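(* Let $n=1$, and let $c:\mathbf{R}\to\mathbf{R}$ satisfy: (A-1) $c(x)>0$ for all $x\in\mathbf{R}$, $c,\,c^{-1}\in L^\infty(\mathbf{R})$, and $\nabla c\in L^\infty(\mathbf{R})$; (A-2) there is a constant $L>0$ such that $c(x)=1$ for $|x|>L$. Set $\eta := 2L\,\|\tfrac{1}{c(\cdot)}\|_\infty\|\nabla c\|_\infty$ and assume $\eta\in[0,1)$. Let $u_0\in H^1(\mathbf{R})$ and $u_1\in L^2(\mathbf{R})$ satisfy $$\int_{\mathbf{R}}(1+|x|)\left(\frac{1}{c(x)^2}|u_1(x)|^2+|\nabla u_0(x)|^2\right)dx<+\infty .$$ Let $u\in C([0,\infty);H^1(\mathbf{R}))\cap C^1([0,\infty);L^2(\mathbf{R}))$ be the unique weak solution of $$u_{tt}-c(x)^2\Delta u=0 \ \text{ in } (0,\infty)\times\mathbf{R},\qquad u(0,x)=u_0(x),\quad u_t(0,x)=u_1(x).$$ Then for each $R>L$, $$E_R(t)=O\big(t^{-(1-\eta)}\big)\quad (t\to\infty),$$ where $E_R(t):=\frac12\int_{|x|\le R}\big(\frac{1}{c(x)^2}|u_t(t,x)|^2+|\nabla u(t,x)|^2\big)dx$.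
   Context: All functions are real valued; in dimension one $\nabla$ is $\frac{d}{dx}$ (or $\frac{\partial}{\partial x}$) and $\Delta$ is $\frac{\partial^2}{\partial x^2}$. $\|\cdot\|_\infty$ is the $L^\infty(\mathbf{R})$-norm. Assumption (A-1) implies that $c$ is Lipschitz continuous. A weak solution is a function $u\in C([0,\infty);H^1(\mathbf{R}))\cap C^1([0,\infty);L^2(\mathbf{R}))$ taking the initial data and satisfying $c(x)^{-2}u_{tt}-\Delta u=0$ in the sense of distributions on $(0,\infty)\times\mathbf{R}$. It is a known fact (taken as given) that under these assumptions on $c$, for $u_0\in H^1$ and $u_1\in L^2$ there is a unique weak solution, and that it conserves the total energy: $E_u(t)=E_u(0)$ for $t\ge 0$, where $E_u(t):=\frac12\int_{\mathbf{R}}\big(c(x)^{-2}|u_t(t,x)|^2+|\nabla u(t,x)|^2\big)dx$. *)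

theory Defs
  imports
    "HOL-Analysis.Analysis"
    "HOL-Library.Landau_Symbols"
    "HOL-Probability.Essential_Supremum"
begin

text \<open>
  Elements of the Lebesgue and Sobolev spaces are represented by functions on the real line,
  two functions that agree almost everywhere standing for the same element.  Every notion below
  that is applied to such functions is invariant under changes on null sets.
\<close>

section \<open>Test functions\<close>

definition partial_deriv :: "'a::euclidean_space \<Rightarrow> ('a \<Rightarrow> real) \<Rightarrow> 'a \<Rightarrow> real" where
  "partial_deriv i f = (\<lambda>z. frechet_derivative f (at z) i)"

primrec Ck :: "nat \<Rightarrow> ('a::euclidean_space \<Rightarrow> real) \<Rightarrow> bool" where
  "Ck 0 f \<longleftrightarrow> continuous_on UNIV f"
| "Ck (Suc k) f \<longleftrightarrow> (\<forall>z. f differentiable (at z)) \<and> (\<forall>i\<in>Basis. Ck k (partial_deriv i f))"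

definition test_functions :: "'a::euclidean_space set \<Rightarrow> ('a \<Rightarrow> real) set" where
  "test_functions \<Omega> = {\<phi>. (\<forall>k. Ck k \<phi>) \<and> compact (closure {z. \<phi> z \<noteq> 0})
                         \<and> closure {z. \<phi> z \<noteq> 0} \<subseteq> \<Omega>}"

section \<open>Function spaces on the real line\<close>

definition L2 :: "(real \<Rightarrow> real) set" where
  "L2 = {f \<in> borel_measurable lebesgue. integrable lebesgue (\<lambda>x. (f x)\<^sup>2)}"

definition L2_norm :: "(real \<Rightarrow> real) \<Rightarrow> real" where
  "L2_norm f = sqrt (LINT x|lebesgue. (f x)\<^sup>2)"

definition Linf :: "(real \<Rightarrow> real) set" where
  "Linf = {f \<in> borel_measurable lebesgue. esssup lebesgue (\<lambda>x. ereal \<bar>f x\<bar>) < \<infinity>}"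

definition Linf_norm :: "(real \<Rightarrow> real) \<Rightarrow> real" where
  "Linf_norm f = real_of_ereal (esssup lebesgue (\<lambda>x. ereal \<bar>f x\<bar>))"

definition locally_integrable :: "(real \<Rightarrow> real) \<Rightarrow> bool" where
  "locally_integrable f \<longleftrightarrow> (\<forall>a b. set_integrable lebesgue {a..b} f)"

definition has_weak_deriv :: "(real \<Rightarrow> real) \<Rightarrow> (real \<Rightarrow> real) \<Rightarrow> bool" where
  "has_weak_deriv f g \<longleftrightarrow> locally_integrable f \<and> locally_integrable g \<and>
     (\<forall>\<phi>\<in>test_functions UNIV.
        (LINT x|lebesgue. f x * deriv \<phi> x) = - (LINT x|lebesgue. g x * \<phi> x))"

definition weakly_differentiable :: "(real \<Rightarrow> real) \<Rightarrow> bool" where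
  "weakly_differentiable f \<longleftrightarrow> (\<exists>g. has_weak_deriv f g)"

text \<open>A representative of the weak derivative, which is unique up to null sets.\<close>

definition weak_deriv :: "(real \<Rightarrow> real) \<Rightarrow> real \<Rightarrow> real" where
  "weak_deriv f = (SOME g. has_weak_deriv f g)"

definition H1 :: "(real \<Rightarrow> real) set" where
  "H1 = {f \<in> L2. weakly_differentiable f \<and> weak_deriv f \<in> L2}"

definition H1_norm :: "(real \<Rightarrow> real) \<Rightarrow> real" where
  "H1_norm f = sqrt ((L2_norm f)\<^sup>2 + (L2_norm (weak_deriv f))\<^sup>2)"

section \<open>Vector-valued functions of time on the half-line\<close>

text \<open>The value \<open>u t\<close> is the function of space at time \<open>t\<close>; only \<open>t \<ge> 0\<close> matters, and at
  \<open>t = 0\<close> limits are one-sided.\<close>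

definition C_L2 :: "(real \<Rightarrow> real \<Rightarrow> real) set" where
  "C_L2 = {u. (\<forall>t\<ge>0. u t \<in> L2) \<and>
     (\<forall>t\<ge>0. ((\<lambda>s. L2_norm (\<lambda>x. u s x - u t x)) \<longlongrightarrow> 0) (at t within {0..}))}"

definition C_H1 :: "(real \<Rightarrow> real \<Rightarrow> real) set" where
  "C_H1 = {u. (\<forall>t\<ge>0. u t \<in> H1) \<and>
     (\<forall>t\<ge>0. ((\<lambda>s. H1_norm (\<lambda>x. u s x - u t x)) \<longlongrightarrow> 0) (at t within {0..}))}"

definition has_time_deriv :: "(real \<Rightarrow> real \<Rightarrow> real) \<Rightarrow> (real \<Rightarrow> real) \<Rightarrow> real \<Rightarrow> bool" where
  "has_time_deriv u v t \<longleftrightarrow> v \<in> L2 \<and>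
     ((\<lambda>s. L2_norm (\<lambda>x. (u s x - u t x) / (s - t) - v x)) \<longlongrightarrow> 0) (at t within {0..})"

text \<open>A representative of the derivative of \<open>u\<close> as an \<open>L2\<close>-valued function of time.\<close>

definition time_deriv :: "(real \<Rightarrow> real \<Rightarrow> real) \<Rightarrow> real \<Rightarrow> real \<Rightarrow> real" where
  "time_deriv u t = (SOME v. has_time_deriv u v t)"

definition C1_L2 :: "(real \<Rightarrow> real \<Rightarrow> real) set" where
  "C1_L2 = {u \<in> C_L2. (\<forall>t\<ge>0. \<exists>v. has_time_deriv u v t) \<and> time_deriv u \<in> C_L2}"

section \<open>The wave equation\<close>

text \<open>
  The equation \<open>c\<^sup>-\<^sup>2 u\<^sub>t\<^sub>t - u\<^sub>x\<^sub>x = 0\<close> in the sense of distributions on \<open>(0,\<infinity>) \<times> \<real>\<close>; the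
  coefficient does not depend on time, so both derivatives fall on the test function.
  The pairing is an iterated integral because the representatives \<open>u t\<close> are chosen separately
  for each \<open>t\<close> and need not be jointly measurable; the inner integral is continuous in \<open>t\<close> for
  \<open>u\<close> in \<open>C_L2\<close> and bounded \<open>1 / c\<close>.
\<close>

definition wave_equation :: "(real \<Rightarrow> real) \<Rightarrow> (real \<Rightarrow> real \<Rightarrow> real) \<Rightarrow> bool" where
  "wave_equation c u \<longleftrightarrow>
     (\<forall>\<phi>\<in>test_functions ({0<..} \<times> UNIV).
        (LINT t:{0<..}|lebesgue. (LINT x|lebesgue.
           u t x * (1 / (c x)\<^sup>2 * partial_deriv (1, 0) (partial_deriv (1, 0) \<phi>) (t, x)
                    - partial_deriv (0, 1) (partial_deriv (0, 1) \<phi>) (t, x)))) = 0)"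

definition weak_solution ::
  "(real \<Rightarrow> real) \<Rightarrow> (real \<Rightarrow> real) \<Rightarrow> (real \<Rightarrow> real) \<Rightarrow> (real \<Rightarrow> real \<Rightarrow> real) \<Rightarrow> bool" where
  "weak_solution c u0 u1 u \<longleftrightarrow> u \<in> C_H1 \<and> u \<in> C1_L2 \<and> wave_equation c u \<and>
     (AE x in lebesgue. u 0 x = u0 x) \<and> (AE x in lebesgue. time_deriv u 0 x = u1 x)"

definition local_energy ::
  "(real \<Rightarrow> real) \<Rightarrow> (real \<Rightarrow> real \<Rightarrow> real) \<Rightarrow> real \<Rightarrow> real \<Rightarrow> real" where
  "local_energy c u R t = 1 / 2 * (LINT x:{x. \<bar>x\<bar> \<le> R}|lebesgue.
     1 / (c x)\<^sup>2 * \<bar>time_deriv u t x\<bar>\<^sup>2 + \<bar>weak_deriv (u t) x\<bar>\<^sup>2)"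

end

theory Submission
  imports Defs "HOL-Real_Asymp.Real_Asymp"
begin

text \<open>
  The local energy decays because energy can neither stay in a bounded set nor come back to it in
  quantity.  Write \<open>\<rho> = c\<^sup>-\<^sup>2\<close>, \<open>v = u\<^sub>t\<close>, \<open>w = u\<^sub>x\<close>, with energy density
  \<open>e = (\<rho> v\<^sup>2 + w\<^sup>2) / 2\<close> and momentum density \<open>\<rho> v w\<close>.  For weights \<open>a\<close> and \<open>b\<close> depending
  on \<open>x\<close>, the time derivative of the integral of \<open>a e + b \<rho> v w\<close> is minus the integral of
  \<open>a' v w + b' w\<^sup>2 / 2 + (b \<rho>)' v\<^sup>2 / 2\<close>.  With \<open>b = x\<close> in \<open>|x| \<le> R\<close> the last two terms are at
  least \<open>(1 - \<eta>) e\<close>, since \<open>2 |x c' / c| \<le> \<eta>\<close>; therefore \<open>a\<close> may grow in time at the rate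
  \<open>1 - \<eta>\<close> there.  Where \<open>c = 1\<close> the wave splits into an inward and an outward moving part, and the
  weights are continued such that the weight of each part decreases along its characteristics.
  The total weighted energy then does not increase on \<open>[0, T]\<close>.  At time \<open>T\<close> it dominates
  \<open>(1 - \<eta>) T\<close> times the local energy, and at time zero it is bounded by the weighted norm of the
  data (\<open>weighted_energy_decay\<close>).  The local energy is thus even \<open>O (1 / T)\<close>, which implies the
  rate \<open>1 - \<eta>\<close> because \<open>\<eta> \<ge> 0\<close>.

  A solution of finite energy is not regular enough for the identity
  (\<open>multiplier_identity\<close>), so it is applied to averages over a time interval of length \<open>h\<close>, whose
  velocity and strain are difference quotients in time of \<open>u\<close> and of the time integral \<open>Y\<close> of
  \<open>u\<^sub>x\<close>.  The wave equation says that \<open>Y\<close> and \<open>u\<close> are conjugate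
  (\<open>conjugate_weak_deriv\<close>), which gives these quotients weak derivatives in \<open>x\<close>; the inequality
  between the weighted energies at the two times survives the limit \<open>h \<rightarrow> 0\<close>
  (\<open>energy_decreasing_weak\<close>).  The curves live in the Hilbert space \<open>l2\<close> of classes of square
  integrable functions, where vector-valued integrals and derivatives are available.
\<close>

section \<open>The Hilbert space of square integrable functions\<close>

lemma L2_D:
  assumes "f \<in> L2"
  shows "f \<in> borel_measurable lebesgue" "integrable lebesgue (\<lambda>x. (f x)\<^sup>2)"
  using assms by (auto simp: L2_def)

lemma L2_mult_integrable:
  assumes "f \<in> L2" "g \<in> L2"
  shows "integrable lebesgue (\<lambda>x. f x * g x)"
proof (rule Bochner_Integration.integrable_bound[where f = "\<lambda>x. (f x)\<^sup>2 + (g x)\<^sup>2"])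
  show "AE x in lebesgue. norm (f x * g x) \<le> norm ((f x)\<^sup>2 + (g x)\<^sup>2)"
  proof (rule AE_I2)
    fix x
    have "\<bar>f x * g x\<bar> \<le> (f x)\<^sup>2 + (g x)\<^sup>2"
      using sum_squares_bound[of "\<bar>f x\<bar>" "\<bar>g x\<bar>"] abs_ge_zero[of "f x * g x"]
      unfolding abs_mult power2_abs by linarith
    then show "norm (f x * g x) \<le> norm ((f x)\<^sup>2 + (g x)\<^sup>2)"
      by simp
  qed
qed (use assms L2_D in auto)

lemma L2_bound:
  assumes "f \<in> L2" "g \<in> borel_measurable lebesgue" "AE x in lebesgue. \<bar>g x\<bar> \<le> B * \<bar>f x\<bar>"
  shows "g \<in> L2"
proof -
  have "integrable lebesgue (\<lambda>x. (g x)\<^sup>2)"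
  proof (rule Bochner_Integration.integrable_bound[where f = "\<lambda>x. B\<^sup>2 * (f x)\<^sup>2"])
    show "AE x in lebesgue. norm ((g x)\<^sup>2) \<le> norm (B\<^sup>2 * (f x)\<^sup>2)"
      using assms(3)
    proof eventually_elim
      case (elim x)
      then have "\<bar>g x\<bar>\<^sup>2 \<le> (B * \<bar>f x\<bar>)\<^sup>2"
        by (intro power_mono) auto
      then show ?case
        by (simp add: power_mult_distrib)
    qed
  qed (use assms L2_D in auto)
  then show ?thesis
    using assms by (auto simp: L2_def)
qed

lemma L2_add: "f \<in> L2 \<Longrightarrow> g \<in> L2 \<Longrightarrow> (\<lambda>x. f x + g x) \<in> L2"
  using L2_mult_integrable[of f g] by (auto simp: L2_def power2_sum mult.assoc)

lemma L2_cmult: "f \<in> L2 \<Longrightarrow> (\<lambda>x. r * f x) \<in> L2"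
  by (auto simp: L2_def power_mult_distrib)

lemma L2_uminus: "f \<in> L2 \<Longrightarrow> (\<lambda>x. - f x) \<in> L2"
  by (auto simp: L2_def)

lemma L2_diff: "f \<in> L2 \<Longrightarrow> g \<in> L2 \<Longrightarrow> (\<lambda>x. f x - g x) \<in> L2"
  using L2_add[OF _ L2_uminus, of f g] by simp

lemma L2_zero: "(\<lambda>x. 0) \<in> L2"
  by (auto simp: L2_def)

lemma L2_divide: "f \<in> L2 \<Longrightarrow> (\<lambda>x. f x / r) \<in> L2"
  using L2_cmult[of f "1 / r"] by simp

lemma L2_cong_AE:
  assumes "f \<in> L2" "g \<in> borel_measurable lebesgue" "AE x in lebesgue. f x = g x"
  shows "g \<in> L2"
  by (rule L2_bound[OF assms(1,2), of 1]) (use assms(3) in auto)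

lemma indicator_L2: "(indicator {a..b} :: real \<Rightarrow> real) \<in> L2"
proof -
  have "integrable lebesgue (indicator {a..b} :: real \<Rightarrow> real)"
    by (cases "a \<le> b") (auto simp: integrable_indicator_iff)
  then show ?thesis
    by (auto simp: L2_def power2_eq_square simp flip: indicator_inter_arith)
qed

lemma L2_absolutely_integrable:
  assumes "f \<in> L2"
  shows "f absolutely_integrable_on {a..b}" "(\<lambda>s. (f s)\<^sup>2) absolutely_integrable_on {a..b}"
proof -
  show "f absolutely_integrable_on {a..b}"
    using L2_mult_integrable[OF indicator_L2 assms] by (simp add: set_integrable_def)
  show "(\<lambda>s. (f s)\<^sup>2) absolutely_integrable_on {a..b}"
    unfolding set_integrable_def using L2_D[OF assms] by (intro integrable_mult_indicator) auto
qed

lemma L2_locally_integrable: "f \<in> L2 \<Longrightarrow> locally_integrable f"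
  by (simp add: locally_integrable_def L2_absolutely_integrable)

text \<open>
  Passing to the quotient by almost everywhere equality makes the whole Banach space calculus
  available: the solution becomes a differentiable curve in a Hilbert space, and it can be
  averaged over time by a vector-valued integral although its representatives are chosen
  separately for each time.
\<close>

quotient_type l2 = "real \<Rightarrow> real" / partial:
  "\<lambda>f g. f \<in> L2 \<and> g \<in> L2 \<and> (AE x in lebesgue. f x = g x)"
  morphisms rep_l2 cls
proof (rule part_equivpI)
  show "\<exists>f. f \<in> L2 \<and> f \<in> L2 \<and> (AE x in lebesgue. f x = f x)"
    using L2_zero by auto
  show "symp (\<lambda>f g. f \<in> L2 \<and> g \<in> L2 \<and> (AE x in lebesgue. f x = g x))"
    by (auto intro!: sympI elim: AE_mp)
  show "transp (\<lambda>f g. f \<in> L2 \<and> g \<in> L2 \<and> (AE x in lebesgue. f x = g x))"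
    by (auto intro!: transpI)
qed

lemma rep_L2: "rep_l2 X \<in> L2"
  using Quotient3_l2 unfolding Quotient3_def by blast

lemma cls_rep: "cls (rep_l2 X) = X"
  using Quotient3_l2 unfolding Quotient3_def by blast

lemma cls_eq_iff:
  "f \<in> L2 \<Longrightarrow> g \<in> L2 \<Longrightarrow> cls f = cls g \<longleftrightarrow> (AE x in lebesgue. f x = g x)"
  using Quotient3_rel[OF Quotient3_l2, of f g] by auto

lemma rep_cls: "f \<in> L2 \<Longrightarrow> AE x in lebesgue. rep_l2 (cls f) x = f x"
  using cls_eq_iff[OF rep_L2, of f "cls f"] cls_rep by auto

lemma cls_exhaust: obtains f where "f \<in> L2" "X = cls f"
  using rep_L2 cls_rep by metis

instantiation l2 :: real_inner
begin

definition "0 = cls (\<lambda>x. 0)"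
definition "X + Y = cls (\<lambda>x. rep_l2 X x + rep_l2 Y x)"
definition "- X = cls (\<lambda>x. - rep_l2 X x)"
definition "X - Y = X + - (Y::l2)"
definition "r *\<^sub>R X = cls (\<lambda>x. r * rep_l2 X x)"
definition "inner X Y = (LINT x|lebesgue. rep_l2 X x * rep_l2 Y x)"
definition "norm (X::l2) = sqrt (inner X X)"
definition "sgn (X::l2) = inverse (norm X) *\<^sub>R X"
definition "dist X Y = norm (X - Y::l2)"
definition "uniformity = (INF e\<in>{0 <..}. principal {(X, Y). dist X (Y::l2) < e})"
definition "open U = (\<forall>X\<in>U. eventually (\<lambda>(X', Y). X' = X \<longrightarrow> Y \<in> U) (uniformity :: (l2 \<times> l2) filter))"

lemma cls_add: "f \<in> L2 \<Longrightarrow> g \<in> L2 \<Longrightarrow> cls f + cls g = cls (\<lambda>x. f x + g x)"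
  unfolding plus_l2_def
  by (subst cls_eq_iff) (use rep_cls[of f] rep_cls[of g] in \<open>auto intro: L2_add rep_L2\<close>)

lemma cls_uminus: "f \<in> L2 \<Longrightarrow> - cls f = cls (\<lambda>x. - f x)"
  unfolding uminus_l2_def
  by (subst cls_eq_iff) (use rep_cls[of f] in \<open>auto intro: L2_uminus rep_L2\<close>)

lemma cls_diff: "f \<in> L2 \<Longrightarrow> g \<in> L2 \<Longrightarrow> cls f - cls g = cls (\<lambda>x. f x - g x)"
  unfolding minus_l2_def by (simp add: cls_uminus cls_add L2_uminus)

lemma cls_scaleR: "f \<in> L2 \<Longrightarrow> r *\<^sub>R cls f = cls (\<lambda>x. r * f x)"
  unfolding scaleR_l2_def
  by (subst cls_eq_iff) (use rep_cls[of f] in \<open>auto intro: L2_cmult rep_L2\<close>)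

lemma cls_inner: "f \<in> L2 \<Longrightarrow> g \<in> L2 \<Longrightarrow> inner (cls f) (cls g) = (LINT x|lebesgue. f x * g x)"
  unfolding inner_l2_def
  by (rule integral_cong_AE) (use rep_cls[of f] rep_cls[of g] in
      \<open>auto intro!: borel_measurable_times simp: L2_D rep_L2\<close>)

instance
proof
  fix X Y Z :: l2 and r s :: real
  obtain f g h where [simp]: "f \<in> L2" "g \<in> L2" "h \<in> L2" and XYZ: "X = cls f" "Y = cls g" "Z = cls h"
    using cls_exhaust by metis
  note [simp] = cls_add cls_uminus cls_diff cls_scaleR cls_inner
    L2_add L2_uminus L2_diff L2_cmult L2_zero L2_mult_integrable
  show "X + Y + Z = X + (Y + Z)" "X + Y = Y + X" "0 + X = X" "- X + X = 0" "X - Y = X + - Y"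
    by (simp_all add: XYZ zero_l2_def algebra_simps)
  show "r *\<^sub>R (X + Y) = r *\<^sub>R X + r *\<^sub>R Y" "(r + s) *\<^sub>R X = r *\<^sub>R X + s *\<^sub>R X"
    "r *\<^sub>R s *\<^sub>R X = (r * s) *\<^sub>R X" "1 *\<^sub>R X = X"
    by (simp_all add: XYZ algebra_simps)
  show "inner X Y = inner Y X" "inner (r *\<^sub>R X) Y = r * inner X Y" "0 \<le> inner X X"
    by (simp_all add: XYZ mult.commute mult.left_commute)
  show "inner (X + Y) Z = inner X Z + inner Y Z"
    by (simp add: XYZ distrib_right)
  show "(inner X X = 0) = (X = 0)"
    using L2_D(2)[of f]
    by (simp add: XYZ zero_l2_def cls_eq_iff integral_nonneg_eq_0_iff_AE flip: power2_eq_square)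
qed (simp_all add: norm_l2_def sgn_l2_def dist_l2_def uniformity_l2_def open_l2_def)

end

lemma norm_cls: "f \<in> L2 \<Longrightarrow> norm (cls f) = L2_norm f"
  by (simp add: norm_l2_def cls_inner L2_norm_def power2_eq_square)

lemma norm_cls_sq: "f \<in> L2 \<Longrightarrow> (norm (cls f))\<^sup>2 = (LINT x|lebesgue. (f x)\<^sup>2)"
  by (simp add: norm_cls L2_norm_def)

text \<open>
  Riesz-Fischer: multiplying by a fixed positive square integrable function turns a Cauchy
  sequence into one that is Cauchy in the mean, hence has an almost everywhere convergent
  subsequence; by Fatou's lemma the pointwise limit is the limit in norm.
\<close>

instance l2 :: complete_space
proof
  fix X :: "nat \<Rightarrow> l2"
  assume "Cauchy X"
  define s where "s n = rep_l2 (X n)" for n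
  have s: "s n \<in> L2" and X: "X n = cls (s n)" for n
    by (simp_all add: s_def rep_L2 cls_rep)
  have [measurable]: "s n \<in> borel_measurable lebesgue" for n
    using L2_D(1)[OF s] .
  obtain w0 :: "real \<Rightarrow> real" where w0: "w0 \<in> borel_measurable lborel" "\<And>x. 0 < w0 x" "\<And>x. w0 x \<le> 1"
      "integrable lborel w0"
    using sigma_finite_measure.obtain_positive_integrable_function[OF lborel.sigma_finite_measure_axioms] by blast
  have w0m [measurable]: "w0 \<in> borel_measurable lebesgue"
    using w0(1) measurable_completion by blast
  have w0i: "integrable lebesgue w0"
    using w0(1,4) integrable_completion by blast
  have wL2: "w0 \<in> L2"
    unfolding L2_def
  proof (safe intro!: w0m Bochner_Integration.integrable_bound[OF w0i])
    show "AE x in lebesgue. norm ((w0 x)\<^sup>2) \<le> norm (w0 x)"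
      using w0(2,3) by (auto intro!: AE_I2 simp: power2_eq_square mult_left_le less_imp_le)
  qed measurable
  define W where "W = cls w0"
  obtain r where r: "strict_mono r" "AE x in lebesgue. Cauchy (\<lambda>i. s (r i) x * w0 x)"
  proof (rule cauchy_L1_AE_cauchy_subseq[of lebesgue "\<lambda>n x. s n x * w0 x"])
    show "integrable lebesgue (\<lambda>x. s n x * w0 x)" for n
      using L2_mult_integrable s wL2 by blast
    fix e :: real assume "e > 0"
    have "norm W + 1 > 0"
      by (smt (verit) norm_ge_zero)
    then have "e / (norm W + 1) > 0"
      using \<open>e > 0\<close> by simp
    then obtain N where N: "\<And>i j. i \<ge> N \<Longrightarrow> j \<ge> N \<Longrightarrow> norm (X i - X j) < e / (norm W + 1)"
      using \<open>Cauchy X\<close> unfolding Cauchy_def dist_norm by metis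
    have "(LINT x|lebesgue. norm (s i x * w0 x - s j x * w0 x)) < e" if "i \<ge> N" "j \<ge> N" for i j
    proof -
      have d: "(\<lambda>x. \<bar>s i x - s j x\<bar>) \<in> L2"
        using L2_diff[OF s[of i] s[of j]] by (auto simp: L2_def)
      have "(LINT x|lebesgue. norm (s i x * w0 x - s j x * w0 x)) = (LINT x|lebesgue. \<bar>s i x - s j x\<bar> * w0 x)"
        using w0(2) by (intro Bochner_Integration.integral_cong)
          (auto simp: abs_mult less_imp_le simp flip: left_diff_distrib)
      also have "\<dots> = inner (cls (\<lambda>x. \<bar>s i x - s j x\<bar>)) W"
        using d wL2 by (simp add: W_def cls_inner)
      also have "\<dots> \<le> norm (cls (\<lambda>x. \<bar>s i x - s j x\<bar>)) * norm W"
        by (rule norm_cauchy_schwarz)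
      also have "norm (cls (\<lambda>x. \<bar>s i x - s j x\<bar>)) = norm (X i - X j)"
        using d L2_diff[OF s[of i] s[of j]] by (simp add: X cls_diff s norm_cls L2_norm_def)
      also have "\<dots> * norm W \<le> norm (X i - X j) * (norm W + 1)"
        by (intro mult_left_mono) auto
      also have "\<dots> < e"
        using N[OF that] \<open>norm W + 1 > 0\<close> by (simp add: pos_less_divide_eq)
      finally show ?thesis .
    qed
    then show "\<exists>N. \<forall>i\<ge>N. \<forall>j\<ge>N. (LINT x|lebesgue. norm (s i x * w0 x - s j x * w0 x)) < e"
      by blast
  qed blast
  define f where "f x = lim (\<lambda>i. s (r i) x)" for x
  have [measurable]: "f \<in> borel_measurable lebesgue"
    unfolding f_def by measurable
  have lim: "AE x in lebesgue. (\<lambda>i. s (r i) x) \<longlonglongrightarrow> f x"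
    using r(2)
  proof eventually_elim
    case (elim x)
    then have "convergent (\<lambda>i. s (r i) x * w0 x)"
      by (simp add: Cauchy_convergent_iff)
    then have "convergent (\<lambda>i. s (r i) x * w0 x * (1 / w0 x))"
      by (rule convergent_mult[OF _ convergent_const])
    moreover have "(\<lambda>i. s (r i) x * w0 x * (1 / w0 x)) = (\<lambda>i. s (r i) x)"
      using w0(2)[of x] by auto
    ultimately have "convergent (\<lambda>i. s (r i) x)"
      by metis
    then show ?case
      by (simp add: f_def convergent_LIMSEQ_iff)
  qed
  have fatou: "(\<lambda>x. s n x - f x) \<in> L2 \<and> L2_norm (\<lambda>x. s n x - f x) \<le> e"
    if e: "e \<ge> 0" and n: "\<And>i. i \<ge> n \<Longrightarrow> norm (X n - X i) \<le> e" for n e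
  proof -
    have ri: "r i \<ge> i" for i
      using r(1) by (simp add: seq_suble)
    have "(\<integral>\<^sup>+x. ennreal ((s n x - f x)\<^sup>2) \<partial>lebesgue)
        = (\<integral>\<^sup>+x. liminf (\<lambda>i. ennreal ((s n x - s (r i) x)\<^sup>2)) \<partial>lebesgue)"
    proof (rule nn_integral_cong_AE)
      show "AE x in lebesgue. ennreal ((s n x - f x)\<^sup>2) = liminf (\<lambda>i. ennreal ((s n x - s (r i) x)\<^sup>2))"
        using lim
      proof eventually_elim
        case (elim x)
        then have "(\<lambda>i. ennreal ((s n x - s (r i) x)\<^sup>2)) \<longlonglongrightarrow> ennreal ((s n x - f x)\<^sup>2)"
          by (intro tendsto_ennrealI tendsto_intros)
        then show ?case
          by (rule lim_imp_Liminf[OF sequentially_bot, symmetric])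
      qed
    qed
    also have "\<dots> \<le> liminf (\<lambda>i. \<integral>\<^sup>+x. ennreal ((s n x - s (r i) x)\<^sup>2) \<partial>lebesgue)"
      by (rule nn_integral_liminf) measurable
    also have "\<dots> \<le> ennreal (e\<^sup>2)"
    proof (rule Liminf_le)
      have "(\<integral>\<^sup>+x. ennreal ((s n x - s (r i) x)\<^sup>2) \<partial>lebesgue) \<le> ennreal (e\<^sup>2)" if "i \<ge> n" for i
      proof -
        have d: "(\<lambda>x. s n x - s (r i) x) \<in> L2"
          using s L2_diff by blast
        have "(\<integral>\<^sup>+x. ennreal ((s n x - s (r i) x)\<^sup>2) \<partial>lebesgue)
            = ennreal (LINT x|lebesgue. (s n x - s (r i) x)\<^sup>2)"
          using L2_D(2)[OF d] by (intro nn_integral_eq_integral) auto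
        also have "(LINT x|lebesgue. (s n x - s (r i) x)\<^sup>2) = (norm (X n - X (r i)))\<^sup>2"
          using d by (simp add: X cls_diff s norm_cls_sq)
        also have "\<dots> \<le> e\<^sup>2"
          using n[of "r i"] ri[of i] that by (intro power_mono) auto
        finally show ?thesis
          by (simp add: ennreal_leI)
      qed
      then show "\<forall>\<^sub>F i in sequentially. (\<integral>\<^sup>+x. ennreal ((s n x - s (r i) x)\<^sup>2) \<partial>lebesgue) \<le> ennreal (e\<^sup>2)"
        using eventually_sequentially by blast
    qed simp
    finally have le: "(\<integral>\<^sup>+x. ennreal ((s n x - f x)\<^sup>2) \<partial>lebesgue) \<le> ennreal (e\<^sup>2)" .
    have int: "integrable lebesgue (\<lambda>x. (s n x - f x)\<^sup>2)"
      using le by (intro integrableI_bounded) (auto simp: top_unique less_top[symmetric])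
    have "(LINT x|lebesgue. (s n x - f x)\<^sup>2) \<le> e\<^sup>2"
      using le nn_integral_eq_integral[OF int] by (simp add: ennreal_le_iff)
    then have "L2_norm (\<lambda>x. s n x - f x) \<le> e"
      unfolding L2_norm_def using e real_le_lsqrt by (simp add: real_sqrt_le_iff real_le_lsqrt)
    moreover have "(\<lambda>x. s n x - f x) \<in> L2"
      using int by (auto simp: L2_def)
    ultimately show ?thesis
      by blast
  qed
  have ev: "\<exists>N. \<forall>n\<ge>N. (\<lambda>x. s n x - f x) \<in> L2 \<and> L2_norm (\<lambda>x. s n x - f x) \<le> e" if "e > 0" for e
  proof -
    obtain N where N: "\<And>i j. i \<ge> N \<Longrightarrow> j \<ge> N \<Longrightarrow> norm (X i - X j) < e"
      using \<open>Cauchy X\<close> \<open>e > 0\<close> unfolding Cauchy_def dist_norm by metis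
    have "(\<lambda>x. s n x - f x) \<in> L2 \<and> L2_norm (\<lambda>x. s n x - f x) \<le> e" if "n \<ge> N" for n
      using that \<open>e > 0\<close> by (intro fatou) (auto intro!: less_imp_le[OF N])
    then show ?thesis by blast
  qed
  obtain N where "(\<lambda>x. s N x - f x) \<in> L2"
    using ev[of 1] by auto
  then have f: "f \<in> L2"
    using L2_diff[OF s[of N], of "\<lambda>x. s N x - f x"] by simp
  have "X \<longlonglongrightarrow> cls f"
  proof (rule LIMSEQ_I)
    fix e :: real assume "e > 0"
    then obtain N where "\<And>n. n \<ge> N \<Longrightarrow> L2_norm (\<lambda>x. s n x - f x) \<le> e / 2"
      using ev[of "e / 2"] by auto
    moreover have "norm (X n - cls f) = L2_norm (\<lambda>x. s n x - f x)" for n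
      using f s by (simp add: X cls_diff norm_cls L2_diff)
    ultimately have "norm (X n - cls f) \<le> e / 2" if "n \<ge> N" for n
      using that by simp
    then have "norm (X n - cls f) < e" if "n \<ge> N" for n
      using that \<open>e > 0\<close> by (smt (verit) field_sum_of_halves)
    then show "\<exists>N. \<forall>n\<ge>N. norm (X n - cls f) < e"
      by blast
  qed
  then show "convergent X"
    unfolding convergent_def by blast
qed

instance l2 :: banach ..

section \<open>Test functions\<close>

lemma partial_deriv_real: "partial_deriv 1 (f :: real \<Rightarrow> real) = deriv f"
  if "\<forall>z. f differentiable (at z)"
proof
  fix z
  have "(f has_derivative (\<lambda>h. deriv f z * h)) (at z)"
    using that DERIV_deriv_iff_real_differentiable[of f z] by (simp add: has_field_derivative_def)
  then have "frechet_derivative f (at z) = (\<lambda>h. deriv f z * h)"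
    using frechet_derivative_at by metis
  then show "partial_deriv 1 f z = deriv f z"
    by (simp add: partial_deriv_def)
qed

lemma Ck_Suc_real:
  "Ck (Suc k) (f :: real \<Rightarrow> real) \<longleftrightarrow> (\<forall>z. f differentiable (at z)) \<and> Ck k (deriv f)"
  by (auto simp: partial_deriv_real)

lemma Ck_SucI_real:
  assumes "\<And>x. (f has_real_derivative f' x) (at x)" "Ck k f'"
  shows "Ck (Suc k) f"
proof -
  have "deriv f = f'"
    using assms(1) by (auto intro: DERIV_imp_deriv)
  then show ?thesis
    using assms real_differentiable_def unfolding Ck_Suc_real by blast
qed

lemma Ck_decrease: "Ck (Suc k) (f :: 'a::euclidean_space \<Rightarrow> real) \<Longrightarrow> Ck k f"
proof (induction k arbitrary: f)
  case 0
  then show ?case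
    by (auto intro: continuous_at_imp_continuous_on differentiable_imp_continuous_within)
next
  case (Suc k)
  then show ?case
    by (metis Ck.simps(2))
qed

lemma Ck_add: "Ck k f \<Longrightarrow> Ck k g \<Longrightarrow> Ck k (\<lambda>x::real. f x + g x)"
proof (induction k arbitrary: f g)
  case 0
  then show ?case by (auto intro: continuous_intros)
next
  case (Suc k)
  then show ?case
    unfolding Ck_Suc_real
    by (intro conjI iffD1[OF Ck_Suc_real, THEN conjunct1] iffD1[OF Ck_Suc_real, THEN conjunct2]
        Ck_SucI_real[where f' = "\<lambda>x. deriv f x + deriv g x"])
      (auto intro!: derivative_eq_intros simp: DERIV_deriv_iff_real_differentiable)
qed

lemma Ck_mult: "Ck k f \<Longrightarrow> Ck k g \<Longrightarrow> Ck k (\<lambda>x::real. f x * g x)"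
proof (induction k arbitrary: f g)
  case 0
  then show ?case by (auto intro: continuous_intros)
next
  case (Suc k)
  have k: "Ck k f" "Ck k g"
    by (rule Suc.prems[THEN Ck_decrease])+
  show ?case
  proof (rule Ck_SucI_real)
    show "((\<lambda>x. f x * g x) has_real_derivative deriv f x * g x + deriv g x * f x) (at x)" for x
      using Suc.prems unfolding Ck_Suc_real
      by (auto intro!: derivative_eq_intros simp: DERIV_deriv_iff_real_differentiable)
    show "Ck k (\<lambda>x. deriv f x * g x + deriv g x * f x)"
      using Suc k unfolding Ck_Suc_real by (intro Ck_add Suc.IH) auto
  qed
qed

lemma Ck_const: "Ck k (\<lambda>x::real. r)"
  by (induction k arbitrary: r) (auto intro: Ck_SucI_real[where f' = "\<lambda>x. 0"] simp del: Ck.simps(2))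

lemma Ck_affine:
  "Ck k f \<Longrightarrow> Ck k (\<lambda>x::real. f (r * x + s))"
proof (induction k arbitrary: f)
  case 0
  then show ?case
    unfolding Ck.simps(1)
    by (intro continuous_on_compose2[of UNIV f UNIV "\<lambda>x. r * x + s"] continuous_intros) auto
next
  case (Suc k)
  show ?case
  proof (rule Ck_SucI_real)
    have der: "(f has_real_derivative deriv f y) (at y)" for y
      using Suc.prems unfolding Ck_Suc_real by (simp add: DERIV_deriv_iff_real_differentiable)
    show "((\<lambda>x. f (r * x + s)) has_real_derivative deriv f (r * x + s) * r) (at x)" for x
      by (rule DERIV_chain2[OF der]) (auto intro!: derivative_eq_intros)
    show "Ck k (\<lambda>x. deriv f (r * x + s) * r)"
      using Suc unfolding Ck_Suc_real by (intro Ck_mult Ck_const Suc.IH) auto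
  qed
qed

definition exp_recip :: "real poly \<Rightarrow> real \<Rightarrow> real" where
  "exp_recip p x = (if x > 0 then poly p (1 / x) * exp (- (1 / x)) else 0)"

lemma exp_recip_limit: "((\<lambda>x. poly p (1 / x) * exp (- (1 / x))) \<longlongrightarrow> 0) (at_right (0::real))"
proof -
  have "((\<lambda>y. poly p y * exp (- y)) \<longlongrightarrow> 0) (at_top :: real filter)"
  proof -
    have "((\<lambda>y. \<Sum>i\<le>degree p. coeff p i * (y ^ i / exp y)) \<longlongrightarrow> (\<Sum>i\<le>degree p. coeff p i * 0))
        (at_top :: real filter)"
      by (intro tendsto_sum tendsto_mult tendsto_const tendsto_power_div_exp_0)
    then show ?thesis
      by (simp add: poly_altdef exp_minus divide_inverse sum_distrib_right mult.assoc)
  qed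
  then show ?thesis
    using filterlim_compose[OF _ filterlim_inverse_at_top_right, of "\<lambda>y. poly p y * exp (- y)"]
    by (simp add: inverse_eq_divide)
qed

text \<open>
  The functions \<open>p (1 / x) exp (- 1 / x)\<close>, extended by zero, form a class that is closed under
  differentiation, so all of them are smooth.
\<close>

lemma exp_recip_deriv:
  "(exp_recip p has_real_derivative exp_recip ([:0, 0, 1:] * (p - pderiv p)) x) (at x)"
proof -
  consider "x > 0" | "x < 0" | "x = 0" by linarith
  then show ?thesis
  proof cases
    case 1
    have "((\<lambda>x. poly p (1 / x) * exp (- (1 / x))) has_real_derivative
        poly (pderiv p) (1 / x) * (- (1 / x\<^sup>2)) * exp (- (1 / x))
        + poly p (1 / x) * (exp (- (1 / x)) * (1 / x\<^sup>2))) (at x)"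
      using 1 by (auto intro!: derivative_eq_intros poly_DERIV[THEN DERIV_chain2] simp: power2_eq_square)
    also have "poly (pderiv p) (1 / x) * (- (1 / x\<^sup>2)) * exp (- (1 / x))
        + poly p (1 / x) * (exp (- (1 / x)) * (1 / x\<^sup>2)) = exp_recip ([:0, 0, 1:] * (p - pderiv p)) x"
      using 1 by (simp add: exp_recip_def field_simps power2_eq_square)
    finally show ?thesis
      by (rule has_field_derivative_transform_within_open[of _ _ _ "{0<..}"])
        (use 1 in \<open>auto simp: exp_recip_def\<close>)
  next
    case 2
    have "((\<lambda>x. 0) has_real_derivative 0) (at x)"
      by simp
    then have "(exp_recip p has_real_derivative 0) (at x)"
      by (rule has_field_derivative_transform_within_open[of _ _ _ "{..<0}"])
        (use 2 in \<open>auto simp: exp_recip_def\<close>)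
    then show ?thesis
      using 2 by (simp add: exp_recip_def)
  next
    case 3
    have "((\<lambda>h. exp_recip p h / h) \<longlongrightarrow> 0) (at 0)"
    proof (rule filterlim_split_at)
      show "((\<lambda>h. exp_recip p h / h) \<longlongrightarrow> 0) (at_left 0)"
        by (rule tendsto_eventually) (auto simp: exp_recip_def eventually_at_left_field intro!: exI[of _ "-1"])
      show "((\<lambda>h. exp_recip p h / h) \<longlongrightarrow> 0) (at_right 0)"
      proof (rule Lim_transform_eventually[OF exp_recip_limit[of "[:0, 1:] * p"]])
        show "\<forall>\<^sub>F x in at_right 0. poly ([:0, 1:] * p) (1 / x) * exp (- (1 / x)) = exp_recip p x / x"
          unfolding eventually_at_right_field by (intro exI[of _ 1]) (auto simp: exp_recip_def)
      qed
    qed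
    then show ?thesis
      unfolding 3 has_field_derivative_iff by (simp add: exp_recip_def)
  qed
qed

lemma Ck_exp_recip: "Ck k (exp_recip p)"
proof (induction k arbitrary: p)
  case 0
  then show ?case
    using exp_recip_deriv[THEN DERIV_isCont] by (simp add: continuous_at_imp_continuous_on)
qed (blast intro: Ck_SucI_real exp_recip_deriv)

text \<open>
  Rescaling both factors by \<open>n + 1\<close> makes them tend to one on the open interval, where the value at
  \<open>n = 0\<close> is already positive: the bumps approximate the indicator function boundedly without
  having a plateau.
\<close>

definition bump :: "real \<Rightarrow> real \<Rightarrow> nat \<Rightarrow> real \<Rightarrow> real" where
  "bump a b n x = exp_recip 1 (real (Suc n) * (x - a)) * exp_recip 1 (real (Suc n) * (b - x))"

lemma bump_range: "0 \<le> bump a b n x" "bump a b n x \<le> 1"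
  by (auto simp: bump_def exp_recip_def mult_le_one)

lemma bump_pos_iff: "bump a b n x \<noteq> 0 \<longleftrightarrow> a < x \<and> x < b"
  by (auto simp: bump_def exp_recip_def zero_less_mult_iff)

lemma bump_limit: "(\<lambda>n. bump a b n x) \<longlonglongrightarrow> indicator {a<..<b} x"
proof (cases "a < x \<and> x < b")
  case True
  have lim: "(\<lambda>n. exp (- (1 / (real (Suc n) * y)))) \<longlonglongrightarrow> exp (- 0)" if "y > 0" for y :: real
    using that by (intro tendsto_exp tendsto_minus) real_asymp
  have "(\<lambda>n. exp (- (1 / (real (Suc n) * (x - a)))) * exp (- (1 / (real (Suc n) * (b - x))))) \<longlonglongrightarrow> exp (-0) * exp (-0)"
    using True by (intro tendsto_mult lim) auto
  with True show ?thesis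
    by (simp add: bump_def exp_recip_def zero_less_mult_iff del: of_nat_Suc)
next
  case False
  then have "bump a b n x = 0" for n
    using bump_pos_iff by metis
  with False show ?thesis by (auto simp: indicator_def)
qed

lemma Ck_bump: "Ck k (bump a b n)"
proof -
  have "Ck k (\<lambda>x. exp_recip 1 (real (Suc n) * x + - (real (Suc n) * a)) * exp_recip 1 (- real (Suc n) * x + real (Suc n) * b))"
    by (intro Ck_mult Ck_affine Ck_exp_recip)
  also have "(\<lambda>x. exp_recip 1 (real (Suc n) * x + - (real (Suc n) * a)) * exp_recip 1 (- real (Suc n) * x + real (Suc n) * b)) = bump a b n"
    by (rule ext) (simp add: bump_def algebra_simps)
  finally show ?thesis .
qed

lemma test_functionsI:
  assumes "\<And>k. Ck k \<phi>" "\<And>x. \<phi> x \<noteq> 0 \<Longrightarrow> x \<in> {a..b}" "{a..b} \<subseteq> \<Omega>"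
  shows "\<phi> \<in> test_functions (\<Omega> :: real set)"
proof -
  have "closure {z. \<phi> z \<noteq> 0} \<subseteq> {a..b}"
    using assms(2) by (intro closure_minimal) auto
  then show ?thesis
    using assms unfolding test_functions_def
    by (simp add: compact_eq_bounded_closed bounded_subset[of "{a..b}"] subset_trans[of _ "{a..b}"])
qed

lemma test_functionsD:
  assumes "\<phi> \<in> test_functions (\<Omega> :: real set)"
  shows "Ck k \<phi>" "\<phi> differentiable (at x)" "continuous_on UNIV \<phi>" "continuous_on UNIV (deriv \<phi>)"
    "(\<phi> has_real_derivative deriv \<phi> x) (at x)"
proof -
  show *: "Ck k \<phi>" for k
    using assms by (auto simp: test_functions_def)
  show "\<phi> differentiable (at x)" "continuous_on UNIV \<phi>" "continuous_on UNIV (deriv \<phi>)"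
    using *[of 0] *[of 1] Ck_Suc_real[of 0 \<phi>] by auto
  then show "(\<phi> has_real_derivative deriv \<phi> x) (at x)"
    by (simp add: DERIV_deriv_iff_real_differentiable)
qed

lemma deriv_eq_0_outside_closure:
  assumes "x \<notin> closure {z. \<phi> z \<noteq> 0}"
  shows "deriv \<phi> x = (0::real)"
proof -
  have "((\<lambda>x. 0) has_real_derivative 0) (at x)"
    by simp
  then have "(\<phi> has_real_derivative 0) (at x)"
    by (rule has_field_derivative_transform_within_open[of _ _ _ "- closure {z. \<phi> z \<noteq> 0}"])
      (use assms closure_subset[of "{z. \<phi> z \<noteq> 0}"] in auto)
  then show ?thesis
    by (rule DERIV_imp_deriv)
qed

lemma test_functions_deriv:
  assumes "\<phi> \<in> test_functions (\<Omega> :: real set)"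
  shows "deriv \<phi> \<in> test_functions \<Omega>"
proof -
  have "{z. deriv \<phi> z \<noteq> 0} \<subseteq> closure {z. \<phi> z \<noteq> 0}"
    using deriv_eq_0_outside_closure by blast
  then have sub: "closure {z. deriv \<phi> z \<noteq> 0} \<subseteq> closure {z. \<phi> z \<noteq> 0}"
    by (intro closure_minimal) auto
  have "Ck k (deriv \<phi>)" for k
    using test_functionsD(1)[OF assms, of "Suc k"] Ck_Suc_real by blast
  then show ?thesis
    using assms sub unfolding test_functions_def
    by (simp add: compact_eq_bounded_closed) (meson bounded_subset subset_trans)
qed

lemma test_functions_bounds:
  assumes "\<phi> \<in> test_functions (\<Omega> :: real set)"
  obtains M B where "M > 0" "\<And>x. \<bar>\<phi> x\<bar> \<le> B" "\<And>x. \<bar>x\<bar> > M \<Longrightarrow> \<phi> x = 0"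
proof -
  have c: "compact (closure {z. \<phi> z \<noteq> 0})"
    using assms by (auto simp: test_functions_def)
  obtain M where M: "M > 0" "\<And>x. x \<in> closure {z. \<phi> z \<noteq> 0} \<Longrightarrow> \<bar>x\<bar> \<le> M"
    using compact_imp_bounded[OF c] unfolding bounded_pos by auto
  have "compact (\<phi> ` {-M..M})"
    by (intro compact_continuous_image continuous_on_subset[OF test_functionsD(3)[OF assms]]) auto
  then obtain B where B: "\<And>x. x \<in> {-M..M} \<Longrightarrow> \<bar>\<phi> x\<bar> \<le> B"
    using compact_imp_bounded bounded_iff by (metis image_eqI real_norm_def)
  have zero: "\<phi> x = 0" if "\<bar>x\<bar> > M" for x
    using M(2)[of x] that closure_subset by force
  have "0 \<le> B"
    using B[of 0] M(1) by auto
  then have "\<bar>\<phi> x\<bar> \<le> B" for x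
    using B[of x] zero[of x] by (cases "\<bar>x\<bar> > M") (auto simp: abs_le_iff not_less minus_le_iff)
  with that M(1) zero show ?thesis
    by blast
qed

lemma borel_imp_lebesgue_measurable:
  "f \<in> borel_measurable borel \<Longrightarrow> f \<in> borel_measurable lebesgue"
  by (rule measurable_completion) simp

lemma test_functions_L2:
  assumes "\<phi> \<in> test_functions (\<Omega> :: real set)"
  shows "\<phi> \<in> L2"
proof -
  obtain M B where MB: "M > 0" "\<And>x. \<bar>\<phi> x\<bar> \<le> B" "\<And>x. \<bar>x\<bar> > M \<Longrightarrow> \<phi> x = 0"
    using test_functions_bounds[OF assms] by blast
  have m [measurable]: "\<phi> \<in> borel_measurable lebesgue"
    by (intro borel_imp_lebesgue_measurable borel_measurable_continuous_onI test_functionsD(3)[OF assms])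
  show ?thesis
    by (rule L2_bound[OF indicator_L2[of "- M" M] m, of B]) (use MB in \<open>auto simp: indicator_def abs_le_iff not_le\<close>)
qed

section \<open>The fundamental lemma of the calculus of variations\<close>

lemma bump_test:
  assumes "{a..b} \<subseteq> \<Omega>"
  shows "bump a b n \<in> test_functions \<Omega>"
  using Ck_bump bump_pos_iff[of a b n] assms by (intro test_functionsI[of _ a b]) (auto simp: less_imp_le)

lemma integral_bump_limit:
  assumes "locally_integrable f"
  shows "(\<lambda>n. LINT x|lebesgue. f x * bump a b n x) \<longlonglongrightarrow> (LINT x:{a..b}|lebesgue. f x)"
proof -
  have i: "integrable lebesgue (\<lambda>x. indicator {a..b} x * f x)"
    using assms by (simp add: locally_integrable_def set_integrable_def)
  have [measurable]: "bump a b n \<in> borel_measurable lebesgue" for n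
    using test_functions_L2[OF bump_test, of a b UNIV] L2_D by blast
  have m: "(\<lambda>x. indicator {a..b} x * f x) \<in> borel_measurable lebesgue"
    using i by auto
  have eq: "indicator {a..b} x * f x * bump a b n x = f x * bump a b n x" for n x
    using bump_pos_iff[of a b n x] by (auto simp: indicator_def)
  have "(\<lambda>n. LINT x|lebesgue. (indicator {a..b} x * f x) * bump a b n x) \<longlonglongrightarrow>
      (LINT x|lebesgue. (indicator {a..b} x * f x) * indicator {a<..<b} x)"
  proof (rule integral_dominated_convergence[where w = "\<lambda>x. \<bar>indicator {a..b} x * f x\<bar>"])
    show "AE x in lebesgue. norm (indicator {a..b} x * f x * bump a b n x) \<le> \<bar>indicator {a..b} x * f x\<bar>" for n
      using bump_range[of a b n] by (intro AE_I2) (auto simp: abs_mult intro!: mult_left_le)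
    show "(\<lambda>x. indicator {a..b} x * f x * bump a b n x) \<in> borel_measurable lebesgue" for n
      using m by measurable
    show "AE x in lebesgue. (\<lambda>n. indicator {a..b} x * f x * bump a b n x) \<longlonglongrightarrow> indicator {a..b} x * f x * indicator {a<..<b} x"
      by (intro AE_I2 tendsto_mult tendsto_const bump_limit)
  next
    show "(\<lambda>x. indicator {a..b} x * f x * indicator {a<..<b} x) \<in> borel_measurable lebesgue"
      by (intro borel_measurable_times[OF m] borel_measurable_indicator) simp
    show "integrable lebesgue (\<lambda>x. \<bar>indicator {a..b} x * f x\<bar>)"
      using i by (rule integrable_abs)
  qed
  also have "(LINT x|lebesgue. (indicator {a..b} x * f x) * indicator {a<..<b} x) = (LINT x:{a..b}|lebesgue. f x)"
    unfolding set_lebesgue_integral_def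
  proof (rule integral_cong_AE)
    have "AE x in lebesgue. x \<noteq> a" "AE x in lebesgue. x \<noteq> b"
      by (auto intro!: AE_completion AE_lborel_singleton)
    then show "AE x in lebesgue. indicator {a..b} x * f x * indicator {a<..<b} x = indicator {a..b} x *\<^sub>R f x"
      by eventually_elim (auto simp: indicator_def)
  next
    show "(\<lambda>x. indicator {a..b} x * f x * indicator {a<..<b} x) \<in> borel_measurable lebesgue"
      by (intro borel_measurable_times[OF m] borel_measurable_indicator) simp
    show "(\<lambda>x. indicator {a..b} x *\<^sub>R f x) \<in> borel_measurable lebesgue"
      using m by simp
  qed
  finally show ?thesis
    by (simp add: eq)
qed

text \<open>
  The sets over which \<open>f\<close> integrates to zero form a Dynkin system; containing the intervals, it
  contains all Borel sets.
\<close>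

lemma AE_zero_if_integral_intervals_zero:
  assumes f: "locally_integrable f" and zero: "\<And>a b. a \<le> b \<Longrightarrow> (LINT x:{a..b}|lebesgue. f x) = 0"
  shows "AE x in lebesgue. f x = 0"
proof -
  have "AE x in lebesgue. x \<in> {-real n..real n} \<longrightarrow> f x = 0" for n
  proof -
    let ?J = "{-real n..real n}"
    define fn where "fn = (\<lambda>x. indicator ?J x * f x)"
    have fn: "integrable lebesgue fn"
      using f by (simp add: locally_integrable_def set_integrable_def fn_def)
    then have [measurable]: "fn \<in> borel_measurable lebesgue"
      by simp
    obtain g where g [measurable]: "g \<in> borel_measurable lborel" and eq: "AE x in lborel. fn x = g x"
      using completion_ex_borel_measurable_real[of fn lborel] by auto
    have eq': "AE x in lebesgue. fn x = g x"
      using eq by (rule AE_completion)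
    have gm: "g \<in> borel_measurable lebesgue"
      using g measurable_completion by blast
    have gi: "integrable lborel g"
      using fn integrable_cong_AE[OF _ gm eq'] integrable_completion[of g lborel] by simp
    have lint: "(LINT x:A|lborel. g x) = (LINT x|lebesgue. indicator A x * fn x)" if "A \<in> sets borel" for A
    proof -
      have "(LINT x:A|lborel. g x) = (LINT x|lebesgue. indicator A x * g x)"
        using that by (simp add: set_lebesgue_integral_def integral_completion)
      also have "\<dots> = (LINT x|lebesgue. indicator A x * fn x)"
        using eq' that
        by (intro integral_cong_AE borel_measurable_times[OF borel_measurable_indicator] gm) auto
      finally show ?thesis .
    qed
    have Icc: "(LINT x:{a..b}|lborel. g x) = 0" for a b
    proof -
      have "(\<lambda>x. indicator {a..b} x * fn x) = (\<lambda>x. indicator {max a (-real n)..min b (real n)} x * f x)"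
        by (rule ext) (auto simp: fn_def indicator_def)
      moreover have "(LINT x|lebesgue. indicator {max a (-real n)..min b (real n)} x * f x) = 0"
        using zero[of "max a (-real n)" "min b (real n)"]
        by (cases "max a (-real n) \<le> min b (real n)") (auto simp: set_lebesgue_integral_def)
      ultimately show ?thesis
        using lint[of "{a..b}"] by simp
    qed
    have total: "(LINT x|lborel. g x) = 0"
    proof -
      have "(LINT x:UNIV|lborel. g x) = (LINT x|lebesgue. indicator ?J x * fn x)"
        by (subst lint) (auto intro!: Bochner_Integration.integral_cong simp: fn_def indicator_def)
      also have "\<dots> = (LINT x:?J|lborel. g x)"
        by (simp add: lint)
      finally show ?thesis
        using Icc[of "-real n" "real n"] by (simp add: set_lebesgue_integral_def)
    qed
    have gA: "set_integrable lborel A g" if "A \<in> sets borel" for A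
      using that gi unfolding set_integrable_def by (intro integrable_mult_indicator) auto
    have sets: "sets lborel = sigma_sets UNIV (range (\<lambda>(a::real, b). {a..b}))"
      using borel_eq_atLeastAtMost by (simp add: borel_eq_atLeastAtMost)
    have "(LINT x:A|lborel. g x) = 0" if "A \<in> sets lborel" for A
    proof -
      have "A \<in> sigma_sets UNIV (range (\<lambda>(a::real, b). {a..b}))"
        using that unfolding sets .
      then show ?thesis
      proof (induction rule: sigma_sets_induct_disjoint[rotated 2, consumes 1, case_names basic empty compl union])
        case (basic A)
        then show ?case using Icc by auto
      next
        case empty
        then show ?case by (simp add: set_lebesgue_integral_def)
      next
        case (compl A)
        then have "A \<in> sets borel"
          using sets by simp
        then have "(LINT x:UNIV|lborel. g x) = (LINT x:A|lborel. g x) + (LINT x:UNIV - A|lborel. g x)"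
          by (subst set_integral_Un[symmetric]) (auto intro!: gA)
        with compl total show ?case by (simp add: set_lebesgue_integral_def)
      next
        case (union A)
        then have "range A \<subseteq> sets borel"
          using sets by auto
        then have "(LINT x:(\<Union>i. A i)|lborel. g x) = (\<Sum>i. (LINT x:A i|lborel. g x))"
          using union(1)
          by (intro lebesgue_integral_countable_add) (auto simp: disjoint_family_on_def intro!: gA)
        with union show ?case by simp
      qed (auto simp: Int_stable_def)
    qed
    then have "AE x in lborel. g x = 0"
      by (intro sigma_finite_measure.density_zero[OF lborel.sigma_finite_measure_axioms] gi)
    then have "AE x in lebesgue. g x = 0"
      by (rule AE_completion)
    with eq' show ?thesis
      by eventually_elim (auto simp: fn_def)
  qed
  then have "AE x in lebesgue. \<forall>n. x \<in> {-real n..real n} \<longrightarrow> f x = 0"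
    by (subst AE_all_countable) blast
  then show ?thesis
  proof eventually_elim
    case (elim x)
    obtain n where "\<bar>x\<bar> \<le> real n"
      using real_arch_simple by blast
    with elim show ?case
      by (auto simp: abs_le_iff)
  qed
qed

text \<open>
  Bumps converge to indicator functions of intervals.
\<close>

lemma fundamental_lemma:
  assumes "locally_integrable f" "\<And>\<phi>. \<phi> \<in> test_functions UNIV \<Longrightarrow> (LINT x|lebesgue. f x * \<phi> x) = 0"
  shows "AE x in lebesgue. f x = 0"
proof (rule AE_zero_if_integral_intervals_zero[OF assms(1)])
  fix a b :: real assume "a \<le> b"
  have "(LINT x|lebesgue. f x * bump a b n x) = 0" for n
    by (intro assms(2) bump_test) auto
  then show "(LINT x:{a..b}|lebesgue. f x) = 0"
    using integral_bump_limit[OF assms(1), of a b] LIMSEQ_unique[OF tendsto_const] by fastforce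
qed

lemma absolutely_integrable_continuous_mult:
  fixes h k :: "real \<Rightarrow> real"
  assumes k: "continuous_on {x..y} k" and h: "h absolutely_integrable_on {x..y}"
  shows "(\<lambda>s. k s * h s) absolutely_integrable_on {x..y}"
proof -
  have "bounded (k ` {x..y})"
    using k by (intro compact_imp_bounded compact_continuous_image) auto
  moreover have "k \<in> borel_measurable (lebesgue_on {x..y})"
    using k by (intro continuous_imp_measurable_on_sets_lebesgue) auto
  ultimately show ?thesis
    using absolutely_integrable_bounded_measurable_product_real[of k "{x..y}" h] h by simp
qed

lemma locally_integrable_mult_test:
  assumes h: "locally_integrable h" and \<phi>: "\<phi> \<in> test_functions UNIV"
  shows "integrable lebesgue (\<lambda>x. h x * \<phi> x)"
proof -
  obtain M B where MB: "M > 0" "\<And>x. \<bar>\<phi> x\<bar> \<le> B" "\<And>x. \<bar>x\<bar> > M \<Longrightarrow> \<phi> x = 0"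
    using test_functions_bounds[OF \<phi>] by blast
  have "(\<lambda>s. \<phi> s * h s) absolutely_integrable_on {-M..M}"
    using h unfolding locally_integrable_def
    by (intro absolutely_integrable_continuous_mult continuous_on_subset[OF test_functionsD(3)[OF \<phi>]]) auto
  moreover have "indicator {-M..M} s *\<^sub>R (\<phi> s * h s) = h s * \<phi> s" for s
    using MB(3)[of s]
    by (cases "\<bar>s\<bar> > M") (auto simp: indicator_def abs_le_iff not_less minus_le_iff)
  then have "(\<lambda>s. indicator {-M..M} s *\<^sub>R (\<phi> s * h s)) = (\<lambda>s. h s * \<phi> s)"
    by (rule ext)
  ultimately show ?thesis
    unfolding set_integrable_def by simp
qed

lemma locally_integrable_mult_bump:
  "locally_integrable f \<Longrightarrow> integrable lebesgue (\<lambda>x. f x * bump a b n x)"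
  by (intro locally_integrable_mult_test bump_test) auto

lemma locally_integrable_const: "locally_integrable (\<lambda>x. r)"
  by (auto simp: locally_integrable_def)

text \<open>
  The integral of \<open>\<psi>\<close> is constant on both sides of the support, and the two constants agree because
  the total integral vanishes.
\<close>

lemma primitive_test_function:
  assumes \<psi>: "\<psi> \<in> test_functions UNIV" and supp: "\<And>x. \<psi> x \<noteq> 0 \<Longrightarrow> x \<in> {p..q}"
    and sub: "{p..q} \<subseteq> \<Omega>" and "(LINT x|lebesgue. \<psi> x) = 0"
  obtains \<Psi> where "\<Psi> \<in> test_functions (\<Omega> :: real set)" "deriv \<Psi> = \<psi>"
proof -
  define \<Psi> where "\<Psi> x = integral {p - 1..x} \<psi>" for x
  have cont: "continuous_on A \<psi>" for A
    using test_functionsD(3)[OF \<psi>] continuous_on_subset by blast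
  have small: "\<Psi> x = 0" if "x < p" for x
  proof -
    have "integral {p - 1..x} \<psi> = integral {p - 1..x} (\<lambda>x. 0)"
      using supp that by (intro Henstock_Kurzweil_Integration.integral_cong) force
    then show ?thesis by (simp add: \<Psi>_def)
  qed
  have large: "\<Psi> x = 0" if "x > q" for x
  proof -
    have "set_integrable lebesgue {p - 1..x} \<psi>"
      using cont by (rule absolutely_integrable_continuous_real)
    then have "\<Psi> x = (LINT x:{p - 1..x}|lebesgue. \<psi> x)"
      unfolding \<Psi>_def by (rule set_lebesgue_integral_eq_integral(2)[symmetric])
    also have "\<dots> = (LINT x|lebesgue. \<psi> x)"
      unfolding set_lebesgue_integral_def
      using supp that by (intro Bochner_Integration.integral_cong) (force simp: indicator_def)+
    finally show ?thesis using assms by simp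
  qed
  have der: "(\<Psi> has_real_derivative \<psi> x) (at x)" for x
  proof (cases "x < p")
    case True
    have "((\<lambda>x. 0) has_real_derivative 0) (at x)"
      by simp
    then have "(\<Psi> has_real_derivative 0) (at x)"
      by (rule has_field_derivative_transform_within_open[of _ _ _ "{..<p}"]) (use small True in auto)
    moreover have "\<psi> x = 0"
      using supp True by force
    ultimately show ?thesis by simp
  next
    case False
    then have "(\<Psi> has_real_derivative \<psi> x) (at x within {p - 1..x + 1})"
      unfolding \<Psi>_def by (intro integral_has_real_derivative cont) auto
    then show ?thesis
      using False by (subst (asm) at_within_interior) auto
  qed
  have "Ck k \<Psi>" for k
    using Ck_SucI_real[OF der test_functionsD(1)[OF \<psi>]] Ck_decrease by blast
  then have "\<Psi> \<in> test_functions \<Omega>"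
    using small large by (intro test_functionsI[OF _ _ sub]) (auto simp: not_less[symmetric])
  moreover have "deriv \<Psi> = \<psi>"
    using der by (auto intro: DERIV_imp_deriv)
  ultimately show ?thesis
    by (rule that)
qed

text \<open>
  Subtracting a multiple of a fixed bump makes the integral of any other bump vanish, so that the
  difference is the derivative of a test function.  Hence \<open>f\<close> and the constant \<open>K\<close> have the same
  integral against every bump.
\<close>

lemma du_Bois_Reymond:
  assumes f: "locally_integrable f" and \<Omega>: "is_interval \<Omega>"
    and ortho: "\<And>\<phi>. \<phi> \<in> test_functions \<Omega> \<Longrightarrow> (LINT x|lebesgue. f x * deriv \<phi> x) = 0"
  obtains K where "\<And>a b. a \<le> b \<Longrightarrow> {a..b} \<subseteq> \<Omega> \<Longrightarrow> (LINT x:{a..b}|lebesgue. f x) = K * (b - a)"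
proof (cases "\<exists>a b. a < b \<and> {a..b} \<subseteq> \<Omega>")
  case False
  show ?thesis
  proof (rule that[of 0])
    fix a b :: real assume ab: "a \<le> b" "{a..b} \<subseteq> \<Omega>"
    then have "a = b"
      using False by (meson order_le_less)
    moreover have "AE x in lebesgue. x \<noteq> a"
      by (intro AE_completion AE_lborel_singleton)
    then have "AE x in lebesgue. indicator {a} x * f x = 0"
      by eventually_elim auto
    then have "(LINT x|lebesgue. indicator {a} x * f x) = 0"
      by (rule integral_eq_zero_AE)
    ultimately show "(LINT x:{a..b}|lebesgue. f x) = 0 * (b - a)"
      by (simp add: set_lebesgue_integral_def)
  qed
next
  case True
  then obtain a0 b0 where ab0: "a0 < b0" "{a0..b0} \<subseteq> \<Omega>"
    by blast
  have int1: "integrable lebesgue (bump a b n)" for a b n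
    using locally_integrable_mult_bump[OF locally_integrable_const, of 1] by simp
  define I0 where "I0 = (LINT x|lebesgue. bump a0 b0 0 x)"
  have "I0 \<noteq> 0"
  proof
    assume "I0 = 0"
    then have "AE x in lebesgue. bump a0 b0 0 x = 0"
      using int1 bump_range(1) unfolding I0_def by (subst (asm) integral_nonneg_eq_0_iff_AE) auto
    then have "AE x in lebesgue. x \<notin> {a0<..<b0}"
      by eventually_elim (use bump_pos_iff[of a0 b0] in auto)
    then have "emeasure lebesgue {x. a0 < x \<and> x < b0} = 0"
      by (subst (asm) AE_iff_measurable[OF _ refl]) auto
    moreover have "{x. a0 < x \<and> x < b0} = {a0<..<b0}"
      by auto
    moreover have "emeasure lebesgue {a0<..<b0} = ennreal (b0 - a0)"
      using ab0 by (simp add: emeasure_lborel_Ioo)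
    ultimately show False
      using ab0 by simp
  qed
  define K where "K = (LINT x|lebesgue. f x * bump a0 b0 0 x) / I0"
  show ?thesis
  proof (rule that[of K])
    fix a b :: real assume ab: "a \<le> b" "{a..b} \<subseteq> \<Omega>"
    have K: "(LINT x|lebesgue. f x * bump a b n x) = K * (LINT x|lebesgue. 1 * bump a b n x)" for n
    proof -
      define r where "r = (LINT x|lebesgue. bump a b n x) / I0"
      let ?\<psi> = "\<lambda>x. bump a b n x + (- r) * bump a0 b0 0 x"
      have supp: "x \<in> {min a a0..max b b0}" if "?\<psi> x \<noteq> 0" for x
      proof -
        have "bump a b n x \<noteq> 0 \<or> bump a0 b0 0 x \<noteq> 0"
          using that by auto
        then show ?thesis
          unfolding bump_pos_iff by auto
      qed
      have \<psi>: "?\<psi> \<in> test_functions UNIV"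
        by (intro test_functionsI[OF _ supp] Ck_add Ck_mult Ck_const Ck_bump) auto
      have sub: "{min a a0..max b b0} \<subseteq> \<Omega>"
      proof -
        have "min a a0 \<in> \<Omega>" "max b b0 \<in> \<Omega>"
          using ab ab0 by (auto simp: min_def max_def)
        then show ?thesis
          using \<Omega> by (meson atLeastAtMost_iff is_interval_1 subsetI)
      qed
      have zero: "(LINT x|lebesgue. ?\<psi> x) = 0"
        using int1 \<open>I0 \<noteq> 0\<close> by (simp add: r_def I0_def)
      obtain \<Psi> where "\<Psi> \<in> test_functions \<Omega>" "deriv \<Psi> = ?\<psi>"
        by (rule primitive_test_function[OF \<psi> supp sub zero])
      then have "(LINT x|lebesgue. f x * ?\<psi> x) = 0"
        using ortho by fastforce
      also have "(\<lambda>x. f x * ?\<psi> x) = (\<lambda>x. f x * bump a b n x - r * (f x * bump a0 b0 0 x))"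
        by (simp add: algebra_simps)
      finally have "(LINT x|lebesgue. f x * bump a b n x) = r * (LINT x|lebesgue. f x * bump a0 b0 0 x)"
        using locally_integrable_mult_bump[OF f] by simp
      then show ?thesis
        by (simp add: r_def K_def)
    qed
    have "(\<lambda>n. LINT x|lebesgue. f x * bump a b n x) \<longlonglongrightarrow> K * (LINT x:{a..b}|lebesgue. 1)"
      unfolding K by (intro tendsto_mult tendsto_const integral_bump_limit locally_integrable_const)
    moreover have "(LINT x:{a..b}|lebesgue. (1::real)) = b - a"
      using ab by (simp add: set_lebesgue_integral_def)
    ultimately show "(LINT x:{a..b}|lebesgue. f x) = K * (b - a)"
      using integral_bump_limit[OF f, of a b] LIMSEQ_unique by metis
  qed
qed

section \<open>Primitives of locally square integrable functions\<close>

text \<open>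
  Absolutely continuous functions are described by their increments.  The derivatives are required
  to be locally square integrable because then the error of the chain rule on a short interval is
  of smaller order than its length.
\<close>

definition primitive :: "(real \<Rightarrow> real) \<Rightarrow> (real \<Rightarrow> real) \<Rightarrow> bool" where
  "primitive F f \<longleftrightarrow> (\<forall>x y. x \<le> y \<longrightarrow>
     f absolutely_integrable_on {x..y} \<and> (\<lambda>s. (f s)\<^sup>2) absolutely_integrable_on {x..y} \<and>
     (f has_integral F y - F x) {x..y})"

lemma primitiveD:
  assumes "primitive F f" 
  shows "f absolutely_integrable_on {x..y}" "(\<lambda>s. (f s)\<^sup>2) absolutely_integrable_on {x..y}"
    "x \<le> y \<Longrightarrow> (f has_integral F y - F x) {x..y}" "x \<le> y \<Longrightarrow> integral {x..y} f = F y - F x"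
  using assms unfolding primitive_def
  by (cases "x \<le> y"; auto intro: integral_unique)+

lemma lebesgue_measurableI:
  assumes "\<And>n::nat. (f :: real \<Rightarrow> real) absolutely_integrable_on {-real n..real n}"
  shows "f \<in> borel_measurable lebesgue"
proof (rule borel_measurable_LIMSEQ_real)
  show "(\<lambda>x. indicator {-real n..real n} x *\<^sub>R f x) \<in> borel_measurable lebesgue" for n
    using assms[of n] unfolding set_integrable_def by (rule borel_measurable_integrable)
  fix x :: real
  obtain N where N: "\<bar>x\<bar> \<le> real N"
    using real_arch_simple by blast
  have "indicator {-real n..real n} x *\<^sub>R f x = f x" if "n \<ge> N" for n
    using that N by (auto simp: indicator_def abs_le_iff)
  then show "(\<lambda>n. indicator {-real n..real n} x *\<^sub>R f x) \<longlonglongrightarrow> f x"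
    by (intro tendsto_eventually) (auto simp: eventually_sequentially)
qed

lemma primitive_measurable: "primitive F f \<Longrightarrow> f \<in> borel_measurable lebesgue"
  by (intro lebesgue_measurableI) (auto dest: primitiveD)

lemma primitive_continuous:
  assumes "primitive F f"
  shows "continuous_on A F"
proof -
  have "isCont F x" for x
  proof -
    have "continuous_on {x - 1..x + 1} (\<lambda>y. F (x - 1) + integral {x - 1..y} f)"
      using primitiveD(1)[OF assms] set_lebesgue_integral_eq_integral(1)
      by (intro continuous_intros indefinite_integral_continuous_1) blast
    also have "?this \<longleftrightarrow> continuous_on {x - 1..x + 1} F"
      by (intro continuous_on_cong) (auto simp: primitiveD(4)[OF assms])
    finally show ?thesis
      by (rule continuous_on_interior) auto
  qed
  then show ?thesis
    by (simp add: continuous_at_imp_continuous_on)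
qed

lemma integral_abs_sq_le:
  fixes f :: "real \<Rightarrow> real"
  assumes "f absolutely_integrable_on {x..y}" "(\<lambda>s. (f s)\<^sup>2) absolutely_integrable_on {x..y}" "x \<le> y"
  shows "(integral {x..y} (\<lambda>s. \<bar>f s\<bar>))\<^sup>2 \<le> (y - x) * integral {x..y} (\<lambda>s. (f s)\<^sup>2)"
proof (cases "x = y")
  case False
  have "x < y" using False assms(3) by linarith
  define N where "N = integral {x..y} (\<lambda>s. \<bar>f s\<bar>)"
  define r where "r = N / (y - x)"
  have i: "(\<lambda>s. \<bar>f s\<bar>) integrable_on {x..y}" "(\<lambda>s. (f s)\<^sup>2) integrable_on {x..y}"
    using set_lebesgue_integral_eq_integral(1)[OF absolutely_integrable_abs[OF assms(1)]]
      set_lebesgue_integral_eq_integral(1)[OF assms(2)] by auto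
  have "((\<lambda>s. (f s)\<^sup>2 - 2 * r * \<bar>f s\<bar> + r\<^sup>2) has_integral
      integral {x..y} (\<lambda>s. (f s)\<^sup>2) - 2 * r * N + (y - x) * r\<^sup>2) {x..y}"
    unfolding N_def using i assms(3) has_integral_const_real[of "r\<^sup>2" x y]
    by (intro has_integral_add has_integral_diff has_integral_mult_right integrable_integral) auto
  moreover have sq: "(f s)\<^sup>2 - 2 * r * \<bar>f s\<bar> + r\<^sup>2 = (\<bar>f s\<bar> - r)\<^sup>2" for s
    by (simp add: power2_eq_square algebra_simps)
  ultimately have "((\<lambda>s. (\<bar>f s\<bar> - r)\<^sup>2) has_integral
      integral {x..y} (\<lambda>s. (f s)\<^sup>2) - 2 * r * N + (y - x) * r\<^sup>2) {x..y}"
    unfolding sq by simp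
  then have "0 \<le> integral {x..y} (\<lambda>s. (f s)\<^sup>2) - 2 * r * N + (y - x) * r\<^sup>2"
    by (rule has_integral_nonneg) simp
  moreover have r: "(y - x) * r = N"
    using \<open>x < y\<close> by (simp add: r_def)
  have "(y - x) * r\<^sup>2 = N * r"
    unfolding r[symmetric] by (simp add: power2_eq_square)
  ultimately have "N * r \<le> integral {x..y} (\<lambda>s. (f s)\<^sup>2)"
    by simp
  then have "(y - x) * (N * r) \<le> (y - x) * integral {x..y} (\<lambda>s. (f s)\<^sup>2)"
    using assms(3) by (intro mult_left_mono) auto
  moreover have "(y - x) * (N * r) = N\<^sup>2"
    using r by (simp add: power2_eq_square mult.left_commute)
  ultimately show ?thesis
    by (simp add: N_def)
qed simp

text \<open>
  At each point the difference quotient of \<open>D\<close> is bounded by an increment of \<open>M\<close>, so the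
  derivative of \<open>D\<close> vanishes.
\<close>

lemma constant_if_small_increments:
  fixes D M :: "real \<Rightarrow> real"
  assumes "a \<le> b" and M: "continuous_on {a..b} M"
    and incr: "\<And>x y. a \<le> x \<Longrightarrow> x \<le> y \<Longrightarrow> y \<le> b \<Longrightarrow> \<bar>D y - D x\<bar> \<le> (y - x) * (M y - M x)"
  shows "D b = D a"
proof -
  have "(D has_real_derivative 0) (at x within {a..b})" if x: "x \<in> {a..b}" for x
  proof -
    have "((\<lambda>y. (D y - D x) / (y - x)) \<longlongrightarrow> 0) (at x within {a..b})"
    proof (rule tendsto_rabs_zero_cancel,
        rule tendsto_sandwich[where f = "\<lambda>_. 0" and h = "\<lambda>y. \<bar>M y - M x\<bar>"])
      show "((\<lambda>y. \<bar>M y - M x\<bar>) \<longlongrightarrow> 0) (at x within {a..b})"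
        using M x by (intro tendsto_rabs_zero LIM_zero) (auto simp: continuous_on_def)
      show "\<forall>\<^sub>F y in at x within {a..b}. \<bar>(D y - D x) / (y - x)\<bar> \<le> \<bar>M y - M x\<bar>"
      proof (unfold eventually_at_filter, rule always_eventually, intro allI impI)
        fix y assume "y \<noteq> x" and y: "y \<in> {a..b}"
        have "\<bar>D y - D x\<bar> \<le> \<bar>y - x\<bar> * \<bar>M y - M x\<bar>"
        proof (cases "x \<le> y")
          case True
          then have "\<bar>D y - D x\<bar> \<le> (y - x) * (M y - M x)"
            using x y by (intro incr) auto
          also have "\<dots> \<le> \<bar>y - x\<bar> * \<bar>M y - M x\<bar>"
            by (metis abs_ge_self abs_mult)
          finally show ?thesis .
        next
          case False
          then have "\<bar>D x - D y\<bar> \<le> (x - y) * (M x - M y)"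
            using x y by (intro incr) auto
          also have "\<dots> \<le> \<bar>x - y\<bar> * \<bar>M x - M y\<bar>"
            by (metis abs_ge_self abs_mult)
          finally show ?thesis
            by (simp add: abs_minus_commute)
        qed
        then show "\<bar>(D y - D x) / (y - x)\<bar> \<le> \<bar>M y - M x\<bar>"
          using \<open>y \<noteq> x\<close> by (simp add: abs_divide divide_le_eq mult.commute)
      qed
    qed auto
    then show ?thesis
      by (simp add: has_field_derivative_iff)
  qed
  then show ?thesis
    using assms(1) has_field_derivative_zero_constant[of "{a..b}" D] by (auto simp: convex_real_interval)
qed

lemma mean_value_between:
  fixes \<phi> \<phi>' :: "real \<Rightarrow> real"
  assumes S: "is_interval S" and der: "\<And>z. z \<in> S \<Longrightarrow> (\<phi> has_real_derivative \<phi>' z) (at z within S)"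
    and "u \<in> S" "v \<in> S"
  obtains \<xi> where "\<xi> \<in> S" "\<phi> v - \<phi> u = \<phi>' \<xi> * (v - u)" "min u v \<le> \<xi>" "\<xi> \<le> max u v"
proof -
  have *: "\<exists>\<xi>. \<xi> \<in> {u..v} \<and> \<xi> \<in> S \<and> \<phi> v - \<phi> u = \<phi>' \<xi> * (v - u)"
    if "u < v" "u \<in> S" "v \<in> S" for u v
  proof -
    have sub: "{u..v} \<subseteq> S"
      using S that by (meson atLeastAtMost_iff is_interval_1 subsetI)
    then have "(\<phi> has_derivative (\<lambda>h. \<phi>' z * h)) (at z within {u..v})" if "u \<le> z" "z \<le> v" for z
      using der[of z] that has_field_derivative_subset has_field_derivative_def by (metis atLeastAtMost_iff subsetD)
    then obtain \<xi> where "\<xi> \<in> {u<..<v}" "\<phi> v - \<phi> u = \<phi>' \<xi> * (v - u)"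
      using mvt_simple[OF \<open>u < v\<close>, of \<phi> "\<lambda>z h. \<phi>' z * h"] by auto
    with sub show ?thesis
      by (intro exI[of _ \<xi>]) auto
  qed
  consider "u < v" | "u = v" | "v < u" by linarith
  then show ?thesis
  proof cases
    case 1
    with *[of u v] assms show ?thesis by (auto intro: that)
  next
    case 2
    with assms show ?thesis by (intro that[of u]) auto
  next
    case 3
    with *[of v u] assms obtain \<xi> where "\<xi> \<in> {v..u}" "\<xi> \<in> S" "\<phi> u - \<phi> v = \<phi>' \<xi> * (u - v)"
      by blast
    with 3 show ?thesis by (intro that[of \<xi>]) (auto simp: algebra_simps)
  qed
qed

text \<open>
  On an interval from \<open>x\<close> to \<open>y\<close> the error of the chain rule is at most \<open>B\<close> times the square of
  the integral of \<open>|f|\<close>: one factor bounds the variation of \<open>\<phi>'\<close>, the other one is the integral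
  itself.  By the Cauchy-Schwarz inequality this is \<open>B (y - x)\<close> times the integral of
  \<open>f\<^sup>2\<close>, so the error does not accumulate.
\<close>

lemma primitive_chain:
  assumes F: "primitive F f" and S: "is_interval S" "\<And>x. F x \<in> S"
    and der: "\<And>z. z \<in> S \<Longrightarrow> (\<phi> has_real_derivative \<phi>' z) (at z within S)"
    and lip: "\<And>z w. z \<in> S \<Longrightarrow> w \<in> S \<Longrightarrow> \<bar>\<phi>' z - \<phi>' w\<bar> \<le> B * \<bar>z - w\<bar>"
  shows "primitive (\<lambda>x. \<phi> (F x)) (\<lambda>x. \<phi>' (F x) * f x)"
proof -
  let ?g = "\<lambda>s. \<phi>' (F s) * f s"
  have "\<bar>B\<bar>-lipschitz_on S \<phi>'"
  proof (rule lipschitz_onI)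
    fix z w assume "z \<in> S" "w \<in> S"
    then show "dist (\<phi>' z) (\<phi>' w) \<le> \<bar>B\<bar> * dist z w"
      using lip[of z w] mult_right_mono[OF abs_ge_self[of B] abs_ge_zero[of "z - w"]]
      by (simp add: dist_real_def)
  qed simp
  then have "continuous_on S \<phi>'"
    by (rule lipschitz_on_continuous_on)
  then have cont: "continuous_on A (\<lambda>s. \<phi>' (F s))" for A
    using continuous_on_compose2[OF _ primitive_continuous[OF F]] S(2) by blast
  have mult: "(\<lambda>s. \<phi>' (F s) * h s) absolutely_integrable_on {x..y}"
    if "h absolutely_integrable_on {x..y}" for h x y
    using absolutely_integrable_continuous_mult[OF cont that] .
  have g: "?g absolutely_integrable_on {x..y}" for x y
    by (intro mult primitiveD[OF F])
  have gi: "?g integrable_on {x..y}" for x y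
    using g set_lebesgue_integral_eq_integral(1) by blast
  have g2: "(\<lambda>s. (?g s)\<^sup>2) absolutely_integrable_on {x..y}" for x y
    using mult[OF mult[OF primitiveD(2)[OF F]]] by (simp add: power2_eq_square ac_simps)
  have fi: "(\<lambda>s. \<bar>f s\<bar>) integrable_on {x..y}" "(\<lambda>s. (f s)\<^sup>2) integrable_on {x..y}" "f integrable_on {x..y}" for x y
    using set_lebesgue_integral_eq_integral(1)[OF absolutely_integrable_abs[OF primitiveD(1)[OF F]]]
      set_lebesgue_integral_eq_integral(1)[OF primitiveD(1)[OF F]]
      set_lebesgue_integral_eq_integral(1)[OF primitiveD(2)[OF F]] by auto
  have Fdiff: "\<bar>F s' - F s\<bar> \<le> integral {x..y} (\<lambda>s. \<bar>f s\<bar>)" if "x \<le> s" "s \<le> s'" "s' \<le> y" for x y s s'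
  proof -
    have "\<bar>F s' - F s\<bar> \<le> integral {s..s'} (\<lambda>s. \<bar>f s\<bar>)"
      using that integral_norm_bound_integral[OF fi(3) fi(1), of s s'] primitiveD(4)[OF F, of s s'] by simp
    also have "\<dots> \<le> integral {x..y} (\<lambda>s. \<bar>f s\<bar>)"
      using that by (intro integral_subset_le fi) auto
    finally show ?thesis .
  qed
  have main: "integral {a..b} ?g = \<phi> (F b) - \<phi> (F a)" if "a \<le> b" for a b
  proof -
    define D where "D y = \<phi> (F y) - integral {a..y} ?g" for y
    define M where "M y = \<bar>B\<bar> * integral {a..y} (\<lambda>s. (f s)\<^sup>2)" for y
    have "D b = D a"
    proof (rule constant_if_small_increments[OF that])
      show "continuous_on {a..b} M"
        unfolding M_def by (intro continuous_intros indefinite_integral_continuous_1 fi)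
      fix x y assume xy: "a \<le> x" "x \<le> y" "y \<le> b"
      let ?N = "integral {x..y} (\<lambda>s. \<bar>f s\<bar>)"
      have "?N \<ge> 0"
        by (intro integral_nonneg fi) auto
      obtain \<xi> where \<xi>: "\<xi> \<in> S" "\<phi> (F y) - \<phi> (F x) = \<phi>' \<xi> * (F y - F x)"
          "min (F x) (F y) \<le> \<xi>" "\<xi> \<le> max (F x) (F y)"
        by (rule mean_value_between[OF S(1) der S(2)[of x] S(2)[of y]])
      have bound: "\<bar>\<phi>' \<xi> - \<phi>' (F s)\<bar> \<le> \<bar>B\<bar> * ?N" if s: "s \<in> {x..y}" for s
      proof -
        have "\<bar>\<phi>' \<xi> - \<phi>' (F s)\<bar> \<le> \<bar>B\<bar> * \<bar>\<xi> - F s\<bar>"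
          using lip[OF \<xi>(1) S(2)[of s]] mult_right_mono[OF abs_ge_self[of B] abs_ge_zero[of "\<xi> - F s"]]
          by linarith
        also have "\<bar>\<xi> - F s\<bar> \<le> ?N"
          using Fdiff[of x x s y] Fdiff[of x s y y] s \<xi>(3,4) by (auto simp: min_def max_def split: if_splits)
        finally show ?thesis
          by (simp add: mult_left_mono)
      qed
      have int: "integral {a..y} h = integral {a..x} h + integral {x..y} h"
        if "\<And>x y. h integrable_on {x..y}" for h :: "real \<Rightarrow> real"
        using Henstock_Kurzweil_Integration.integral_combine[OF xy(1,2) that] by simp
      have "D y - D x = \<phi>' \<xi> * integral {x..y} f - integral {x..y} ?g"
        using xy primitiveD(4)[OF F, of x y] \<xi>(2) int[of ?g] gi by (simp add: D_def)
      also have "\<dots> = integral {x..y} (\<lambda>s. (\<phi>' \<xi> - \<phi>' (F s)) * f s)"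
        using fi(3) gi by (simp add: left_diff_distrib integral_diff integrable_on_mult_right)
      finally have "\<bar>D y - D x\<bar> = \<bar>integral {x..y} (\<lambda>s. (\<phi>' \<xi> - \<phi>' (F s)) * f s)\<bar>"
        by simp
      also have "\<dots> \<le> integral {x..y} (\<lambda>s. \<bar>B\<bar> * ?N * \<bar>f s\<bar>)"
      proof (simp only: real_norm_def[symmetric], intro integral_norm_bound_integral)
        show "(\<lambda>s. (\<phi>' \<xi> - \<phi>' (F s)) * f s) integrable_on {x..y}"
          using fi gi by (simp add: left_diff_distrib integrable_diff integrable_on_mult_right)
        show "norm ((\<phi>' \<xi> - \<phi>' (F s)) * f s) \<le> norm B * integral {x..y} (\<lambda>s. norm (f s)) * norm (f s)"
          if "s \<in> {x..y}" for s
          using bound[OF that] by (simp add: abs_mult mult_right_mono)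
      qed (use fi in \<open>auto intro!: integrable_on_mult_right\<close>)
      also have "\<dots> = \<bar>B\<bar> * ?N\<^sup>2"
        by (simp add: power2_eq_square)
      also have "\<dots> \<le> \<bar>B\<bar> * ((y - x) * integral {x..y} (\<lambda>s. (f s)\<^sup>2))"
        using xy by (intro mult_left_mono integral_abs_sq_le primitiveD[OF F]) auto
      also have "\<dots> = (y - x) * (M y - M x)"
        using int[of "\<lambda>s. (f s)\<^sup>2"] fi by (simp add: M_def algebra_simps)
      finally show "\<bar>D y - D x\<bar> \<le> (y - x) * (M y - M x)" .
    qed
    then show ?thesis
      using that by (simp add: D_def)
  qed
  show ?thesis
    unfolding primitive_def
  proof (intro allI impI conjI g g2)
    fix x y :: real assume "x \<le> y"
    from main[OF this] gi[of x y] show "(?g has_integral \<phi> (F y) - \<phi> (F x)) {x..y}"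
      by (metis integrable_integral)
  qed
qed

lemma primitive_const: "primitive (\<lambda>x. r) (\<lambda>x. 0)"
  by (simp add: primitive_def)

lemma primitive_add:
  assumes "primitive F f" "primitive G g"
  shows "primitive (\<lambda>x. F x + G x) (\<lambda>x. f x + g x)"
  unfolding primitive_def
proof (intro allI impI conjI)
  fix x y :: real assume xy: "x \<le> y"
  note F = primitiveD[OF assms(1), of x y] and G = primitiveD[OF assms(2), of x y]
  show "(\<lambda>x. f x + g x) absolutely_integrable_on {x..y}"
    using F G by (intro set_integral_add)
  show "((\<lambda>x. f x + g x) has_integral F y + G y - (F x + G x)) {x..y}"
    using has_integral_add[OF F(3) G(3)] xy by (simp add: algebra_simps)
  show "(\<lambda>s. (f s + g s)\<^sup>2) absolutely_integrable_on {x..y}"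
    unfolding set_integrable_def
  proof (rule Bochner_Integration.integrable_bound)
    show "integrable lebesgue (\<lambda>s. indicator {x..y} s *\<^sub>R (2 * (f s)\<^sup>2 + 2 * (g s)\<^sup>2))"
      unfolding set_integrable_def[symmetric]
      by (intro set_integral_add set_integrable_mult_right F(2) G(2))
    have [measurable]: "f \<in> borel_measurable lebesgue" "g \<in> borel_measurable lebesgue"
      using assms primitive_measurable by auto
    show "(\<lambda>s. indicator {x..y} s *\<^sub>R (f s + g s)\<^sup>2) \<in> borel_measurable lebesgue"
      by (intro borel_measurable_scaleR borel_measurable_indicator) auto
    have "(f s + g s)\<^sup>2 \<le> 2 * (f s)\<^sup>2 + 2 * (g s)\<^sup>2" for s
      using sum_squares_bound[of "f s" "g s"] by (simp add: power2_sum)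
    then show "AE s in lebesgue. norm (indicator {x..y} s *\<^sub>R (f s + g s)\<^sup>2)
        \<le> norm (indicator {x..y} s *\<^sub>R (2 * (f s)\<^sup>2 + 2 * (g s)\<^sup>2))"
      by (intro AE_I2) (auto simp: indicator_def)
  qed
qed

lemma primitive_cmult:
  assumes "primitive F f"
  shows "primitive (\<lambda>x. r * F x) (\<lambda>x. r * f x)"
  unfolding primitive_def
proof (intro allI impI conjI)
  fix x y :: real assume xy: "x \<le> y"
  note F = primitiveD[OF assms(1), of x y]
  show "(\<lambda>x. r * f x) absolutely_integrable_on {x..y}" "(\<lambda>x. (r * f x)\<^sup>2) absolutely_integrable_on {x..y}"
    using F by (simp_all add: power_mult_distrib)
  show "((\<lambda>x. r * f x) has_integral r * F y - r * F x) {x..y}"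
    using has_integral_mult_right[OF F(3), of r] xy by (simp add: algebra_simps)
qed

lemma primitive_diff:
  assumes "primitive F f" "primitive G g"
  shows "primitive (\<lambda>x. F x - G x) (\<lambda>x. f x - g x)"
  using primitive_add[OF assms(1) primitive_cmult[OF assms(2), of "-1"]] by simp

text \<open>
  By polarisation the product rule follows from the chain rule for the square.
\<close>

lemma primitive_mult:
  assumes "primitive F f" "primitive G g"
  shows "primitive (\<lambda>x. F x * G x) (\<lambda>x. f x * G x + F x * g x)"
proof -
  have sq: "primitive (\<lambda>x. (H x)\<^sup>2) (\<lambda>x. 2 * H x * h x)" if "primitive H h" for H h
    using that by (rule primitive_chain[where S = UNIV and B = 2])
      (auto intro!: derivative_eq_intros simp: is_interval_univ abs_if)
  have "primitive (\<lambda>x. 1 / 4 * ((F x + G x)\<^sup>2 - (F x - G x)\<^sup>2))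
      (\<lambda>x. 1 / 4 * (2 * (F x + G x) * (f x + g x) - 2 * (F x - G x) * (f x - g x)))"
    by (intro primitive_cmult primitive_diff sq primitive_add assms)
  then show ?thesis
    by (simp add: power2_eq_square algebra_simps)
qed

lemma primitive_cong:
  assumes "primitive F f" "AE x in lebesgue. f x = g x" "g \<in> borel_measurable lebesgue"
  shows "primitive F g"
  unfolding primitive_def
proof (intro allI impI conjI)
  fix x y :: real assume xy: "x \<le> y"
  note F = primitiveD[OF assms(1), of x y]
  have g [measurable]: "g \<in> borel_measurable lebesgue" by fact
  have ind: "indicator {x..y} \<in> borel_measurable lebesgue" for x y :: real
    by (intro borel_measurable_indicator) auto
  show gi: "g absolutely_integrable_on {x..y}"
    using F(1) unfolding set_integrable_def
    by (rule integrable_cong_AE_imp) (use assms(2) ind in \<open>auto intro!: borel_measurable_times\<close>)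
  show "(\<lambda>s. (g s)\<^sup>2) absolutely_integrable_on {x..y}"
    using F(2) unfolding set_integrable_def
    by (rule integrable_cong_AE_imp) (use assms(2) ind in \<open>auto intro!: borel_measurable_times\<close>)
  have "(LINT s:{x..y}|lebesgue. f s) = (LINT s:{x..y}|lebesgue. g s)"
    unfolding set_lebesgue_integral_def using assms(2) ind primitive_measurable[OF assms(1)]
    by (intro integral_cong_AE) (auto intro!: borel_measurable_times)
  then show "(g has_integral F y - F x) {x..y}"
    using F(3)[OF xy] gi F(1) set_lebesgue_integral_eq_integral[of "{x..y}"]
    by (metis has_integral_iff)
qed

lemma locally_integrable_primitive:
  assumes "\<And>a b. g absolutely_integrable_on {a..b}" "\<And>a b. (\<lambda>s. (g s)\<^sup>2) absolutely_integrable_on {a..b}"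
  obtains G where "primitive G g"
proof -
  have gi: "g integrable_on {a..b}" for a b
    using assms(1) set_lebesgue_integral_eq_integral(1) by blast
  define G where "G x = (if 0 \<le> x then integral {0..x} g else - integral {x..0} g)" for x
  have "integral {x..y} g = G y - G x" if "x \<le> y" for x y
    using that Henstock_Kurzweil_Integration.integral_combine[OF _ _ gi, of x 0 y]
      Henstock_Kurzweil_Integration.integral_combine[OF _ _ gi, of 0 x y]
      Henstock_Kurzweil_Integration.integral_combine[OF _ _ gi, of x y 0]
    by (auto simp: G_def)
  then have "primitive G g"
    unfolding primitive_def using assms gi by (metis integrable_integral)
  then show ?thesis by (rule that)
qed

lemma integrable_limit_at_top_eq_0:
  fixes H :: "real \<Rightarrow> real"
  assumes H: "integrable lebesgue H" and lim: "(H \<longlongrightarrow> A) at_top"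
  shows "A = 0"
proof (rule ccontr)
  assume "A \<noteq> 0"
  then have "\<forall>\<^sub>F x in at_top. dist (H x) A < \<bar>A\<bar> / 2"
    using lim by (intro tendstoD) auto
  then obtain N where N: "\<And>x. x \<ge> N \<Longrightarrow> \<bar>H x - A\<bar> < \<bar>A\<bar> / 2"
    unfolding eventually_at_top_linorder dist_real_def by blast
  have "\<bar>A\<bar> / 2 * m \<le> (LINT x|lebesgue. \<bar>H x\<bar>)" if "m \<ge> 0" for m
  proof -
    have "(LINT x|lebesgue. \<bar>A\<bar> / 2 * indicator {N..N + m} x) \<le> (LINT x|lebesgue. \<bar>H x\<bar>)"
    proof (rule integral_mono)
      show "integrable lebesgue (\<lambda>x. \<bar>A\<bar> / 2 * indicator {N..N + m} x)"
        using that by (intro integrable_mult_right) (simp add: integrable_indicator_iff)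
      show "\<bar>A\<bar> / 2 * indicator {N..N + m} x \<le> \<bar>H x\<bar>" for x
        using N[of x] by (cases "x \<in> {N..N + m}") (auto simp: indicator_def abs_real_def split: if_splits)
    qed (use H in auto)
    then show ?thesis
      using that by simp
  qed
  note this[of "2 * (1 + (LINT x|lebesgue. \<bar>H x\<bar>)) / \<bar>A\<bar>"]
  moreover have "(LINT x|lebesgue. \<bar>H x\<bar>) \<ge> 0"
    by (intro integral_nonneg_AE) auto
  ultimately show False
    using \<open>A \<noteq> 0\<close> by simp
qed

text \<open>
  The increments \<open>F x - F (- x)\<close> converge to the integral of \<open>f\<close> as \<open>x\<close> grows; being integrable in
  \<open>x\<close>, they can only converge to zero.
\<close>

lemma integral_derivative_eq_0:
  assumes F: "primitive F f" and Fi: "integrable lebesgue F" and fi: "integrable lebesgue f"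
  shows "(LINT x|lebesgue. f x) = 0"
proof (rule integrable_limit_at_top_eq_0)
  have m: "F \<in> borel_measurable borel"
    by (intro borel_measurable_continuous_onI primitive_continuous[OF F])
  then have "integrable lborel F"
    using Fi by (simp add: integrable_completion)
  then have "integrable lborel (\<lambda>x. F (0 + - 1 * x))"
    by (rule lborel_integrable_real_affine) simp
  then have "integrable lebesgue (\<lambda>x. F (- x))"
    using m by (subst integrable_completion) auto
  with Fi show "integrable lebesgue (\<lambda>x. F x - F (- x))"
    by simp
  have fm: "f \<in> borel_measurable lebesgue"
    using fi by simp
  have "((\<lambda>x. LINT s|lebesgue. indicator {-x..x} s *\<^sub>R f s) \<longlongrightarrow> (LINT s|lebesgue. f s)) at_top"
  proof (rule integral_dominated_convergence_at_top[where w = "\<lambda>s. \<bar>f s\<bar>"])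
    show "(\<lambda>s. indicator {-x..x} s *\<^sub>R f s) \<in> borel_measurable lebesgue" for x
      by (intro borel_measurable_scaleR borel_measurable_indicator fm) auto
    show "AE s in lebesgue. ((\<lambda>x. indicator {-x..x} s *\<^sub>R f s) \<longlongrightarrow> f s) at_top"
    proof (rule AE_I2)
      fix s :: real
      have "\<forall>\<^sub>F x in at_top. indicator {-x..x} s *\<^sub>R f s = f s"
        using eventually_ge_at_top[of "\<bar>s\<bar>"] by eventually_elim (auto simp: indicator_def)
      then show "((\<lambda>x. indicator {-x..x} s *\<^sub>R f s) \<longlongrightarrow> f s) at_top"
        by (rule tendsto_eventually)
    qed
    show "\<forall>\<^sub>F x in at_top. AE s in lebesgue. norm (indicator {-x..x} s *\<^sub>R f s) \<le> \<bar>f s\<bar>"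
      by (intro always_eventually allI AE_I2) (auto simp: indicator_def)
  qed (use fi fm in auto)
  moreover have "\<forall>\<^sub>F x in at_top. (LINT s|lebesgue. indicator {-x..x} s *\<^sub>R f s) = F x - F (- x)"
    using eventually_ge_at_top[of 0]
  proof eventually_elim
    case (elim x)
    have "(LINT s:{-x..x}|lebesgue. f s) = integral {-x..x} f"
      by (rule set_lebesgue_integral_eq_integral(2)[OF primitiveD(1)[OF F]])
    then show ?case
      using primitiveD(4)[OF F, of "-x" x] elim by (simp add: set_lebesgue_integral_def)
  qed
  ultimately show "((\<lambda>x. F x - F (- x)) \<longlongrightarrow> (LINT s|lebesgue. f s)) at_top"
    by (rule Lim_transform_eventually)
qed

text \<open>
  The difference of \<open>f\<close> and any primitive of \<open>g\<close> is orthogonal to the derivatives of all test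
  functions, hence constant.
\<close>

lemma weak_deriv_primitive:
  assumes fg: "has_weak_deriv f g" and g2: "\<And>a b. (\<lambda>s. (g s)\<^sup>2) absolutely_integrable_on {a..b}"
  obtains F where "primitive F g" "AE x in lebesgue. f x = F x"
proof -
  have li: "locally_integrable f" "locally_integrable g"
    using fg by (auto simp: has_weak_deriv_def)
  obtain G where G: "primitive G g"
    using locally_integrable_primitive[of g] li g2 by (auto simp: locally_integrable_def)
  have Gl: "locally_integrable G"
    unfolding locally_integrable_def
    using primitive_continuous[OF G] absolutely_integrable_continuous_real by blast
  have ortho: "(LINT x|lebesgue. (f x - G x) * deriv \<phi> x) = 0" if \<phi>: "\<phi> \<in> test_functions UNIV" for \<phi>
  proof -
    have \<phi>': "deriv \<phi> \<in> test_functions UNIV"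
      using \<phi> by (rule test_functions_deriv)
    have p\<phi>: "primitive \<phi> (deriv \<phi>)"
      unfolding primitive_def
    proof (intro allI impI conjI)
      fix x y :: real assume "x \<le> y"
      have c: "continuous_on {x..y} (deriv \<phi>)"
        by (rule continuous_on_subset[OF test_functionsD(4)[OF \<phi>]]) auto
      show "deriv \<phi> absolutely_integrable_on {x..y}" "(\<lambda>s. (deriv \<phi> s)\<^sup>2) absolutely_integrable_on {x..y}"
        using c by (auto intro!: absolutely_integrable_continuous_real continuous_intros)
      show "(deriv \<phi> has_integral \<phi> y - \<phi> x) {x..y}"
        using \<open>x \<le> y\<close> test_functionsD(5)[OF \<phi>]
        by (intro fundamental_theorem_of_calculus)
          (auto simp: has_real_derivative_iff_has_vector_derivative[symmetric] intro: has_field_derivative_at_within)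
    qed
    have "(LINT x|lebesgue. g x * \<phi> x + G x * deriv \<phi> x) = 0"
      by (rule integral_derivative_eq_0[OF primitive_mult[OF G p\<phi>]])
        (intro Bochner_Integration.integrable_add locally_integrable_mult_test li Gl \<phi> \<phi>')+
    then have "(LINT x|lebesgue. G x * deriv \<phi> x) = - (LINT x|lebesgue. g x * \<phi> x)"
      using locally_integrable_mult_test[OF li(2) \<phi>] locally_integrable_mult_test[OF Gl \<phi>'] by simp
    also have "\<dots> = (LINT x|lebesgue. f x * deriv \<phi> x)"
      using fg \<phi> by (simp add: has_weak_deriv_def)
    finally show ?thesis
      using locally_integrable_mult_test[OF li(1) \<phi>'] locally_integrable_mult_test[OF Gl \<phi>'] by (simp add: left_diff_distrib)
  qed
  have dl: "locally_integrable (\<lambda>x. f x - G x)"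
    using li Gl by (auto simp: locally_integrable_def)
  obtain K where K: "\<And>a b. a \<le> b \<Longrightarrow> (LINT x:{a..b}|lebesgue. f x - G x) = K * (b - a)"
    using du_Bois_Reymond[OF dl is_interval_univ ortho] by auto
  have "AE x in lebesgue. f x - G x - K = 0"
  proof (rule AE_zero_if_integral_intervals_zero)
    show "locally_integrable (\<lambda>x. f x - G x - K)"
      unfolding locally_integrable_def
    proof (intro allI)
      show "(\<lambda>x. f x - G x - K) absolutely_integrable_on {a..b}" for a b
        by (rule set_integral_diff(1))
          (use dl locally_integrable_const[of K] in \<open>simp_all only: locally_integrable_def\<close>)
    qed
    fix a b :: real assume "a \<le> b"
    have "(LINT x:{a..b}|lebesgue. f x - G x - K) = (LINT x:{a..b}|lebesgue. f x - G x) - (LINT x:{a..b}|lebesgue. K)"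
      by (rule set_integral_diff(2))
        (use dl locally_integrable_const[of K] in \<open>simp_all only: locally_integrable_def\<close>)
    also have "(LINT x:{a..b}|lebesgue. K) = K * (b - a)"
      using \<open>a \<le> b\<close> by (simp add: set_lebesgue_integral_def)
    finally show "(LINT x:{a..b}|lebesgue. f x - G x - K) = 0"
      using K[OF \<open>a \<le> b\<close>] by simp
  qed
  moreover have "primitive (\<lambda>x. G x + K) g"
    using primitive_add[OF G primitive_const] by simp
  ultimately show ?thesis
    by (intro that[of "\<lambda>x. G x + K"]) auto
qed

section \<open>Weak derivatives and curves in the Hilbert space\<close>

lemma locally_integrable_diff:
  assumes "locally_integrable f" "locally_integrable g"
  shows "locally_integrable (\<lambda>x. f x - g x)"
  unfolding locally_integrable_def
proof (intro allI)
  show "(\<lambda>x. f x - g x) absolutely_integrable_on {a..b}" for a b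
    by (rule set_integral_diff(1)) (use assms in \<open>simp_all only: locally_integrable_def\<close>)
qed

lemma locally_integrable_measurable: "locally_integrable f \<Longrightarrow> f \<in> borel_measurable lebesgue"
  by (rule lebesgue_measurableI) (simp add: locally_integrable_def)

lemma has_weak_deriv_diff:
  assumes "has_weak_deriv f g" "has_weak_deriv f' g'"
  shows "has_weak_deriv (\<lambda>x. f x - f' x) (\<lambda>x. g x - g' x)"
  using assms locally_integrable_mult_test[OF _ test_functions_deriv] locally_integrable_mult_test
  by (simp add: has_weak_deriv_def locally_integrable_diff left_diff_distrib)

lemma has_weak_deriv_unique:
  assumes "has_weak_deriv f g" "has_weak_deriv f g'"
  shows "AE x in lebesgue. g x = g' x"
proof -
  have "has_weak_deriv (\<lambda>x. f x - f x) (\<lambda>x. g x - g' x)"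
    by (rule has_weak_deriv_diff[OF assms])
  then have "AE x in lebesgue. g x - g' x = 0"
    by (intro fundamental_lemma) (auto simp: has_weak_deriv_def)
  then show ?thesis
    by eventually_elim simp
qed

lemma has_weak_deriv_cmult: "has_weak_deriv f g \<Longrightarrow> has_weak_deriv (\<lambda>x. r * f x) (\<lambda>x. r * g x)"
  by (auto simp: has_weak_deriv_def locally_integrable_def mult.assoc)

lemma has_weak_deriv_cong_AE:
  assumes fg: "has_weak_deriv f g"
    and f': "AE x in lebesgue. f x = f' x" "locally_integrable f'"
    and g': "AE x in lebesgue. g x = g' x" "locally_integrable g'"
  shows "has_weak_deriv f' g'"
proof -
  have cong: "(LINT x|lebesgue. k x * \<phi> x) = (LINT x|lebesgue. k' x * \<phi> x)"
    if "\<phi> \<in> test_functions UNIV" "AE x in lebesgue. k x = k' x" "locally_integrable k" "locally_integrable k'"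
    for k k' \<phi> :: "real \<Rightarrow> real"
    using that
    by (intro integral_cong_AE borel_measurable_times L2_D(1)[OF test_functions_L2[OF that(1)]]
        locally_integrable_measurable) auto
  have li: "locally_integrable f" "locally_integrable g"
    using fg by (auto simp: has_weak_deriv_def)
  show ?thesis
    using fg f' g' cong[OF test_functions_deriv f'(1) li(1) f'(2)] cong[OF _ g'(1) li(2) g'(2)]
    by (simp add: has_weak_deriv_def)
qed

lemma weak_deriv: "weakly_differentiable f \<Longrightarrow> has_weak_deriv f (weak_deriv f)"
  using someI_ex[of "has_weak_deriv f"] unfolding weakly_differentiable_def weak_deriv_def by blast

lemma H1_D:
  assumes "f \<in> H1"
  shows "f \<in> L2" "weak_deriv f \<in> L2" "has_weak_deriv f (weak_deriv f)"
  using assms weak_deriv by (auto simp: H1_def)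

lemma L2_weak_deriv_primitive:
  assumes "has_weak_deriv f g" "f \<in> L2" "g \<in> L2"
  obtains F where "primitive F g" "F \<in> L2" "cls F = cls f"
proof -
  obtain F where F: "primitive F g" "AE x in lebesgue. f x = F x"
    using weak_deriv_primitive[OF assms(1) L2_absolutely_integrable(2)[OF assms(3)]] by blast
  have "F \<in> borel_measurable lebesgue"
    by (intro borel_imp_lebesgue_measurable borel_measurable_continuous_onI primitive_continuous[OF F(1)])
  then have "F \<in> L2"
    using L2_cong_AE[OF assms(2) _ F(2)] by blast
  moreover have "cls F = cls f"
    using F(2) assms(2) \<open>F \<in> L2\<close> by (subst cls_eq_iff) auto
  ultimately show ?thesis
    using F(1) that by blast
qed

definition curve :: "(real \<Rightarrow> real \<Rightarrow> real) \<Rightarrow> real \<Rightarrow> l2" where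
  "curve u t = cls (u t)"

lemma C_L2_continuous:
  assumes "u \<in> C_L2"
  shows "continuous_on {0..} (curve u)"
  unfolding continuous_on_def
proof
  fix t :: real assume t: "t \<in> {0..}"
  have ev: "\<forall>\<^sub>F s in at t within {0..}. L2_norm (\<lambda>x. u s x - u t x) = norm (curve u s - curve u t)"
    unfolding eventually_at_filter using assms t
    by (intro always_eventually) (auto simp: C_L2_def curve_def cls_diff norm_cls L2_diff)
  have "((\<lambda>s. L2_norm (\<lambda>x. u s x - u t x)) \<longlongrightarrow> 0) (at t within {0..})"
    using assms t by (simp add: C_L2_def)
  then have "((\<lambda>s. norm (curve u s - curve u t)) \<longlongrightarrow> 0) (at t within {0..})"
    using ev by (rule Lim_transform_eventually)
  then show "(curve u \<longlongrightarrow> curve u t) (at t within {0..})"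
    by (simp add: tendsto_norm_zero_iff Lim_null[symmetric])
qed

text \<open>
  The weak derivative of a difference is chosen independently of the weak derivatives of its terms;
  uniqueness identifies them almost everywhere.
\<close>

lemma C_H1_continuous:
  assumes "u \<in> C_H1"
  shows "continuous_on {0..} (curve (\<lambda>t. weak_deriv (u t)))"
  unfolding continuous_on_def
proof
  fix t :: real assume t: "t \<in> {0..}"
  have H1: "u s \<in> H1" if "s \<ge> 0" for s
    using assms that by (auto simp: C_H1_def)
  have le: "norm (cls (weak_deriv (u s)) - cls (weak_deriv (u t))) \<le> H1_norm (\<lambda>x. u s x - u t x)"
    if s: "s \<ge> 0" for s
  proof -
    let ?d = "\<lambda>x. u s x - u t x"
    note Hs = H1_D[OF H1[OF s]] and Ht = H1_D[OF H1, of t]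
    have d: "has_weak_deriv ?d (\<lambda>x. weak_deriv (u s) x - weak_deriv (u t) x)"
      using Hs Ht t by (intro has_weak_deriv_diff) auto
    have dL: "(\<lambda>x. weak_deriv (u s) x - weak_deriv (u t) x) \<in> L2"
      using Hs Ht t by (intro L2_diff) auto
    have wd: "has_weak_deriv ?d (weak_deriv ?d)"
      using d weak_deriv weakly_differentiable_def by blast
    then have wdm: "weak_deriv ?d \<in> borel_measurable lebesgue"
      by (intro locally_integrable_measurable) (simp add: has_weak_deriv_def)
    have "AE x in lebesgue. weak_deriv ?d x = weak_deriv (u s) x - weak_deriv (u t) x"
      by (rule has_weak_deriv_unique[OF wd d])
    then have "L2_norm (weak_deriv ?d) = L2_norm (\<lambda>x. weak_deriv (u s) x - weak_deriv (u t) x)"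
      unfolding L2_norm_def using L2_D(1)[OF dL] wdm
      by (intro arg_cong[where f = sqrt] integral_cong_AE borel_measurable_power) auto
    also have "\<dots> = norm (cls (weak_deriv (u s)) - cls (weak_deriv (u t)))"
      using Hs Ht t dL by (simp add: cls_diff norm_cls)
    finally show ?thesis
      unfolding H1_norm_def by (simp add: real_le_rsqrt)
  qed
  have "((\<lambda>s. norm (curve (\<lambda>t. weak_deriv (u t)) s - curve (\<lambda>t. weak_deriv (u t)) t)) \<longlongrightarrow> 0) (at t within {0..})"
  proof (rule tendsto_sandwich[where f = "\<lambda>_. 0" and h = "\<lambda>s. H1_norm (\<lambda>x. u s x - u t x)"])
    show "((\<lambda>s. H1_norm (\<lambda>x. u s x - u t x)) \<longlongrightarrow> 0) (at t within {0..})"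
      using assms t by (auto simp: C_H1_def)
    show "\<forall>\<^sub>F s in at t within {0..}. norm (curve (\<lambda>t. weak_deriv (u t)) s - curve (\<lambda>t. weak_deriv (u t)) t)
        \<le> H1_norm (\<lambda>x. u s x - u t x)"
      unfolding eventually_at_filter curve_def using le by (intro always_eventually) auto
  qed auto
  then show "(curve (\<lambda>t. weak_deriv (u t)) \<longlongrightarrow> curve (\<lambda>t. weak_deriv (u t)) t) (at t within {0..})"
    by (simp add: tendsto_norm_zero_iff Lim_null[symmetric])
qed

lemma C1_L2_D:
  assumes "u \<in> C1_L2"
  shows "continuous_on {0..} (curve (time_deriv u))"
    and "t \<ge> 0 \<Longrightarrow> time_deriv u t \<in> L2" "t \<ge> 0 \<Longrightarrow> u t \<in> L2"
    and "t \<ge> 0 \<Longrightarrow> (curve u has_vector_derivative curve (time_deriv u) t) (at t within {0..})"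
proof -
  show "continuous_on {0..} (curve (time_deriv u))"
    using assms by (intro C_L2_continuous) (auto simp: C1_L2_def)
  assume t: "t \<ge> 0"
  show v: "time_deriv u t \<in> L2" and "u t \<in> L2"
    using assms t by (auto simp: C1_L2_def C_L2_def)
  have uL: "u s \<in> L2" if "s \<ge> 0" for s
    using assms that by (auto simp: C1_L2_def C_L2_def)
  have "has_time_deriv u (time_deriv u t) t"
    using assms t someI_ex[of "\<lambda>v. has_time_deriv u v t"] unfolding C1_L2_def time_deriv_def by blast
  then have lim: "((\<lambda>s. L2_norm (\<lambda>x. (u s x - u t x) / (s - t) - time_deriv u t x)) \<longlongrightarrow> 0) (at t within {0..})"
    by (simp add: has_time_deriv_def)
  have "\<forall>\<^sub>F s in at t within {0..}. L2_norm (\<lambda>x. (u s x - u t x) / (s - t) - time_deriv u t x)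
      = norm ((1 / norm (s - t)) *\<^sub>R (curve u s - (curve u t + (s - t) *\<^sub>R curve (time_deriv u) t)))"
    unfolding eventually_at_filter
  proof (intro always_eventually allI impI)
    fix s assume s: "s \<noteq> t" "s \<in> {0..}"
    have "L2_norm (\<lambda>x. (u s x - u t x) / (s - t) - time_deriv u t x)
        = norm ((1 / (s - t)) *\<^sub>R (curve u s - curve u t) - curve (time_deriv u) t)"
      using s t v uL by (simp add: curve_def cls_diff cls_scaleR norm_cls L2_diff L2_cmult L2_divide)
    also have "(1 / (s - t)) *\<^sub>R (curve u s - curve u t) - curve (time_deriv u) t
        = (1 / (s - t)) *\<^sub>R (curve u s - (curve u t + (s - t) *\<^sub>R curve (time_deriv u) t))"
      using s by (simp add: scaleR_diff_right diff_diff_eq scaleR_add_right)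
    also have "norm \<dots> = norm ((1 / norm (s - t)) *\<^sub>R (curve u s - (curve u t + (s - t) *\<^sub>R curve (time_deriv u) t)))"
      by simp
    finally show "L2_norm (\<lambda>x. (u s x - u t x) / (s - t) - time_deriv u t x)
        = norm ((1 / norm (s - t)) *\<^sub>R (curve u s - (curve u t + (s - t) *\<^sub>R curve (time_deriv u) t)))" .
  qed
  from Lim_transform_eventually[OF lim this]
  show "(curve u has_vector_derivative curve (time_deriv u) t) (at t within {0..})"
    unfolding has_vector_derivative_def has_derivative_within
    by (auto intro: bounded_linear_scaleR_left tendsto_norm_zero_cancel)
qed

section \<open>The conjugate function\<close>

lemma integral_curve_deriv:
  fixes w :: "real \<Rightarrow> l2"
  assumes "continuous_on {0..} w" "t \<ge> 0"
  shows "((\<lambda>t. integral {0..t} w) has_vector_derivative w t) (at t within {0..})"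
proof -
  have "((\<lambda>t. integral {0..t} w) has_vector_derivative w t) (at t within {0..t + 1})"
    using assms by (intro integral_has_vector_derivative continuous_on_subset[OF assms(1)]) auto
  moreover have "at t within {0..t + 1} = at t within {0..}"
    using assms(2) by (intro at_within_nhd[of _ "{..<t + 1}"]) auto
  ultimately show ?thesis by simp
qed

lemma partial_deriv_product:
  assumes "\<And>x. f differentiable (at (x::real))" "\<And>x. g differentiable (at (x::real))"
  shows "(\<lambda>z. f (fst z) * g (snd z)) differentiable (at z)"
    and "partial_deriv (1, 0) (\<lambda>z. f (fst z) * g (snd z)) = (\<lambda>z. deriv f (fst z) * g (snd z))"
    and "partial_deriv (0, 1) (\<lambda>z. f (fst z) * g (snd z)) = (\<lambda>z. f (fst z) * deriv g (snd z))"
proof -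
  have d: "((\<lambda>z. f (fst z) * g (snd z)) has_derivative
      (\<lambda>h. f (fst z) * (deriv g (snd z) * snd h) + deriv f (fst z) * fst h * g (snd z))) (at z)" for z
  proof -
    have f: "(f has_derivative (\<lambda>h. deriv f x * h)) (at x)" and g: "(g has_derivative (\<lambda>h. deriv g x * h)) (at x)" for x
      using assms by (simp_all add: DERIV_deriv_iff_real_differentiable flip: has_field_derivative_def)
    have "((\<lambda>z. f (fst z)) has_derivative (\<lambda>h. deriv f (fst z) * fst h)) (at z)"
      by (rule has_derivative_compose[OF _ f]) (auto intro!: derivative_eq_intros)
    moreover have "((\<lambda>z. g (snd z)) has_derivative (\<lambda>h. deriv g (snd z) * snd h)) (at z)"
      by (rule has_derivative_compose[OF _ g]) (auto intro!: derivative_eq_intros)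
    ultimately show ?thesis
      by (rule has_derivative_mult)
  qed
  show "(\<lambda>z. f (fst z) * g (snd z)) differentiable (at z)"
    using d unfolding differentiable_def by blast
  show "partial_deriv (1, 0) (\<lambda>z. f (fst z) * g (snd z)) = (\<lambda>z. deriv f (fst z) * g (snd z))"
    "partial_deriv (0, 1) (\<lambda>z. f (fst z) * g (snd z)) = (\<lambda>z. f (fst z) * deriv g (snd z))"
    by (simp_all add: partial_deriv_def fun_eq_iff flip: frechet_derivative_at[OF d])
qed

lemma Ck_product:
  fixes f g :: "real \<Rightarrow> real"
  assumes "\<And>k. Ck k f" "\<And>k. Ck k g"
  shows "Ck k (\<lambda>z. f (fst z) * g (snd z))"
  using assms
proof (induction k arbitrary: f g)
  case 0
  have "continuous_on UNIV f" "continuous_on UNIV g"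
    using 0[of 0] by auto
  then show ?case
    by (auto intro!: continuous_intros continuous_on_compose2[of UNIV f] continuous_on_compose2[of UNIV g])
next
  case (Suc k)
  have diff: "f differentiable (at x)" "g differentiable (at x)" for x
    using Suc.prems(1)[of 1] Suc.prems(2)[of 1] by auto
  have "Ck l (deriv f)" "Ck l (deriv g)" for l
    using Suc.prems[of "Suc l"] unfolding Ck_Suc_real by auto
  then have "Ck k (\<lambda>z. deriv f (fst z) * g (snd z))" "Ck k (\<lambda>z. f (fst z) * deriv g (snd z))"
    using Suc by auto
  moreover have B: "(Basis :: (real \<times> real) set) = {(1, 0), (0, 1)}"
    by (auto simp: Basis_prod_def)
  ultimately show ?case
    unfolding Ck.simps(2) B using partial_deriv_product[OF diff] by simp
qed

lemma test_functions_product: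
  assumes \<phi>: "\<phi> \<in> test_functions A" and \<psi>: "\<psi> \<in> test_functions (B :: real set)"
  shows "(\<lambda>z. \<phi> (fst z) * \<psi> (snd z)) \<in> test_functions ((A :: real set) \<times> B)"
proof -
  let ?S = "closure {t. \<phi> t \<noteq> 0} \<times> closure {x. \<psi> x \<noteq> 0}"
  have S: "compact ?S" "?S \<subseteq> A \<times> B"
    using \<phi> \<psi> by (auto simp: test_functions_def intro: compact_Times)
  have "{z. \<phi> (fst z) * \<psi> (snd z) \<noteq> 0} \<subseteq> ?S"
    using closure_subset[of "{t. \<phi> t \<noteq> 0}"] closure_subset[of "{x. \<psi> x \<noteq> 0}"] by auto
  then have sub: "closure {z. \<phi> (fst z) * \<psi> (snd z) \<noteq> 0} \<subseteq> ?S"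
    using S(1) by (intro closure_minimal compact_imp_closed)
  then have "compact (closure {z. \<phi> (fst z) * \<psi> (snd z) \<noteq> 0})"
    using S(1) bounded_subset compact_eq_bounded_closed by blast
  with sub S(2) show ?thesis
    using Ck_product[OF test_functionsD(1)[OF \<phi>] test_functionsD(1)[OF \<psi>]]
    unfolding test_functions_def by (blast intro: order_trans)
qed

lemma constant_if_integrals_linear:
  fixes f :: "real \<Rightarrow> real"
  assumes f: "continuous_on UNIV f"
    and lin: "\<And>a b. 0 < a \<Longrightarrow> a \<le> b \<Longrightarrow> (LINT x:{a..b}|lebesgue. f x) = K * (b - a)" and "t \<ge> 0"
  shows "f t = K"
proof -
  have pos: "f t = K" if "t > 0" for t
  proof -
    have eq: "integral {t / 2..x} f = K * (x - t / 2)" if "x \<ge> t / 2" for x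
    proof -
      have "f absolutely_integrable_on {t / 2..x}"
        by (intro absolutely_integrable_continuous_real continuous_on_subset[OF f]) auto
      then show ?thesis
        using lin[of "t / 2" x] that \<open>t > 0\<close> set_lebesgue_integral_eq_integral(2) by fastforce
    qed
    have "((\<lambda>x. integral {t / 2..x} f) has_real_derivative f t) (at t within {t / 2..t + 1})"
      using that by (intro integral_has_real_derivative continuous_on_subset[OF f]) auto
    then have "((\<lambda>x. integral {t / 2..x} f) has_real_derivative f t) (at t)"
      using that by (subst (asm) at_within_interior) auto
    then have "((\<lambda>x. K * (x - t / 2)) has_real_derivative f t) (at t)"
      by (rule has_field_derivative_transform_within_open[of _ _ _ "{t / 2<..}"]) (use that eq in auto)
    moreover have "((\<lambda>x. K * (x - t / 2)) has_real_derivative K) (at t)"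
      by (auto intro!: derivative_eq_intros)
    ultimately show ?thesis
      by (rule DERIV_unique)
  qed
  have "(f \<longlongrightarrow> f 0) (at_right 0)"
    using f by (metis continuous_on_def UNIV_I tendsto_within_subset top_greatest)
  moreover have "(f \<longlongrightarrow> K) (at_right 0)"
    by (rule tendsto_eventually) (use pos in \<open>auto simp: eventually_at_right_field intro!: exI[of _ 1]\<close>)
  ultimately have "f 0 = K"
    using tendsto_unique trivial_limit_at_right_real by blast
  with pos \<open>t \<ge> 0\<close> show ?thesis
    by (cases "t = 0") auto
qed

text \<open>
  With the test function a product of a function of time and one of space, the wave equation says
  that the momentum \<open>c\<^sup>-\<^sup>2 u\<^sub>t\<close> changes in time at the rate \<open>u\<^sub>x\<^sub>x\<close>.  Integrated in time, this
  makes \<open>Y\<close>, the time integral of \<open>u\<^sub>x\<close>, conjugate to \<open>u\<close>: its increments in time have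
  increments of the momentum as weak space derivative.
\<close>

lemma conjugate_weak_deriv:
  fixes c :: "real \<Rightarrow> real" and u :: "real \<Rightarrow> real \<Rightarrow> real"
  defines "Y \<equiv> \<lambda>t. integral {0..t} (curve (\<lambda>t. weak_deriv (u t)))"
  assumes c: "(\<lambda>x. 1 / c x) \<in> borel_measurable lebesgue" "AE x in lebesgue. \<bar>1 / c x\<bar> \<le> M"
    and u: "u \<in> C_H1" "u \<in> C1_L2" "wave_equation c u" and st: "0 \<le> s" "0 \<le> t"
    and y: "y \<in> L2" "cls y = Y t - Y s"
  shows "has_weak_deriv y (\<lambda>x. 1 / (c x)\<^sup>2 * (time_deriv u t x - time_deriv u s x))"
proof -
  define \<rho> where "\<rho> x = 1 / (c x)\<^sup>2" for x
  define U where "U = curve u"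
  define Ut where "Ut = curve (time_deriv u)"
  define Ux where "Ux = curve (\<lambda>t. weak_deriv (u t))"
  have \<rho>m: "\<rho> \<in> borel_measurable lebesgue"
    using borel_measurable_power[OF c(1), of 2] by (simp add: \<rho>_def[abs_def] power_one_over)
  have \<rho>b: "AE x in lebesgue. \<bar>\<rho> x\<bar> \<le> M\<^sup>2"
    using c(2)
  proof eventually_elim
    case (elim x)
    then have "\<bar>1 / c x\<bar>\<^sup>2 \<le> M\<^sup>2"
      by (intro power_mono) auto
    then show ?case
      by (simp add: \<rho>_def power_one_over)
  qed
  have \<rho>L2: "(\<lambda>x. \<rho> x * g x) \<in> L2" if g: "g \<in> L2" for g
  proof (rule L2_bound[OF g, of _ "M\<^sup>2"])
    show "AE x in lebesgue. \<bar>\<rho> x * g x\<bar> \<le> M\<^sup>2 * \<bar>g x\<bar>"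
      using \<rho>b by eventually_elim (simp add: abs_mult mult_right_mono)
  qed (intro borel_measurable_times \<rho>m L2_D(1)[OF g])
  have uH: "u t \<in> H1" if "t \<ge> 0" for t
    using u(1) that by (auto simp: C_H1_def)
  note uD = C1_L2_D[OF u(2)]
  have Uxc: "continuous_on {0..} Ux"
    unfolding Ux_def by (rule C_H1_continuous[OF u(1)])
  have Ud: "(U has_vector_derivative Ut t) (at t within {0..})" if "t \<ge> 0" for t
    unfolding U_def Ut_def by (rule uD(4)[OF that])
  have Yd: "(Y has_vector_derivative Ux t) (at t within {0..})" if "t \<ge> 0" for t
    using integral_curve_deriv[OF Uxc that] unfolding Y_def Ux_def .
  have conserved: "inner (Ut t - Ut s) (cls (\<lambda>x. \<rho> x * \<psi> x)) + inner (Y t - Y s) (cls (deriv \<psi>)) = 0"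
    if \<psi>: "\<psi> \<in> test_functions UNIV" for \<psi>
  proof -
    define A where "A = cls (\<lambda>x. \<rho> x * \<psi> x)"
    define B where "B = cls (deriv \<psi>)"
    note \<psi>' = test_functions_deriv[OF \<psi>] and \<psi>'' = test_functions_deriv[OF test_functions_deriv[OF \<psi>]]
    define p where "p t = inner (Ut t) A + inner (Y t) B" for t
    have inner_c: "continuous_on {0..} (\<lambda>t. inner (w t) Z)" if "continuous_on {0..} w" for w :: "real \<Rightarrow> l2" and Z
      using that by (intro continuous_intros)
    have Yc: "continuous_on {0..} Y"
      using Yd by (intro continuous_on_vector_derivative[where f' = Ux]) auto
    have Uc: "continuous_on {0..} U"
      using Ud by (intro continuous_on_vector_derivative[where f' = Ut]) auto
    have pc: "continuous_on {0..} p"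
      unfolding p_def Ut_def using uD(1) Yc by (intro continuous_intros)
    have pc': "continuous_on UNIV (\<lambda>t. p (max 0 t))"
      by (intro continuous_on_compose2[OF pc] continuous_intros) auto
    have ortho: "(LINT t|lebesgue. p (max 0 t) * deriv \<phi> t) = 0" if \<phi>: "\<phi> \<in> test_functions {0<..}" for \<phi>
    proof -
      note \<phi>' = test_functions_deriv[OF \<phi>] and \<phi>'' = test_functions_deriv[OF test_functions_deriv[OF \<phi>]]
      have neg: "\<theta> t = 0" if "\<theta> \<in> test_functions {0<..}" "t \<le> 0" for \<theta> and t :: real
        using that closure_subset[of "{z. \<theta> z \<noteq> 0}"] by (force simp: test_functions_def)
      obtain T1 T2 T3 where T: "T1 > 0" "\<And>t. \<bar>t\<bar> > T1 \<Longrightarrow> \<phi> t = 0" "\<And>t. \<bar>t\<bar> > T2 \<Longrightarrow> deriv \<phi> t = 0"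
          "\<And>t. \<bar>t\<bar> > T3 \<Longrightarrow> deriv (deriv \<phi>) t = 0"
        using test_functions_bounds[OF \<phi>] test_functions_bounds[OF \<phi>'] test_functions_bounds[OF \<phi>''] by metis
      define T where "T = max T1 (max T2 T3) + 1"
      have T0: "T > 0"
        using T by (simp add: T_def)
      have large: "\<phi> t = 0" "deriv \<phi> t = 0" "deriv (deriv \<phi>) t = 0" if "t \<ge> T" for t
        using T that by (auto simp: T_def)
      define E where "E t = deriv (deriv \<phi>) t * inner (U t) A + \<phi> t * inner (Ux t) B" for t
      have Ec: "continuous_on {0..T} E"
        unfolding E_def using test_functionsD(3)[OF \<phi>] test_functionsD(3)[OF \<phi>''] Uc Uxc
        by (intro continuous_intros) (auto intro: continuous_on_subset)
      let ?\<Phi> = "\<lambda>z. \<phi> (fst z) * \<psi> (snd z)"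
      let ?space = "\<lambda>t. LINT x|lebesgue. u t x * (1 / (c x)\<^sup>2 * partial_deriv (1, 0) (partial_deriv (1, 0) ?\<Phi>) (t, x)
          - partial_deriv (0, 1) (partial_deriv (0, 1) ?\<Phi>) (t, x))"
      have space: "?space t = E t"
        if t: "t \<ge> 0" for t
      proof -
        have pd: "partial_deriv (1, 0) (partial_deriv (1, 0) ?\<Phi>) = (\<lambda>z. deriv (deriv \<phi>) (fst z) * \<psi> (snd z))"
          "partial_deriv (0, 1) (partial_deriv (0, 1) ?\<Phi>) = (\<lambda>z. \<phi> (fst z) * deriv (deriv \<psi>) (snd z))"
          using test_functionsD(2)[OF \<phi>] test_functionsD(2)[OF \<phi>'] test_functionsD(2)[OF \<psi>] test_functionsD(2)[OF \<psi>']
          by (simp_all add: partial_deriv_product)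
        note i1 = L2_mult_integrable[OF uD(3)[OF t] \<rho>L2[OF test_functions_L2[OF \<psi>]]]
          and i2 = L2_mult_integrable[OF uD(3)[OF t] test_functions_L2[OF \<psi>'']]
        have "(LINT x|lebesgue. u t x * (1 / (c x)\<^sup>2 * (deriv (deriv \<phi>) t * \<psi> x) - \<phi> t * deriv (deriv \<psi>) x))
            = (LINT x|lebesgue. deriv (deriv \<phi>) t * (u t x * (\<rho> x * \<psi> x)) - \<phi> t * (u t x * deriv (deriv \<psi>) x))"
          by (intro Bochner_Integration.integral_cong) (auto simp: \<rho>_def algebra_simps)
        also have "\<dots> = deriv (deriv \<phi>) t * (LINT x|lebesgue. u t x * (\<rho> x * \<psi> x)) - \<phi> t * (LINT x|lebesgue. u t x * deriv (deriv \<psi>) x)"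
          using i1 i2 by simp
        also have "(LINT x|lebesgue. u t x * (\<rho> x * \<psi> x)) = inner (U t) A"
          using uD(3)[OF t] \<rho>L2[OF test_functions_L2[OF \<psi>]] by (simp add: U_def curve_def A_def cls_inner)
        also have "(LINT x|lebesgue. u t x * deriv (deriv \<psi>) x) = - (LINT x|lebesgue. weak_deriv (u t) x * deriv \<psi> x)"
          using H1_D(3)[OF uH[OF t]] \<psi>' by (simp add: has_weak_deriv_def)
        also have "(LINT x|lebesgue. weak_deriv (u t) x * deriv \<psi> x) = inner (Ux t) B"
          using H1_D(2)[OF uH[OF t]] test_functions_L2[OF \<psi>'] by (simp add: Ux_def curve_def B_def cls_inner)
        finally show ?thesis
          unfolding pd by (simp add: E_def)
      qed
      have Ei: "E absolutely_integrable_on {0..T}"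
        using Ec by (rule absolutely_integrable_continuous_real)
      have "?\<Phi> \<in> test_functions ({0<..} \<times> UNIV)"
        by (rule test_functions_product[OF \<phi> \<psi>])
      then have "0 = (LINT t:{0<..}|lebesgue. ?space t)"
        by (rule u(3)[unfolded wave_equation_def, rule_format, symmetric])
      also have "\<dots> = (LINT t:{0..T}|lebesgue. E t)"
        unfolding set_lebesgue_integral_def
      proof (intro Bochner_Integration.integral_cong refl)
        fix t :: real
        have "E t = 0" if "t = 0 \<or> t \<ge> T"
          using that large neg[OF \<phi>, of 0] neg[OF \<phi>'', of 0] by (auto simp: E_def)
        then show "indicator {0<..} t *\<^sub>R ?space t = indicator {0..T} t *\<^sub>R E t"
          using space[of t] by (cases "t > 0"; cases "t \<ge> T") (auto simp: indicator_def)
      qed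
      also have "\<dots> = integral {0..T} E"
        by (rule set_lebesgue_integral_eq_integral(2)[OF Ei])
      finally have E0: "(E has_integral 0) {0..T}"
        using set_lebesgue_integral_eq_integral(1)[OF Ei] by (metis integrable_integral)
      define D where "D t = deriv \<phi> t * inner (U t) A + \<phi> t * inner (Y t) B" for t
      have "(D has_vector_derivative E t + deriv \<phi> t * p t) (at t within {0..T})" if t: "t \<in> {0..T}" for t
      proof -
        have d: "(U has_vector_derivative Ut t) (at t within {0..T})" "(Y has_vector_derivative Ux t) (at t within {0..T})"
          using t Ud[of t] Yd[of t] by (auto intro: has_vector_derivative_within_subset)
        have i: "((\<lambda>t. inner (w t) Z) has_vector_derivative inner w' Z) (at t within {0..T})"
          if "(w has_vector_derivative w') (at t within {0..T})" for w w' and Z :: l2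
          using bounded_linear.has_vector_derivative[OF bounded_linear_inner_left that] .
        have f: "(\<theta> has_vector_derivative deriv \<theta> t) (at t within {0..T})" if "\<theta> \<in> test_functions {0<..}" for \<theta>
          using test_functionsD(5)[OF that, of t]
          by (simp add: has_field_derivative_at_within flip: has_real_derivative_iff_has_vector_derivative)
        have "(D has_vector_derivative (deriv \<phi> t * inner (Ut t) A + deriv (deriv \<phi>) t * inner (U t) A)
            + (\<phi> t * inner (Ux t) B + deriv \<phi> t * inner (Y t) B)) (at t within {0..T})"
          unfolding D_def by (intro has_vector_derivative_add has_vector_derivative_mult f \<phi> \<phi>' i d)
        then show ?thesis
          by (simp add: E_def p_def algebra_simps)
      qed
      then have "((\<lambda>t. E t + deriv \<phi> t * p t) has_integral D T - D 0) {0..T}"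
        using T0 by (intro fundamental_theorem_of_calculus) auto
      moreover have "D T = 0" "D 0 = 0"
        using large[of T] neg[OF \<phi>, of 0] neg[OF \<phi>', of 0] by (auto simp: D_def)
      ultimately have "((\<lambda>t. E t + deriv \<phi> t * p t - E t) has_integral 0 - 0) {0..T}"
        using E0 by (intro has_integral_diff) auto
      then have int0: "integral {0..T} (\<lambda>t. deriv \<phi> t * p t) = 0"
        by (simp add: integral_unique)
      have "(\<lambda>t. deriv \<phi> t * p t) absolutely_integrable_on {0..T}"
        using test_functionsD(4)[OF \<phi>] pc
        by (intro absolutely_integrable_continuous_real continuous_intros) (auto intro: continuous_on_subset)
      then have "(LINT t:{0..T}|lebesgue. deriv \<phi> t * p t) = 0"
        using set_lebesgue_integral_eq_integral(2) int0 by fastforce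
      moreover have eq: "indicator {0..T} t *\<^sub>R (deriv \<phi> t * p t) = p (max 0 t) * deriv \<phi> t" for t
        using large[of t] neg[OF \<phi>', of t] by (cases "t \<le> 0"; cases "t \<ge> T") (auto simp: indicator_def)
      ultimately show ?thesis
        unfolding set_lebesgue_integral_def eq by simp
    qed
    have "locally_integrable (\<lambda>t. p (max 0 t))"
      unfolding locally_integrable_def
      using pc' by (auto intro: absolutely_integrable_continuous_real continuous_on_subset)
    then obtain K where K: "\<And>a b. a \<le> b \<Longrightarrow> {a..b} \<subseteq> {0<..} \<Longrightarrow> (LINT t:{a..b}|lebesgue. p (max 0 t)) = K * (b - a)"
      using du_Bois_Reymond[of "\<lambda>t. p (max 0 t)" "{0<..}"] ortho by (auto simp: is_interval_1)
    have "p (max 0 r) = K" if "r \<ge> 0" for r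
    proof (rule constant_if_integrals_linear[of "\<lambda>t. p (max 0 t)", OF pc' _ that])
      show "(LINT t:{a..b}|lebesgue. p (max 0 t)) = K * (b - a)" if "0 < a" "a \<le> b" for a b
        using that by (intro K) auto
    qed
    from this[OF st(1)] this[OF st(2)] st have "p s = p t"
      by simp
    then show ?thesis
      by (simp add: p_def A_def B_def inner_diff_left)
  qed
  have utL: "(\<lambda>x. time_deriv u t x - time_deriv u s x) \<in> L2"
    using st uD(2) L2_diff by blast
  have UtL: "Ut t - Ut s = cls (\<lambda>x. time_deriv u t x - time_deriv u s x)"
    using st uD(2) by (simp add: Ut_def curve_def cls_diff)
  have "has_weak_deriv y (\<lambda>x. \<rho> x * (time_deriv u t x - time_deriv u s x))"
    unfolding has_weak_deriv_def
  proof (intro conjI ballI L2_locally_integrable y(1) \<rho>L2 utL)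
    fix \<psi> :: "real \<Rightarrow> real" assume \<psi>: "\<psi> \<in> test_functions UNIV"
    have "(LINT x|lebesgue. y x * deriv \<psi> x) = inner (Y t - Y s) (cls (deriv \<psi>))"
      using y test_functions_L2[OF test_functions_deriv[OF \<psi>]] by (simp add: cls_inner flip: y(2))
    also have "\<dots> = - inner (cls (\<lambda>x. time_deriv u t x - time_deriv u s x)) (cls (\<lambda>x. \<rho> x * \<psi> x))"
      using conserved[OF \<psi>] unfolding UtL by simp
    also have "\<dots> = - (LINT x|lebesgue. \<rho> x * (time_deriv u t x - time_deriv u s x) * \<psi> x)"
      using utL \<rho>L2[OF test_functions_L2[OF \<psi>]] by (simp add: cls_inner ac_simps)
    finally show "(LINT x|lebesgue. y x * deriv \<psi> x) = - (LINT x|lebesgue. \<rho> x * (time_deriv u t x - time_deriv u s x) * \<psi> x)" .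
  qed
  then show ?thesis
    by (simp add: \<rho>_def)
qed

section \<open>The multiplier identity\<close>

definition bounded_weight :: "(real \<Rightarrow> real) \<Rightarrow> bool" where
  "bounded_weight k \<longleftrightarrow> k \<in> borel_measurable lebesgue \<and> (\<exists>M. \<forall>x. \<bar>k x\<bar> \<le> M)"

lemma bounded_weight_const: "bounded_weight (\<lambda>x. r)"
  by (auto simp: bounded_weight_def)

lemma bounded_weight_mult:
  assumes "bounded_weight k" "bounded_weight l"
  shows "bounded_weight (\<lambda>x. k x * l x)"
proof -
  obtain M N where MN: "\<And>x. \<bar>k x\<bar> \<le> M" "\<And>x. \<bar>l x\<bar> \<le> N"
    using assms by (auto simp: bounded_weight_def)
  have "\<bar>k x * l x\<bar> \<le> M * N" for x
    using mult_mono[OF MN(1)[of x] MN(2)[of x]] order_trans[OF abs_ge_zero MN(1)[of x]]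
    by (simp add: abs_mult)
  then show ?thesis
    using assms by (auto simp: bounded_weight_def intro!: borel_measurable_times)
qed

lemma bounded_weight_add:
  assumes "bounded_weight k" "bounded_weight l"
  shows "bounded_weight (\<lambda>x. k x + l x)"
proof -
  obtain M N where MN: "\<And>x. \<bar>k x\<bar> \<le> M" "\<And>x. \<bar>l x\<bar> \<le> N"
    using assms by (auto simp: bounded_weight_def)
  have "\<bar>k x + l x\<bar> \<le> M + N" for x
    using MN(1)[of x] MN(2)[of x] by linarith
  then show ?thesis
    using assms by (auto simp: bounded_weight_def intro!: borel_measurable_add)
qed

lemma bounded_weight_cmult: "bounded_weight k \<Longrightarrow> bounded_weight (\<lambda>x. r * k x)"
  by (intro bounded_weight_mult bounded_weight_const)

lemma bounded_weight_diff: "bounded_weight k \<Longrightarrow> bounded_weight l \<Longrightarrow> bounded_weight (\<lambda>x. k x - l x)"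
  using bounded_weight_add[OF _ bounded_weight_cmult[of l "-1"]] by simp

lemma bounded_weight_L2:
  assumes k: "bounded_weight k" and f: "f \<in> L2"
  shows "(\<lambda>x. k x * f x) \<in> L2"
proof -
  obtain M where M: "\<And>x. \<bar>k x\<bar> \<le> M"
    using k by (auto simp: bounded_weight_def)
  show ?thesis
  proof (rule L2_bound[OF f, of _ M])
    show "(\<lambda>x. k x * f x) \<in> borel_measurable lebesgue"
      using k L2_D(1)[OF f] by (auto simp: bounded_weight_def intro!: borel_measurable_times)
    show "AE x in lebesgue. \<bar>k x * f x\<bar> \<le> M * \<bar>f x\<bar>"
      using M by (intro AE_I2) (simp add: abs_mult mult_right_mono)
  qed
qed

lemma bounded_weight_integrable:
  assumes "bounded_weight k" "f \<in> L2" "g \<in> L2"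
  shows "integrable lebesgue (\<lambda>x. k x * f x * g x)"
  by (intro L2_mult_integrable bounded_weight_L2 assms)

definition weight_mult :: "(real \<Rightarrow> real) \<Rightarrow> l2 \<Rightarrow> l2" where
  "weight_mult k X = cls (\<lambda>x. k x * rep_l2 X x)"

lemma weight_mult_cls:
  assumes "bounded_weight k" "f \<in> L2"
  shows "weight_mult k (cls f) = cls (\<lambda>x. k x * f x)"
  unfolding weight_mult_def
  by (subst cls_eq_iff) (use assms rep_cls[OF assms(2)] in \<open>auto intro: bounded_weight_L2 rep_L2\<close>)

lemma inner_weight_mult:
  assumes "bounded_weight k" "f \<in> L2" "g \<in> L2"
  shows "inner (weight_mult k (cls f)) (cls g) = (LINT x|lebesgue. k x * f x * g x)"
  using assms by (simp add: weight_mult_cls cls_inner bounded_weight_L2)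

lemma inner_weight_mult_commute:
  assumes "bounded_weight k"
  shows "inner (weight_mult k X) Y = inner (weight_mult k Y) X"
proof -
  obtain f g where "f \<in> L2" "X = cls f" "g \<in> L2" "Y = cls g"
    by (metis cls_exhaust)
  then show ?thesis
    using assms by (simp add: inner_weight_mult ac_simps)
qed

lemma bounded_linear_weight_mult:
  assumes k: "bounded_weight k"
  shows "bounded_linear (weight_mult k)"
proof -
  obtain M where M: "\<And>x. \<bar>k x\<bar> \<le> M"
    using k by (auto simp: bounded_weight_def)
  then have M0: "M \<ge> 0"
    using order_trans[OF abs_ge_zero] by blast
  show ?thesis
  proof (rule bounded_linear_intro[where K = M])
    fix X Y :: l2 and r :: real
    obtain f g where fg: "f \<in> L2" "X = cls f" "g \<in> L2" "Y = cls g"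
      by (metis cls_exhaust)
    show "weight_mult k (X + Y) = weight_mult k X + weight_mult k Y"
      using fg k by (simp add: cls_add L2_add weight_mult_cls bounded_weight_L2 distrib_left)
    show "weight_mult k (r *\<^sub>R X) = r *\<^sub>R weight_mult k X"
      using fg k by (simp add: cls_scaleR L2_cmult weight_mult_cls bounded_weight_L2 mult.left_commute)
    have "(norm (weight_mult k X))\<^sup>2 = (LINT x|lebesgue. (k x * f x)\<^sup>2)"
      using fg k by (simp add: weight_mult_cls norm_cls_sq bounded_weight_L2)
    also have "\<dots> \<le> (LINT x|lebesgue. M\<^sup>2 * (f x)\<^sup>2)"
    proof (rule integral_mono)
      fix x
      have "(k x)\<^sup>2 \<le> M\<^sup>2"
        using power_mono[OF M abs_ge_zero, of x 2] by simp
      then show "(k x * f x)\<^sup>2 \<le> M\<^sup>2 * (f x)\<^sup>2"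
        by (simp add: power_mult_distrib mult_right_mono)
    qed (use L2_D(2)[OF fg(1)] L2_D(2)[OF bounded_weight_L2[OF k fg(1)]] in auto)
    also have "\<dots> = (norm X * M)\<^sup>2"
      using fg by (simp add: norm_cls_sq power_mult_distrib)
    finally show "norm (weight_mult k X) \<le> norm X * M"
      by (rule power2_le_imp_le) (use M0 in simp)
  qed
qed

text \<open>
  With \<open>\<rho> = c\<^sup>-\<^sup>2\<close>, \<open>X\<close> the velocity and \<open>Y\<close> the strain of a wave, this is the integral of
  \<open>a\<close> times the energy density plus \<open>b\<close> times the momentum density.
\<close>

definition energy :: "(real \<Rightarrow> real) \<Rightarrow> (real \<Rightarrow> real) \<Rightarrow> (real \<Rightarrow> real) \<Rightarrow> l2 \<Rightarrow> l2 \<Rightarrow> real" where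
  "energy \<rho> a b X Y = (inner (weight_mult (\<lambda>x. a x * \<rho> x) X) X + inner (weight_mult a Y) Y) / 2
     + inner (weight_mult (\<lambda>x. b x * \<rho> x) X) Y"

lemma energy_eq_integral:
  assumes w: "bounded_weight \<rho>" "bounded_weight a" "bounded_weight b" and f: "f \<in> L2" "g \<in> L2"
  shows "energy \<rho> a b (cls f) (cls g)
      = (LINT x|lebesgue. a x * (\<rho> x * (f x)\<^sup>2 + (g x)\<^sup>2) / 2 + b x * \<rho> x * f x * g x)"
    and "integrable lebesgue (\<lambda>x. a x * (\<rho> x * (f x)\<^sup>2 + (g x)\<^sup>2) / 2 + b x * \<rho> x * f x * g x)"
proof -
  note i = bounded_weight_integrable[OF bounded_weight_mult[OF w(2,1)] f(1) f(1)]
    bounded_weight_integrable[OF w(2) f(2) f(2)]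
    bounded_weight_integrable[OF bounded_weight_mult[OF w(3,1)] f(1) f(2)]
  have eq: "a x * (\<rho> x * (f x)\<^sup>2 + (g x)\<^sup>2) / 2 + b x * \<rho> x * f x * g x
      = (a x * \<rho> x * f x * f x + a x * g x * g x) / 2 + b x * \<rho> x * f x * g x" for x
    by (simp add: power2_eq_square algebra_simps)
  show "energy \<rho> a b (cls f) (cls g)
      = (LINT x|lebesgue. a x * (\<rho> x * (f x)\<^sup>2 + (g x)\<^sup>2) / 2 + b x * \<rho> x * f x * g x)"
    unfolding eq using i by (simp add: energy_def inner_weight_mult bounded_weight_mult w f)
  show "integrable lebesgue (\<lambda>x. a x * (\<rho> x * (f x)\<^sup>2 + (g x)\<^sup>2) / 2 + b x * \<rho> x * f x * g x)"
    unfolding eq using i by auto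
qed

lemma tendsto_energy:
  assumes "bounded_weight \<rho>" "bounded_weight a" "bounded_weight b" "(X \<longlongrightarrow> x) F" "(Y \<longlongrightarrow> y) F"
  shows "((\<lambda>h. energy \<rho> a b (X h) (Y h)) \<longlongrightarrow> energy \<rho> a b x y) F"
  unfolding energy_def
  by (intro tendsto_intros bounded_linear.tendsto[OF bounded_linear_weight_mult] bounded_weight_mult assms) simp

lemma energy_has_derivative:
  assumes w: "bounded_weight \<rho>" "bounded_weight a" "bounded_weight b"
    and V: "(V has_vector_derivative V') (at t within S)" and W: "(W has_vector_derivative W') (at t within S)"
  shows "((\<lambda>t. energy \<rho> a b (V t) (W t)) has_real_derivative
    inner (weight_mult (\<lambda>x. a x * \<rho> x) (V t)) V' + inner (weight_mult a (W t)) W'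
    + (inner (weight_mult (\<lambda>x. b x * \<rho> x) V') (W t) + inner (weight_mult (\<lambda>x. b x * \<rho> x) (V t)) W')) (at t within S)"
proof -
  have inn: "((\<lambda>t. inner (weight_mult k (X t)) (Z t)) has_real_derivative
      inner (weight_mult k (X t)) Z' + inner (weight_mult k X') (Z t)) (at t within S)"
    if "bounded_weight k" "(X has_vector_derivative X') (at t within S)" "(Z has_vector_derivative Z') (at t within S)"
    for k X X' Z Z'
    unfolding has_real_derivative_iff_has_vector_derivative
    by (intro bounded_bilinear.has_vector_derivative[OF bounded_bilinear_inner]
        bounded_linear.has_vector_derivative[OF bounded_linear_weight_mult] that)
  have 1: "((\<lambda>t. inner (weight_mult (\<lambda>x. a x * \<rho> x) (V t)) (V t)) has_real_derivative
      2 * inner (weight_mult (\<lambda>x. a x * \<rho> x) (V t)) V') (at t within S)"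
    using inn[OF bounded_weight_mult[OF w(2,1)] V V] inner_weight_mult_commute[OF bounded_weight_mult[OF w(2,1)], of V']
    by simp
  have 2: "((\<lambda>t. inner (weight_mult a (W t)) (W t)) has_real_derivative 2 * inner (weight_mult a (W t)) W') (at t within S)"
    using inn[OF w(2) W W] inner_weight_mult_commute[OF w(2), of W'] by simp
  show ?thesis
    unfolding energy_def
    using DERIV_add[OF DERIV_cdivide[OF DERIV_add[OF 1 2], of 2] inn[OF bounded_weight_mult[OF w(3,1)] V W]]
    by (simp add: add_divide_distrib add.commute add.left_commute)
qed

text \<open>
  The bounds on the weights and on their derivatives make all terms of the multiplier identity
  integrable, for any square integrable velocity and strain.
\<close>

definition multiplier ::
  "(real \<Rightarrow> real) \<Rightarrow> (real \<Rightarrow> real) \<Rightarrow> (real \<Rightarrow> real) \<Rightarrow> (real \<Rightarrow> real) \<Rightarrow> (real \<Rightarrow> real) \<Rightarrow> (real \<Rightarrow> real) \<Rightarrow> bool"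
  where "multiplier \<rho> a a' b b' d \<longleftrightarrow>
     primitive a a' \<and> primitive b b' \<and> primitive (\<lambda>x. b x * \<rho> x) d \<and>
     bounded_weight a \<and> bounded_weight a' \<and> bounded_weight b \<and> bounded_weight b' \<and> bounded_weight d"

text \<open>
  Here \<open>v\<close> and \<open>w\<close> are velocity and strain, and the four functions satisfy \<open>v\<^sub>x = w\<^sub>t\<close> and
  \<open>w\<^sub>x = \<rho> v\<^sub>t\<close>; the primed ones are the derivatives in time.  The integrands differ by the space
  derivative of \<open>a v w + b w\<^sup>2 / 2 + b \<rho> v\<^sup>2 / 2\<close>.
\<close>

lemma multiplier_identity:
  assumes m: "multiplier \<rho> a a' b b' d" and \<rho>: "bounded_weight \<rho>"
    and L: "v \<in> L2" "w \<in> L2" "v' \<in> L2" "w' \<in> L2"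
    and v: "primitive v w'" and w: "primitive w (\<lambda>x. \<rho> x * v' x)"
  shows "inner (weight_mult (\<lambda>x. a x * \<rho> x) (cls v)) (cls v') + inner (weight_mult a (cls w)) (cls w')
      + (inner (weight_mult (\<lambda>x. b x * \<rho> x) (cls v')) (cls w) + inner (weight_mult (\<lambda>x. b x * \<rho> x) (cls v)) (cls w'))
    = - (LINT x|lebesgue. a' x * v x * w x + b' x * (w x)\<^sup>2 / 2 + d x * (v x)\<^sup>2 / 2)"
proof -
  note m = m[unfolded multiplier_def] and bm = bounded_weight_mult
  let ?f = "\<lambda>x. a x * \<rho> x * v x * v' x + a x * w x * w' x + (b x * \<rho> x * v' x * w x + b x * \<rho> x * v x * w' x)"
  let ?g = "\<lambda>x. a' x * v x * w x + b' x * (w x)\<^sup>2 / 2 + d x * (v x)\<^sup>2 / 2"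
  note bi = bounded_weight_integrable
  have i: "integrable lebesgue (\<lambda>x. a x * \<rho> x * v x * v' x)" "integrable lebesgue (\<lambda>x. a x * w x * w' x)"
    "integrable lebesgue (\<lambda>x. b x * \<rho> x * v' x * w x)" "integrable lebesgue (\<lambda>x. b x * \<rho> x * v x * w' x)"
    by (intro bi bm L; use m \<rho> in blast)+
  have fi: "integrable lebesgue ?f"
    using i by auto
  have gi: "integrable lebesgue ?g"
    using bi[of a' v w] bi[of b' w w] bi[of d v v] m L by (auto simp: power2_eq_square mult.assoc)
  define F where "F = (\<lambda>x. a x * (v x * w x) + (1 / 2) * (b x * (w x * w x)) + (1 / 2) * (b x * \<rho> x * (v x * v x)))"
  have Fi: "integrable lebesgue F"
    using bi[of a v w] bi[of b w w] bi[of "\<lambda>x. b x * \<rho> x" v v] bm[of b \<rho>] m \<rho> L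
    by (auto simp: F_def mult.assoc)
  have "primitive F (\<lambda>x. (a' x * (v x * w x) + a x * (w' x * w x + v x * (\<rho> x * v' x)))
      + (1 / 2) * (b' x * (w x * w x) + b x * ((\<rho> x * v' x) * w x + w x * (\<rho> x * v' x)))
      + (1 / 2) * (d x * (v x * v x) + b x * \<rho> x * (w' x * v x + v x * w' x)))"
    unfolding F_def using m v w by (intro primitive_add primitive_cmult primitive_mult) auto
  also have "(\<lambda>x. (a' x * (v x * w x) + a x * (w' x * w x + v x * (\<rho> x * v' x)))
      + (1 / 2) * (b' x * (w x * w x) + b x * ((\<rho> x * v' x) * w x + w x * (\<rho> x * v' x)))
      + (1 / 2) * (d x * (v x * v x) + b x * \<rho> x * (w' x * v x + v x * w' x))) = (\<lambda>x. ?f x + ?g x)"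
    by (rule ext) (simp add: power2_eq_square algebra_simps)
  finally have "(LINT x|lebesgue. ?f x + ?g x) = 0"
    using Fi fi gi by (intro integral_derivative_eq_0) auto
  then have "(LINT x|lebesgue. ?f x) = - (LINT x|lebesgue. ?g x)"
    using fi gi by simp
  moreover have "(LINT x|lebesgue. ?f x) = inner (weight_mult (\<lambda>x. a x * \<rho> x) (cls v)) (cls v') + inner (weight_mult a (cls w)) (cls w')
      + (inner (weight_mult (\<lambda>x. b x * \<rho> x) (cls v')) (cls w) + inner (weight_mult (\<lambda>x. b x * \<rho> x) (cls v)) (cls w'))"
    using i m \<rho> L by (simp add: inner_weight_mult bm)
  ultimately show ?thesis by simp
qed

text \<open>
  By the multiplier identity, the time derivative of the weighted energy with weights
  \<open>a0 + t a1\<close> and \<open>b0 + t b1\<close> is the integral of the difference of the two sides of the last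
  hypothesis, taken at the velocity and the strain.
\<close>

lemma energy_decreasing_strong:
  assumes \<rho>: "bounded_weight \<rho>"
    and m0: "multiplier \<rho> a0 a0' b0 b0' d0" and m1: "multiplier \<rho> a1 a1' b1 b1' d1"
    and T: "T \<ge> 0"
    and V: "\<And>t. 0 \<le> t \<Longrightarrow> (V has_vector_derivative Vt t) (at t within {0..})"
    and W: "\<And>t. 0 \<le> t \<Longrightarrow> (W has_vector_derivative Wt t) (at t within {0..})"
    and strong: "\<And>t. 0 \<le> t \<Longrightarrow> \<exists>v w v' w'. v \<in> L2 \<and> w \<in> L2 \<and> v' \<in> L2 \<and> w' \<in> L2 \<and>
        V t = cls v \<and> W t = cls w \<and> Vt t = cls v' \<and> Wt t = cls w' \<and>
        primitive v w' \<and> primitive w (\<lambda>x. \<rho> x * v' x)"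
    and form: "\<And>t. 0 \<le> t \<Longrightarrow> t \<le> T \<Longrightarrow> AE x in lebesgue. \<forall>v w.
        a1 x * (\<rho> x * v\<^sup>2 + w\<^sup>2) / 2 + b1 x * \<rho> x * v * w
        \<le> (a0' x + t * a1' x) * v * w + (b0' x + t * b1' x) * w\<^sup>2 / 2 + (d0 x + t * d1 x) * v\<^sup>2 / 2"
  shows "energy \<rho> a0 b0 (V T) (W T) + T * energy \<rho> a1 b1 (V T) (W T) \<le> energy \<rho> a0 b0 (V 0) (W 0)"
proof -
  note m0' = m0[unfolded multiplier_def] and m1' = m1[unfolded multiplier_def]
  define Q where "Q t = energy \<rho> a0 b0 (V t) (W t) + t * energy \<rho> a1 b1 (V t) (W t)" for t
  have der: "\<exists>D\<le>0. (Q has_real_derivative D) (at t within {0..})" if t: "0 \<le> t" "t \<le> T" for t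
  proof -
    obtain v w v' w' where L: "v \<in> L2" "w \<in> L2" "v' \<in> L2" "w' \<in> L2"
      and eq: "V t = cls v" "W t = cls w" "Vt t = cls v'" "Wt t = cls w'"
      and p: "primitive v w'" "primitive w (\<lambda>x. \<rho> x * v' x)"
      using strong[OF t(1)] by blast
    let ?R = "\<lambda>a' b' d x. a' x * v x * w x + b' x * (w x)\<^sup>2 / 2 + d x * (v x)\<^sup>2 / 2"
    have d0: "((\<lambda>t. energy \<rho> a0 b0 (V t) (W t)) has_real_derivative - (LINT x|lebesgue. ?R a0' b0' d0 x)) (at t within {0..})"
      using energy_has_derivative[OF \<rho> _ _ V[OF t(1)] W[OF t(1)], of a0 b0] m0'
      unfolding eq multiplier_identity[OF m0 \<rho> L p] by auto
    have d1: "((\<lambda>t. energy \<rho> a1 b1 (V t) (W t)) has_real_derivative - (LINT x|lebesgue. ?R a1' b1' d1 x)) (at t within {0..})"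
      using energy_has_derivative[OF \<rho> _ _ V[OF t(1)] W[OF t(1)], of a1 b1] m1'
      unfolding eq multiplier_identity[OF m1 \<rho> L p] by auto
    note bi = bounded_weight_integrable
    have i: "integrable lebesgue (?R a0' b0' d0)" "integrable lebesgue (?R a1' b1' d1)"
      using bi[of a0' v w] bi[of b0' w w] bi[of d0 v v] bi[of a1' v w] bi[of b1' w w] bi[of d1 v v] m0' m1' L
      by (auto simp: power2_eq_square mult.assoc)
    let ?E = "\<lambda>x. a1 x * (\<rho> x * (v x)\<^sup>2 + (w x)\<^sup>2) / 2 + b1 x * \<rho> x * v x * w x"
    have Ei: "integrable lebesgue ?E" and E: "energy \<rho> a1 b1 (V t) (W t) = (LINT x|lebesgue. ?E x)"
      using energy_eq_integral[OF \<rho> _ _ L(1,2), of a1 b1] m1' unfolding eq by auto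
    have "(Q has_real_derivative - (LINT x|lebesgue. ?R a0' b0' d0 x)
        + (t * - (LINT x|lebesgue. ?R a1' b1' d1 x) + 1 * energy \<rho> a1 b1 (V t) (W t))) (at t within {0..})"
      unfolding Q_def by (intro DERIV_add d0 DERIV_mult'[OF DERIV_ident d1])
    moreover have "- (LINT x|lebesgue. ?R a0' b0' d0 x)
        + (t * - (LINT x|lebesgue. ?R a1' b1' d1 x) + 1 * energy \<rho> a1 b1 (V t) (W t)) \<le> 0"
    proof -
      have "(LINT x|lebesgue. ?E x) \<le> (LINT x|lebesgue. ?R a0' b0' d0 x + t * ?R a1' b1' d1 x)"
      proof (rule integral_mono_AE)
        show "AE x in lebesgue. ?E x \<le> ?R a0' b0' d0 x + t * ?R a1' b1' d1 x"
          using form[OF t]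
        proof eventually_elim
          case (elim x)
          from elim[rule_format, of "v x" "w x"] show ?case
            by (simp add: algebra_simps add_divide_distrib)
        qed
      qed (use Ei i in auto)
      also have "\<dots> = (LINT x|lebesgue. ?R a0' b0' d0 x) + t * (LINT x|lebesgue. ?R a1' b1' d1 x)"
        using i by (simp only: Bochner_Integration.integral_add integrable_mult_right integral_mult_right_zero)
      finally show ?thesis
        by (simp add: E)
    qed
    ultimately show ?thesis by blast
  qed
  have "Q T \<le> Q 0"
  proof (rule DERIV_nonpos_imp_decreasing_open[OF T])
    show "\<exists>D. (Q has_real_derivative D) (at t) \<and> D \<le> 0" if "0 < t" "t < T" for t
    proof -
      have "at t within {0..} = at t"
        using that by (intro at_within_interior) auto
      then show ?thesis
        using der[of t] that by auto
    qed
    show "continuous_on {0..T} Q"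
      unfolding continuous_on_eq_continuous_within
    proof
      fix t assume "t \<in> {0..T}"
      then obtain D where "(Q has_real_derivative D) (at t within {0..})"
        using der by auto
      then have "continuous (at t within {0..}) Q"
        by (rule DERIV_continuous)
      then show "continuous (at t within {0..T}) Q"
        by (rule continuous_within_subset) auto
    qed
  qed
  then show ?thesis
    by (simp add: Q_def)
qed

section \<open>Weak solutions\<close>

lemma right_difference_quotient:
  fixes U :: "real \<Rightarrow> 'a::real_normed_vector"
  assumes "(U has_vector_derivative D) (at t within {0..})" "t \<ge> 0"
  shows "((\<lambda>h. (1 / h) *\<^sub>R (U (t + h) - U t)) \<longlongrightarrow> D) (at_right 0)"
proof -
  have "((\<lambda>y. (1 / norm (y - t)) *\<^sub>R (U y - (U t + (y - t) *\<^sub>R D))) \<longlongrightarrow> 0) (at t within {0..})"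
    using assms(1) unfolding has_vector_derivative_def has_derivative_within by blast
  moreover have "filterlim (\<lambda>h. t + h) (at t within {0..}) (at_right 0)"
    unfolding filterlim_at
  proof
    show "\<forall>\<^sub>F h in at_right 0. t + h \<in> {0..} \<and> t + h \<noteq> t"
      unfolding eventually_at_right_field using assms(2) by (intro exI[of _ 1]) auto
    have "((\<lambda>h. t + h) \<longlongrightarrow> t + 0) (at_right 0)"
      by (intro tendsto_intros)
    then show "((\<lambda>h. t + h) \<longlongrightarrow> t) (at_right 0)"
      by simp
  qed
  ultimately have lim: "((\<lambda>h. (1 / norm (t + h - t)) *\<^sub>R (U (t + h) - (U t + (t + h - t) *\<^sub>R D))) \<longlongrightarrow> 0) (at_right 0)"
    by (rule filterlim_compose)
  have ev: "\<forall>\<^sub>F h in at_right 0. (1 / norm (t + h - t)) *\<^sub>R (U (t + h) - (U t + (t + h - t) *\<^sub>R D))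
      = (1 / h) *\<^sub>R (U (t + h) - U t) - D"
    unfolding eventually_at_right_field
    by (intro exI[of _ 1]) (auto simp: scaleR_diff_right scaleR_add_right)
  show ?thesis
    by (rule LIM_zero_cancel) (rule Lim_transform_eventually[OF lim ev])
qed

lemma has_vector_derivative_shift_right:
  fixes U :: "real \<Rightarrow> 'a::real_normed_vector"
  assumes "(U has_vector_derivative D) (at (t + h) within {0..})" "h \<ge> 0"
  shows "((\<lambda>t. U (t + h)) has_vector_derivative D) (at t within {0..})"
proof -
  have "((\<lambda>t. t + h) has_vector_derivative 1) (at t within {0..})"
    by (auto intro!: derivative_eq_intros)
  moreover have "(U has_vector_derivative D) (at (t + h) within (\<lambda>t. t + h) ` {0..})"
    using assms by (auto intro: has_vector_derivative_within_subset)
  ultimately show ?thesis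
    using vector_diff_chain_within[of "\<lambda>t. t + h" 1 t "{0..}" U D] by (simp add: o_def)
qed

text \<open>
  Averaging over a time interval of length \<open>h\<close> turns a weak solution into a strong one: its
  velocity and strain are difference quotients of the solution and of the conjugate function, and
  both of these have weak space derivatives.  The inequality for the averages involves only two
  instants of time, so it survives the limit \<open>h \<rightarrow> 0\<close>.
\<close>

lemma energy_decreasing_weak:
  assumes c: "(\<lambda>x. 1 / c x) \<in> borel_measurable lebesgue" "AE x in lebesgue. \<bar>1 / c x\<bar> \<le> M"
    and \<rho>: "bounded_weight \<rho>" "AE x in lebesgue. 1 / (c x)\<^sup>2 = \<rho> x"
    and u: "u \<in> C_H1" "u \<in> C1_L2" "wave_equation c u"
    and m0: "multiplier \<rho> a0 a0' b0 b0' d0" and m1: "multiplier \<rho> a1 a1' b1 b1' d1"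
    and T: "T \<ge> 0"
    and form: "\<And>t. 0 \<le> t \<Longrightarrow> t \<le> T \<Longrightarrow> AE x in lebesgue. \<forall>v w.
        a1 x * (\<rho> x * v\<^sup>2 + w\<^sup>2) / 2 + b1 x * \<rho> x * v * w
        \<le> (a0' x + t * a1' x) * v * w + (b0' x + t * b1' x) * w\<^sup>2 / 2 + (d0 x + t * d1 x) * v\<^sup>2 / 2"
  shows "energy \<rho> a0 b0 (cls (time_deriv u T)) (cls (weak_deriv (u T)))
      + T * energy \<rho> a1 b1 (cls (time_deriv u T)) (cls (weak_deriv (u T)))
      \<le> energy \<rho> a0 b0 (cls (time_deriv u 0)) (cls (weak_deriv (u 0)))"
proof -
  define U where "U = curve u"
  define Ut where "Ut = curve (time_deriv u)"
  define Ux where "Ux = curve (\<lambda>t. weak_deriv (u t))"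
  define Y where "Y t = integral {0..t} Ux" for t
  have Ud: "(U has_vector_derivative Ut t) (at t within {0..})" if "t \<ge> 0" for t
    unfolding U_def Ut_def by (rule C1_L2_D(4)[OF u(2) that])
  have Yd: "(Y has_vector_derivative Ux t) (at t within {0..})" if "t \<ge> 0" for t
    unfolding Y_def Ux_def by (rule integral_curve_deriv[OF C_H1_continuous[OF u(1)] that])
  have uL: "u t \<in> L2" "time_deriv u t \<in> L2" "weak_deriv (u t) \<in> L2" "has_weak_deriv (u t) (weak_deriv (u t))"
    if "t \<ge> 0" for t
    using C1_L2_D(2,3)[OF u(2) that] u(1) that H1_D[of "u t"] by (auto simp: C_H1_def)
  define V where "V h t = (1 / h) *\<^sub>R (U (t + h) - U t)" for h t
  define W where "W h t = (1 / h) *\<^sub>R (Y (t + h) - Y t)" for h t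
  have le: "energy \<rho> a0 b0 (V h T) (W h T) + T * energy \<rho> a1 b1 (V h T) (W h T) \<le> energy \<rho> a0 b0 (V h 0) (W h 0)"
    if h: "h > 0" for h
  proof (rule energy_decreasing_strong[OF \<rho>(1) m0 m1 T _ _ _ form])
    fix t :: real assume t: "t \<ge> 0"
    show "(V h has_vector_derivative (1 / h) *\<^sub>R (Ut (t + h) - Ut t)) (at t within {0..})"
      unfolding V_def using t h
      by (intro bounded_linear.has_vector_derivative[OF bounded_linear_scaleR_right]
          has_vector_derivative_diff has_vector_derivative_shift_right Ud) auto
    show "(W h has_vector_derivative (1 / h) *\<^sub>R (Ux (t + h) - Ux t)) (at t within {0..})"
      unfolding W_def using t h
      by (intro bounded_linear.has_vector_derivative[OF bounded_linear_scaleR_right]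
          has_vector_derivative_diff has_vector_derivative_shift_right Yd) auto
    have th: "t + h \<ge> 0"
      using t h by simp
    note L0 = uL[OF t] and L1 = uL[OF th]
    define v' where "v' x = 1 / h * (time_deriv u (t + h) x - time_deriv u t x)" for x
    define w' where "w' x = 1 / h * (weak_deriv (u (t + h)) x - weak_deriv (u t) x)" for x
    have v': "v' \<in> L2" "(1 / h) *\<^sub>R (Ut (t + h) - Ut t) = cls v'"
      using L0 L1 by (auto simp: v'_def[abs_def] Ut_def curve_def cls_diff cls_scaleR L2_diff intro: L2_cmult L2_divide)
    have w': "w' \<in> L2" "(1 / h) *\<^sub>R (Ux (t + h) - Ux t) = cls w'"
      using L0 L1 by (auto simp: w'_def[abs_def] Ux_def curve_def cls_diff cls_scaleR L2_diff intro: L2_cmult L2_divide)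
    have wd: "has_weak_deriv (\<lambda>x. 1 / h * (u (t + h) x - u t x)) w'"
      unfolding w'_def[abs_def] using L0 L1 by (intro has_weak_deriv_cmult has_weak_deriv_diff)
    obtain v where v: "primitive v w'" "v \<in> L2" "cls v = cls (\<lambda>x. 1 / h * (u (t + h) x - u t x))"
      by (rule L2_weak_deriv_primitive[OF wd L2_cmult[OF L2_diff[OF L1(1) L0(1)]] w'(1)])
    have v_eq: "V h t = cls v"
      using L0 L1 by (simp add: v(3) V_def U_def curve_def cls_diff cls_scaleR L2_diff)
    obtain y where y: "y \<in> L2" "cls y = Y (t + h) - Y t"
      by (metis cls_exhaust)
    have \<rho>v'L: "(\<lambda>x. \<rho> x * v' x) \<in> L2"
      by (rule bounded_weight_L2[OF \<rho>(1) v'(1)])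
    have "has_weak_deriv y (\<lambda>x. 1 / (c x)\<^sup>2 * (time_deriv u (t + h) x - time_deriv u t x))"
      using conjugate_weak_deriv[OF c u t th y(1)] y(2) unfolding Y_def Ux_def by simp
    moreover have AE: "AE x in lebesgue. 1 / (c x)\<^sup>2 * (time_deriv u (t + h) x - time_deriv u t x)
        = \<rho> x * (time_deriv u (t + h) x - time_deriv u t x)"
      using \<rho>(2) by eventually_elim simp
    moreover have hL: "(\<lambda>x. \<rho> x * (time_deriv u (t + h) x - time_deriv u t x)) \<in> L2"
      using L0 L1 by (intro bounded_weight_L2[OF \<rho>(1)] L2_diff)
    ultimately have "has_weak_deriv y (\<lambda>x. \<rho> x * (time_deriv u (t + h) x - time_deriv u t x))"
      by (intro has_weak_deriv_cong_AE[OF _ _ L2_locally_integrable[OF y(1)] AE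
            L2_locally_integrable[OF hL]]) auto
    from has_weak_deriv_cmult[OF this, of "1 / h"]
    have wd': "has_weak_deriv (\<lambda>x. 1 / h * y x) (\<lambda>x. \<rho> x * v' x)"
      by (simp add: v'_def mult.left_commute)
    obtain w where w: "primitive w (\<lambda>x. \<rho> x * v' x)" "w \<in> L2" "cls w = cls (\<lambda>x. 1 / h * y x)"
      by (rule L2_weak_deriv_primitive[OF wd' L2_cmult[OF y(1)] \<rho>v'L])
    have w_eq: "W h t = cls w"
      using y by (simp add: w(3) W_def cls_scaleR flip: y(2))
    show "\<exists>v w v' w'. v \<in> L2 \<and> w \<in> L2 \<and> v' \<in> L2 \<and> w' \<in> L2 \<and>
        V h t = cls v \<and> W h t = cls w \<and> (1 / h) *\<^sub>R (Ut (t + h) - Ut t) = cls v' \<and>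
        (1 / h) *\<^sub>R (Ux (t + h) - Ux t) = cls w' \<and> primitive v w' \<and> primitive w (\<lambda>x. \<rho> x * v' x)"
      using v v_eq w w_eq v' w' by blast
  qed
  have lim: "((\<lambda>h. V h t) \<longlongrightarrow> Ut t) (at_right 0)" "((\<lambda>h. W h t) \<longlongrightarrow> Ux t) (at_right 0)" if "t \<ge> 0" for t
    unfolding V_def W_def using that by (intro right_difference_quotient Ud Yd; simp)+
  note bw = m0[unfolded multiplier_def] m1[unfolded multiplier_def]
  have "energy \<rho> a0 b0 (Ut T) (Ux T) + T * energy \<rho> a1 b1 (Ut T) (Ux T) \<le> energy \<rho> a0 b0 (Ut 0) (Ux 0)"
  proof (rule tendsto_le[OF trivial_limit_at_right_real])
    show "((\<lambda>h. energy \<rho> a0 b0 (V h 0) (W h 0)) \<longlongrightarrow> energy \<rho> a0 b0 (Ut 0) (Ux 0)) (at_right 0)"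
      using bw by (intro tendsto_energy \<rho> lim) auto
    show "((\<lambda>h. energy \<rho> a0 b0 (V h T) (W h T) + T * energy \<rho> a1 b1 (V h T) (W h T))
        \<longlongrightarrow> energy \<rho> a0 b0 (Ut T) (Ux T) + T * energy \<rho> a1 b1 (Ut T) (Ux T)) (at_right 0)"
      using bw T by (intro tendsto_add tendsto_mult tendsto_const tendsto_energy \<rho> lim) auto
    show "\<forall>\<^sub>F h in at_right 0. energy \<rho> a0 b0 (V h T) (W h T) + T * energy \<rho> a1 b1 (V h T) (W h T)
        \<le> energy \<rho> a0 b0 (V h 0) (W h 0)"
      unfolding eventually_at_right_field using le by (intro exI[of _ 1]) auto
  qed
  then show ?thesis
    by (simp add: Ut_def Ux_def curve_def)
qed

section \<open>Almost everywhere bounds\<close>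

lemma Linf_AE_le:
  assumes "f \<in> Linf"
  shows "AE x in lebesgue. \<bar>f x\<bar> \<le> Linf_norm f" "Linf_norm f \<ge> 0"
proof -
  define s where "s = esssup lebesgue (\<lambda>x. ereal \<bar>f x\<bar>)"
  have AE: "AE x in lebesgue. ereal \<bar>f x\<bar> \<le> s"
    unfolding s_def by (rule esssup_AE)
  have "s < \<infinity>"
    using assms by (simp add: Linf_def s_def)
  moreover have "s \<ge> 0"
  proof (rule ccontr)
    assume "\<not> s \<ge> 0"
    then have no: "\<not> ereal \<bar>f x\<bar> \<le> s" for x
      by (metis abs_ge_zero ereal_less_eq(5) order_trans)
    have "AE x::real in lebesgue. False"
      using AE by (simp add: no)
    then show False
      by (subst (asm) AE_iff_measurable[OF _ refl]) auto
  qed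
  ultimately have s: "s = ereal (Linf_norm f)"
    unfolding Linf_norm_def s_def[symmetric] by (cases s) auto
  show "AE x in lebesgue. \<bar>f x\<bar> \<le> Linf_norm f" "Linf_norm f \<ge> 0"
    using AE \<open>s \<ge> 0\<close> unfolding s by simp_all
qed

lemma closed_AE_UNIV:
  assumes "closed S" "AE x in lebesgue. x \<in> (S :: real set)"
  shows "x \<in> S"
proof (rule ccontr)
  assume "x \<notin> S"
  then obtain e where e: "e > 0" "ball x e \<subseteq> - S"
    using assms(1) open_contains_ball[of "- S"] by (auto simp: open_Compl)
  have "AE y in lebesgue. y \<notin> ball x e"
    using assms(2) by eventually_elim (use e(2) in auto)
  then have "emeasure lebesgue {y. y \<in> ball x e} = 0"
    by (subst (asm) AE_iff_measurable[OF _ refl]) auto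
  moreover have "{y. y \<in> ball x e} = {x - e<..<x + e}"
    by (auto simp: dist_real_def)
  ultimately show False
    using e(1) by simp
qed

lemma primitive_zero_AE:
  assumes "primitive (\<lambda>x. 0) f"
  shows "AE x in lebesgue. f x = 0"
proof (rule AE_zero_if_integral_intervals_zero)
  show "locally_integrable f"
    using primitiveD(1)[OF assms] by (simp add: locally_integrable_def)
  show "(LINT x:{a..b}|lebesgue. f x) = 0" if "a \<le> b" for a b
    using primitiveD(4)[OF assms that] set_lebesgue_integral_eq_integral(2)[OF primitiveD(1)[OF assms]] by simp
qed

lemma bounded_absolutely_integrable:
  fixes f :: "real \<Rightarrow> real"
  assumes "f \<in> borel_measurable lebesgue" "AE x in lebesgue. \<bar>f x\<bar> \<le> B"
  shows "f absolutely_integrable_on {a..b}" "(\<lambda>x. (f x)\<^sup>2) absolutely_integrable_on {a..b}"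
proof -
  have i: "integrable lebesgue (\<lambda>x. B * indicator {a..b} x)" for B :: real
    by (cases "a \<le> b") (auto simp: integrable_indicator_iff)
  have ind: "indicator {a..b} \<in> borel_measurable lebesgue"
    by (intro borel_measurable_indicator) auto
  show "f absolutely_integrable_on {a..b}"
    unfolding set_integrable_def
  proof (rule Bochner_Integration.integrable_bound[OF i[of B]])
    show "AE x in lebesgue. norm (indicator {a..b} x *\<^sub>R f x) \<le> norm (B * indicator {a..b} x)"
      using assms(2) by eventually_elim (auto simp: indicator_def)
  qed (intro borel_measurable_scaleR ind assms(1))
  show "(\<lambda>x. (f x)\<^sup>2) absolutely_integrable_on {a..b}"
    unfolding set_integrable_def
  proof (rule Bochner_Integration.integrable_bound[OF i[of "B\<^sup>2"]])
    show "AE x in lebesgue. norm (indicator {a..b} x *\<^sub>R (f x)\<^sup>2) \<le> norm (B\<^sup>2 * indicator {a..b} x)"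
      using assms(2)
    proof eventually_elim
      case (elim x)
      then show ?case
        using power_mono[OF elim abs_ge_zero, of 2] by (auto simp: indicator_def)
    qed
  qed (intro borel_measurable_scaleR borel_measurable_power ind assms(1))
qed

lemma primitive_piecewise:
  assumes F: "continuous_on UNIV F" and S: "finite S"
    and der: "\<And>x. x \<notin> S \<Longrightarrow> (F has_real_derivative f x) (at x)"
    and f: "bounded_weight f"
  shows "primitive F f"
  unfolding primitive_def
proof (intro allI impI conjI)
  fix x y :: real assume "x \<le> y"
  obtain B where B: "\<And>x. \<bar>f x\<bar> \<le> B"
    using f by (auto simp: bounded_weight_def)
  show "f absolutely_integrable_on {x..y}" "(\<lambda>s. (f s)\<^sup>2) absolutely_integrable_on {x..y}"
    using bounded_absolutely_integrable[of f B] f B by (auto simp: bounded_weight_def)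
  show "(f has_integral F y - F x) {x..y}"
    using S \<open>x \<le> y\<close> der
    by (intro fundamental_theorem_of_calculus_interior_strong[of S])
      (auto simp: has_real_derivative_iff_has_vector_derivative[symmetric] intro: continuous_on_subset[OF F])
qed

section \<open>Piecewise linear weights\<close>

text \<open>
  All weights are combinations of functions of slope one or zero, so that their derivatives are
  indicator functions, up to sign.
\<close>

definition cut :: "real \<Rightarrow> real \<Rightarrow> real \<Rightarrow> real" where
  "cut \<alpha> \<beta> x = max \<alpha> (min \<beta> x)"

definition ramp :: "real \<Rightarrow> real \<Rightarrow> real \<Rightarrow> real" where
  "ramp R l x = min (max 0 (\<bar>x\<bar> - R)) l"

definition odd_ramp :: "real \<Rightarrow> real \<Rightarrow> real \<Rightarrow> real" where
  "odd_ramp R l x = cut (- (R + l)) (R + l) x - cut (- R) R x"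

definition shell :: "real \<Rightarrow> real \<Rightarrow> real \<Rightarrow> real" where
  "shell R l x = (if R < \<bar>x\<bar> \<and> \<bar>x\<bar> < R + l then 1 else 0)"

definition core :: "real \<Rightarrow> real \<Rightarrow> real" where
  "core R x = (if \<bar>x\<bar> < R then 1 else 0)"

lemma odd_ramp_eq: "R > 0 \<Longrightarrow> l > 0 \<Longrightarrow> odd_ramp R l x = sgn x * ramp R l x"
  by (auto simp: odd_ramp_def cut_def ramp_def sgn_real_def min_def max_def)

lemma ramp_bounds:
  assumes "R > 0" "l > 0"
  shows "0 \<le> ramp R l x" "ramp R l x \<le> l" "ramp R l x \<le> \<bar>x\<bar>"
  using assms by (auto simp: ramp_def min_def max_def)

lemma primitive_cut:
  assumes "\<alpha> \<le> \<beta>"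
  shows "primitive (cut \<alpha> \<beta>) (indicator {\<alpha><..<\<beta>})"
proof (rule primitive_piecewise[where S = "{\<alpha>, \<beta>}"])
  show "continuous_on UNIV (cut \<alpha> \<beta>)"
    unfolding cut_def[abs_def] by (intro continuous_intros)
  show "bounded_weight (indicator {\<alpha><..<\<beta>})"
    by (auto simp: bounded_weight_def indicator_def intro!: borel_measurable_indicator exI[of _ 1])
  fix x assume "x \<notin> {\<alpha>, \<beta>}"
  then consider "x < \<alpha>" | "\<alpha> < x" "x < \<beta>" | "\<beta> < x"
    by fastforce
  then show "(cut \<alpha> \<beta> has_real_derivative indicator {\<alpha><..<\<beta>} x) (at x)"
  proof cases
    case 1
    have "((\<lambda>x. \<alpha>) has_real_derivative 0) (at x)"
      by simp
    then have "(cut \<alpha> \<beta> has_real_derivative 0) (at x)"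
      by (rule has_field_derivative_transform_within_open[of _ _ _ "{..<\<alpha>}"])
        (use 1 assms in \<open>auto simp: cut_def\<close>)
    with 1 show ?thesis by simp
  next
    case 2
    have "(cut \<alpha> \<beta> has_real_derivative 1) (at x)"
      by (rule has_field_derivative_transform_within_open[OF DERIV_ident, of "{\<alpha><..<\<beta>}"])
        (use 2 in \<open>auto simp: cut_def\<close>)
    with 2 show ?thesis by simp
  next
    case 3
    have "((\<lambda>x. \<beta>) has_real_derivative 0) (at x)"
      by simp
    then have "(cut \<alpha> \<beta> has_real_derivative 0) (at x)"
      by (rule has_field_derivative_transform_within_open[of _ _ _ "{\<beta><..}"])
        (use 3 assms in \<open>auto simp: cut_def\<close>)
    with 3 show ?thesis by simp
  qed
qed simp

lemma weight_derivatives: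
  assumes R: "R > 0" "l > 0"
  shows "primitive (ramp R l) (\<lambda>x. sgn x * shell R l x)"
    and "primitive (odd_ramp R l) (shell R l)"
    and "primitive (cut (- R) R) (core R)"
proof -
  have p: "primitive (cut R (R + l)) (indicator {R<..<R + l})"
    "primitive (cut (- (R + l)) (- R)) (indicator {- (R + l)<..<- R})"
    using R by (auto intro!: primitive_cut)
  have "primitive (\<lambda>x. cut R (R + l) x - cut (- (R + l)) (- R) x + (- 2 * R))
      (\<lambda>x. indicator {R<..<R + l} x - indicator {- (R + l)<..<- R} x + 0)"
    by (intro primitive_add primitive_diff p primitive_const)
  moreover have "(\<lambda>x. cut R (R + l) x - cut (- (R + l)) (- R) x + (- 2 * R)) = ramp R l"
    using R by (intro ext) (auto simp: cut_def ramp_def min_def max_def)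
  moreover have "(\<lambda>x. indicator {R<..<R + l} x - indicator {- (R + l)<..<- R} x + 0) = (\<lambda>x. sgn x * shell R l x)"
    using R by (intro ext) (auto simp: indicator_def shell_def sgn_real_def)
  ultimately show "primitive (ramp R l) (\<lambda>x. sgn x * shell R l x)"
    by simp
  have "primitive (\<lambda>x. cut R (R + l) x + cut (- (R + l)) (- R) x)
      (\<lambda>x. indicator {R<..<R + l} x + indicator {- (R + l)<..<- R} x)"
    by (intro primitive_add p)
  moreover have "(\<lambda>x. cut R (R + l) x + cut (- (R + l)) (- R) x) = odd_ramp R l"
    using R by (intro ext) (auto simp: cut_def odd_ramp_def min_def max_def)
  moreover have "(\<lambda>x. indicator {R<..<R + l} x + indicator {- (R + l)<..<- R} x) = shell R l"
    using R by (intro ext) (auto simp: indicator_def shell_def)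
  ultimately show "primitive (odd_ramp R l) (shell R l)"
    by simp
  have "indicator {- R<..<R} = core R"
    by (intro ext) (auto simp: core_def indicator_def)
  then show "primitive (cut (- R) R) (core R)"
    using primitive_cut[of "- R" R] R by simp
qed

lemma weights_bounded:
  assumes "R > 0" "l > 0"
  shows "bounded_weight (ramp R l)" "bounded_weight (odd_ramp R l)" "bounded_weight (cut (- R) R)"
    "bounded_weight (\<lambda>x. sgn x * shell R l x)" "bounded_weight (shell R l)" "bounded_weight (core R)"
proof -
  have c: "F \<in> borel_measurable lebesgue" if "primitive F f" for F f
    by (intro borel_imp_lebesgue_measurable borel_measurable_continuous_onI primitive_continuous[OF that])
  note p = weight_derivatives[OF assms]
  show "bounded_weight (ramp R l)"
    using c[OF p(1)] ramp_bounds[OF assms] by (auto simp: bounded_weight_def intro!: exI[of _ l])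
  show "bounded_weight (odd_ramp R l)"
    using c[OF p(2)] assms by (auto simp: bounded_weight_def odd_ramp_def cut_def intro!: exI[of _ "R + l + R"])
  show "bounded_weight (cut (- R) R)"
    using c[OF p(3)] assms by (auto simp: bounded_weight_def cut_def intro!: exI[of _ R])
  show "bounded_weight (\<lambda>x. sgn x * shell R l x)" "bounded_weight (shell R l)" "bounded_weight (core R)"
    unfolding bounded_weight_def
    by (intro conjI exI[of _ 1] allI primitive_measurable[OF p(1)] primitive_measurable[OF p(2)]
        primitive_measurable[OF p(3)]; simp add: shell_def core_def sgn_real_def)+
qed

section \<open>A representative of the wave speed\<close>

text \<open>
  Bounds that hold almost everywhere hold everywhere for a continuous representative \<open>C\<close> of the
  speed.  That the derivative vanishes almost everywhere in \<open>|x| > L\<close> is read off from the product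
  of \<open>C - 1\<close> with a function \<open>k\<close> that is positive exactly there.  The values of \<open>g\<close> on null sets are
  chosen such that it is bounded at every point.
\<close>

lemma slowness_representative:
  assumes c_inv: "(\<lambda>x. 1 / c x) \<in> Linf" and c_pos: "\<And>x. c x > 0"
    and c_diff: "weakly_differentiable c" "weak_deriv c \<in> Linf"
    and c_out: "\<And>x. \<bar>x\<bar> > L \<Longrightarrow> c x = 1" and L: "L > 0"
  obtains q g where "primitive q (\<lambda>x. - (g x * (q x)\<^sup>2))" "AE x in lebesgue. 1 / c x = q x"
    "\<And>x. q x > 0" "\<And>x. q x \<le> Linf_norm (\<lambda>x. 1 / c x)" "\<And>x. \<bar>x\<bar> > L \<Longrightarrow> q x = 1"
    "\<And>x. \<bar>g x\<bar> \<le> Linf_norm (weak_deriv c)" "\<And>x. \<bar>x\<bar> > L \<Longrightarrow> g x = 0" "g \<in> borel_measurable lebesgue"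
proof -
  define M where "M = Linf_norm (\<lambda>x. 1 / c x)"
  define D where "D = Linf_norm (weak_deriv c)"
  let ?w = "weak_deriv c"
  have wm: "?w \<in> borel_measurable lebesgue"
    using c_diff(2) by (auto simp: Linf_def)
  note M = Linf_AE_le[OF c_inv, folded M_def] and D = Linf_AE_le[OF c_diff(2), folded D_def]
  obtain C where C: "primitive C ?w" "AE x in lebesgue. c x = C x"
    using weak_deriv_primitive[OF weak_deriv[OF c_diff(1)] bounded_absolutely_integrable(2)[OF wm D(1)]] by blast
  have cont: "continuous_on UNIV C"
    by (rule primitive_continuous[OF C(1)])
  have CM: "1 \<le> M * C x" for x
  proof -
    have "x \<in> {x. 1 \<le> M * C x}"
    proof (rule closed_AE_UNIV)
      show "closed {x. 1 \<le> M * C x}"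
        using cont by (intro closed_Collect_le continuous_intros)
      show "AE x in lebesgue. x \<in> {x. 1 \<le> M * C x}"
        using M(1) C(2)
      proof eventually_elim
        case (elim x)
        then show ?case
          using c_pos[of x] by (simp add: divide_le_eq)
      qed
    qed
    then show ?thesis by simp
  qed
  have Mpos: "M > 0"
    using M(2) CM[of 0] by (cases "M = 0") auto
  have Cpos: "C x > 0" and CM': "C x \<in> {1 / M..}" for x
    using CM[of x] Mpos by (auto simp: divide_le_eq mult.commute) (metis less_le_trans zero_less_mult_pos zero_less_one)
  have C1: "C x = 1" if "\<bar>x\<bar> > L" for x
  proof -
    have "x \<in> {x. \<bar>x\<bar> \<le> L} \<union> {x. C x = 1}"
    proof (rule closed_AE_UNIV)
      show "closed ({x. \<bar>x\<bar> \<le> L} \<union> {x. C x = 1})"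
        using cont by (intro closed_Un closed_Collect_le closed_Collect_eq continuous_intros)
      show "AE x in lebesgue. x \<in> {x. \<bar>x\<bar> \<le> L} \<union> {x. C x = 1}"
        using C(2)
      proof eventually_elim
        case (elim x)
        then show ?case
          using c_out[of x] by (cases "\<bar>x\<bar> \<le> L") auto
      qed
    qed
    with that show ?thesis by auto
  qed
  define k where "k = ramp L 1"
  define k' where "k' = (\<lambda>x. sgn x * shell L 1 x)"
  have k: "primitive k k'"
    unfolding k_def k'_def by (rule weight_derivatives(1)[OF L zero_less_one])
  have "primitive (\<lambda>x. (C x - 1) * k x) (\<lambda>x. (?w x - 0) * k x + (C x - 1) * k' x)"
    by (intro primitive_mult primitive_diff C(1) primitive_const k)
  moreover have "(C x - 1) * k x = 0" for x
    using C1[of x] by (cases "\<bar>x\<bar> > L") (auto simp: k_def ramp_def)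
  ultimately have "AE x in lebesgue. (?w x - 0) * k x + (C x - 1) * k' x = 0"
    using primitive_zero_AE by simp
  then have w0: "AE x in lebesgue. \<bar>x\<bar> > L \<longrightarrow> ?w x = 0"
    by eventually_elim (use C1 in \<open>auto simp: k_def ramp_def min_def max_def split: if_splits\<close>)
  define g where "g x = (if \<bar>x\<bar> > L \<or> D < \<bar>?w x\<bar> then 0 else ?w x)" for x
  have gm: "g \<in> borel_measurable lebesgue"
  proof -
    have [measurable]: "?w \<in> borel_measurable lebesgue" "(\<lambda>x::real. x) \<in> borel_measurable lebesgue"
      using wm by (auto intro: borel_imp_lebesgue_measurable)
    show ?thesis
      unfolding g_def[abs_def] by measurable
  qed
  have "AE x in lebesgue. ?w x = g x"
    using w0 D(1) by eventually_elim (auto simp: g_def)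
  then have Cg: "primitive C g"
    using primitive_cong[OF C(1) _ gm] by blast
  have "primitive (\<lambda>x. 1 / C x) (\<lambda>x. - (1 / (C x)\<^sup>2) * g x)"
  proof (rule primitive_chain[OF Cg, where S = "{1 / M..}" and B = "2 * M ^ 3" and \<phi> = "\<lambda>z. 1 / z" and \<phi>' = "\<lambda>z. - (1 / z\<^sup>2)"])
    show "is_interval {1 / M..}"
      by (auto simp: is_interval_1)
    show "C x \<in> {1 / M..}" for x
      by (rule CM')
    fix z assume z: "z \<in> {1 / M..}"
    then have zpos: "z > 0"
      using Mpos by (auto intro: less_le_trans[of 0 "1 / M"])
    then show "((\<lambda>z. 1 / z) has_real_derivative - (1 / z\<^sup>2)) (at z within {1 / M..})"
      by (auto intro!: derivative_eq_intros simp: power2_eq_square)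
    fix w assume w: "w \<in> {1 / M..}"
    then have wpos: "w > 0"
      using Mpos by (auto intro: less_le_trans[of 0 "1 / M"])
    have iz: "1 / z \<le> M" "1 / w \<le> M"
      using z w zpos wpos Mpos by (auto simp: divide_le_eq mult.commute)
    have "- (1 / z\<^sup>2) - - (1 / w\<^sup>2) = (z - w) * ((1 / z + 1 / w) * (1 / z) * (1 / w))"
      using zpos wpos by (simp add: field_simps power2_eq_square)
    then have "\<bar>- (1 / z\<^sup>2) - - (1 / w\<^sup>2)\<bar> = \<bar>z - w\<bar> * ((1 / z + 1 / w) * (1 / z) * (1 / w))"
      using zpos wpos by (simp add: abs_mult)
    also have "\<dots> \<le> \<bar>z - w\<bar> * ((M + M) * M * M)"
      using iz zpos wpos Mpos by (intro mult_left_mono mult_mono add_mono) auto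
    finally show "\<bar>- (1 / z\<^sup>2) - - (1 / w\<^sup>2)\<bar> \<le> 2 * M ^ 3 * \<bar>z - w\<bar>"
      by (simp add: power3_eq_cube mult.commute)
  qed
  then have "primitive (\<lambda>x. 1 / C x) (\<lambda>x. - (g x * (1 / C x)\<^sup>2))"
    by (simp add: power_one_over)
  moreover have "AE x in lebesgue. 1 / c x = 1 / C x"
    using C(2) by eventually_elim simp
  moreover have "1 / C x \<le> M" for x
    using CM[of x] Cpos[of x] by (simp add: divide_le_eq)
  ultimately show ?thesis
    using Cpos C1 gm D(2) by (intro that[of "\<lambda>x. 1 / C x" g]) (auto simp: M_def D_def g_def)
qed

section \<open>Decay of the weighted energy\<close>

lemma multiplier_slowness:
  assumes q: "primitive q q'" "bounded_weight q" "bounded_weight q'"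
    and a: "primitive a a'" "bounded_weight a" "bounded_weight a'"
    and b: "primitive b b'" "bounded_weight b" "bounded_weight b'"
  shows "multiplier (\<lambda>x. (q x)\<^sup>2) a a' b b' (\<lambda>x. b' x * (q x)\<^sup>2 + b x * (2 * q x * q' x))"
proof -
  have "primitive (\<lambda>x. b x * (q x * q x)) (\<lambda>x. b' x * (q x * q x) + b x * (q' x * q x + q x * q' x))"
    by (intro primitive_mult b q)
  then have "primitive (\<lambda>x. b x * (q x)\<^sup>2) (\<lambda>x. b' x * (q x)\<^sup>2 + b x * (2 * q x * q' x))"
    by (simp add: power2_eq_square algebra_simps)
  moreover have "bounded_weight (\<lambda>x. b' x * (q x * q x) + b x * (2 * (q x * q' x)))"
    by (intro bounded_weight_add bounded_weight_mult bounded_weight_const b q)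
  ultimately show ?thesis
    using a b by (simp add: multiplier_def power2_eq_square mult.assoc)
qed

text \<open>
  Where the speed is one, a wave splits into the parts with energy densities \<open>(v + \<sigma> w)\<^sup>2 / 4\<close>,
  moving inward, and \<open>(v - \<sigma> w)\<^sup>2 / 4\<close>, moving outward, where \<open>\<sigma>\<close> is the sign of the position.
  In these terms the quadratic forms of the weights are diagonal.
\<close>

lemma split_form:
  fixes \<sigma> a b v w :: real
  assumes "\<sigma> = 1 \<or> \<sigma> = -1"
  shows "a * (v\<^sup>2 + w\<^sup>2) / 2 + b * v * w
      = (a + \<sigma> * b) * ((v + \<sigma> * w)\<^sup>2 / 4) + (a - \<sigma> * b) * ((v - \<sigma> * w)\<^sup>2 / 4)"
  using assms by (auto simp: power2_eq_square field_simps)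

lemma split_form_le:
  fixes \<sigma> a b a' b' v w :: real
  assumes "\<sigma> = 1 \<or> \<sigma> = -1" "a + \<sigma> * b \<le> a' + \<sigma> * b'" "a - \<sigma> * b \<le> a' - \<sigma> * b'"
  shows "a * (v\<^sup>2 + w\<^sup>2) / 2 + b * v * w \<le> a' * (v\<^sup>2 + w\<^sup>2) / 2 + b' * v * w"
  unfolding split_form[OF assms(1)] by (intro add_mono mult_right_mono assms(2,3)) auto

text \<open>
  In \<open>|x| \<le> R\<close> the energy has the weight \<open>K + \<kappa> t\<close> and the momentum the weight \<open>x\<close>.  The
  momentum contributes a loss of at least \<open>\<kappa>\<close> times the energy there, because \<open>x c' / c\<close> is at
  most \<open>L M D\<close>, which is half of \<open>1 - \<kappa>\<close>; this pays for the growth of the first weight.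

  For \<open>|x| > R\<close> the inward moving energy has the weight
  \<open>K + R + 2 \<kappa> m + \<kappa> t (1 - m / T)\<close> with \<open>m = ramp R T x\<close>, and the outward moving energy has the
  weight \<open>K - R - \<kappa> m + \<kappa> t (1 - m)\<close> with \<open>m = ramp R 1 x\<close>.  Both fit continuously to the weights
  inside and decrease along the characteristics of their part.  The ramps keep the weights bounded,
  as the identities require; still, the initial weights grow at most linearly in \<open>x\<close> with a
  constant that does not depend on \<open>T\<close>, and the final weights are nonnegative.
\<close>

lemma weighted_energy_decay:
  fixes q g :: "real \<Rightarrow> real"
  assumes c: "(\<lambda>x. 1 / c x) \<in> borel_measurable lebesgue" "AE x in lebesgue. 1 / c x = q x"
    and q: "primitive q (\<lambda>x. - (g x * (q x)\<^sup>2))" "\<And>x. q x > 0" "\<And>x. q x \<le> M" "\<And>x. \<bar>x\<bar> > L \<Longrightarrow> q x = 1"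
    and g: "g \<in> borel_measurable lebesgue" "\<And>x. \<bar>g x\<bar> \<le> D" "\<And>x. \<bar>x\<bar> > L \<Longrightarrow> g x = 0"
    and LR: "0 < L" "L < R" and \<kappa>: "\<kappa> = 1 - 2 * L * M * D" "\<kappa> > 0"
    and u: "u \<in> C_H1" "u \<in> C1_L2" "wave_equation c u" and T: "T \<ge> 1"
    and f: "f = time_deriv u 0" "h = weak_deriv (u 0)"
    and weighted: "integrable lebesgue (\<lambda>x. (1 + \<bar>x\<bar>) * ((q x)\<^sup>2 * (f x)\<^sup>2 + (h x)\<^sup>2))"
  shows "\<kappa> * T * local_energy c u R T
      \<le> (2 * R * M + R + 2 * M + 2) / 2 * (LINT x|lebesgue. (1 + \<bar>x\<bar>) * ((q x)\<^sup>2 * (f x)\<^sup>2 + (h x)\<^sup>2))"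
proof -
  define K where "K = R * M + R + 1"
  define \<rho> where "\<rho> = (\<lambda>x. (q x)\<^sup>2)"
  define q' where "q' = (\<lambda>x. - (g x * (q x)\<^sup>2))"
  have R: "R > 0" and T0: "T > 0"
    using LR T by auto
  have Mpos: "M > 0"
    using q(2,3) less_le_trans by blast
  have D0: "D \<ge> 0"
    using g(2)[of 0] by simp
  have \<kappa>1: "\<kappa> \<le> 1"
    unfolding \<kappa>(1) using LR Mpos D0 by simp
  note pT = weight_derivatives[OF R T0] and p1 = weight_derivatives[OF R zero_less_one]
  note bdT = weights_bounded[OF R T0] and bd1 = weights_bounded[OF R zero_less_one]
  have bq: "bounded_weight q"
    unfolding bounded_weight_def
    using q(2,3) by (auto intro!: exI[of _ M] borel_imp_lebesgue_measurable borel_measurable_continuous_onI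
        primitive_continuous[OF q(1)] simp: less_imp_le)
  have bg: "bounded_weight g"
    using g by (auto simp: bounded_weight_def)
  have bq': "bounded_weight q'"
    unfolding q'_def power2_eq_square using bounded_weight_cmult[OF bounded_weight_mult[OF bg bounded_weight_mult[OF bq bq]], of "-1"]
    by simp
  have b\<rho>: "bounded_weight \<rho>"
    unfolding \<rho>_def power2_eq_square by (intro bounded_weight_mult bq)
  define a0 where "a0 x = (K + \<kappa> * ramp R T x) - \<kappa> / 2 * ramp R 1 x" for x
  define a0' where "a0' x = (0 + \<kappa> * (sgn x * shell R T x)) - \<kappa> / 2 * (sgn x * shell R 1 x)" for x
  define b0 where "b0 x = (cut (- R) R x + \<kappa> * odd_ramp R T x) + \<kappa> / 2 * odd_ramp R 1 x" for x
  define b0' where "b0' x = (core R x + \<kappa> * shell R T x) + \<kappa> / 2 * shell R 1 x" for x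
  define a1 where "a1 x = (\<kappa> - \<kappa> / (2 * T) * ramp R T x) - \<kappa> / 2 * ramp R 1 x" for x
  define a1' where "a1' x = (0 - \<kappa> / (2 * T) * (sgn x * shell R T x)) - \<kappa> / 2 * (sgn x * shell R 1 x)" for x
  define b1 where "b1 x = \<kappa> / 2 * odd_ramp R 1 x - \<kappa> / (2 * T) * odd_ramp R T x" for x
  define b1' where "b1' x = \<kappa> / 2 * shell R 1 x - \<kappa> / (2 * T) * shell R T x" for x
  define d0 where "d0 x = b0' x * (q x)\<^sup>2 + b0 x * (2 * q x * q' x)" for x
  define d1 where "d1 x = b1' x * (q x)\<^sup>2 + b1 x * (2 * q x * q' x)" for x
  note pr = primitive_add primitive_diff primitive_cmult primitive_const pT p1
  note bw = bounded_weight_add bounded_weight_diff bounded_weight_cmult bounded_weight_const bdT bd1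
  have m0: "multiplier \<rho> a0 a0' b0 b0' d0"
    unfolding \<rho>_def d0_def a0_def a0'_def b0_def b0'_def
    by (rule multiplier_slowness[OF q(1)[folded q'_def] bq bq']) (intro pr bw)+
  have m1: "multiplier \<rho> a1 a1' b1 b1' d1"
    unfolding \<rho>_def d1_def a1_def a1'_def b1_def b1'_def
    by (rule multiplier_slowness[OF q(1)[folded q'_def] bq bq']) (intro pr bw)+
  note bm = m0[unfolded multiplier_def] m1[unfolded multiplier_def]
  have \<rho>AE: "AE x in lebesgue. 1 / (c x)\<^sup>2 = \<rho> x"
    using c(2) by eventually_elim (simp add: \<rho>_def flip: power_one_over)
  have cM: "AE x in lebesgue. \<bar>1 / c x\<bar> \<le> M"
    using c(2) by eventually_elim (use q(2,3) in \<open>auto simp: less_imp_le\<close>)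
  have out: "\<bar>x\<bar> > R \<Longrightarrow> q x = 1 \<and> q' x = 0" for x
    using q(4)[of x] g(3)[of x] LR by (auto simp: q'_def)
  have form: "AE x in lebesgue. \<forall>v w.
        a1 x * (\<rho> x * v\<^sup>2 + w\<^sup>2) / 2 + b1 x * \<rho> x * v * w
        \<le> (a0' x + t * a1' x) * v * w + (b0' x + t * b1' x) * w\<^sup>2 / 2 + (d0 x + t * d1 x) * v\<^sup>2 / 2"
    if t: "0 \<le> t" "t \<le> T" for t
  proof -
    have ne: "AE x in lebesgue. x \<noteq> r" for r :: real
      by (intro AE_completion AE_lborel_singleton)
    have "AE x in lebesgue. \<bar>x\<bar> \<noteq> R \<and> \<bar>x\<bar> \<noteq> R + 1 \<and> \<bar>x\<bar> \<noteq> R + T"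
      using ne[of R] ne[of "- R"] ne[of "R + 1"] ne[of "- (R + 1)"] ne[of "R + T"] ne[of "- (R + T)"]
    proof eventually_elim
      case (elim x)
      then show ?case
        by (cases "x \<ge> 0") auto
    qed
    then show ?thesis
    proof eventually_elim
      case (elim x)
      show ?case
      proof (intro allI)
        fix v w :: real
        show "a1 x * (\<rho> x * v\<^sup>2 + w\<^sup>2) / 2 + b1 x * \<rho> x * v * w
          \<le> (a0' x + t * a1' x) * v * w + (b0' x + t * b1' x) * w\<^sup>2 / 2 + (d0 x + t * d1 x) * v\<^sup>2 / 2"
        proof (cases "\<bar>x\<bar> < R")
          case True
          have z: "ramp R l x = 0" "odd_ramp R l x = 0" "shell R l x = 0" if "l > 0" for l
            using True that by (auto simp: ramp_def odd_ramp_def cut_def shell_def min_def max_def)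
          have i: "core R x = 1" "cut (- R) R x = x"
            using True by (auto simp: core_def cut_def)
          have "\<kappa> * (q x)\<^sup>2 \<le> (q x)\<^sup>2 + x * (2 * q x * q' x)"
          proof -
            have "x * g x * q x \<le> L * D * M"
            proof (cases "\<bar>x\<bar> > L")
              case False
              have "x * g x * q x \<le> \<bar>x\<bar> * \<bar>g x\<bar> * q x"
                using q(2)[of x] by (metis abs_ge_self abs_mult less_imp_le mult_right_mono)
              also have "\<dots> \<le> L * D * M"
                using False q(2,3)[of x] g(2)[of x] LR D0 by (intro mult_mono) auto
              finally show ?thesis .
            qed (use g(3) LR D0 Mpos in simp)
            then have "\<kappa> \<le> 1 - 2 * (x * g x * q x)"
              unfolding \<kappa>(1) by (simp add: mult.commute mult.left_commute)
            then have "\<kappa> * (q x)\<^sup>2 \<le> (1 - 2 * (x * g x * q x)) * (q x)\<^sup>2"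
              by (intro mult_right_mono) auto
            also have "\<dots> = (q x)\<^sup>2 + x * (2 * q x * q' x)"
              by (simp add: q'_def power2_eq_square algebra_simps)
            finally show ?thesis .
          qed
          from mult_right_mono[OF this, of "v\<^sup>2"] mult_right_mono[OF \<kappa>1, of "w\<^sup>2"]
          have "\<kappa> * ((q x)\<^sup>2 * v\<^sup>2 + w\<^sup>2) / 2 \<le> w\<^sup>2 / 2 + ((q x)\<^sup>2 + x * (2 * q x * q' x)) * v\<^sup>2 / 2"
            by (simp add: algebra_simps add_divide_distrib)
          then show ?thesis
            using z T0 i by (simp add: a1_def b1_def a0'_def a1'_def b0'_def b1'_def d0_def d1_def b0_def \<rho>_def)
        next
          case False
          with elim have x: "\<bar>x\<bar> > R" by simp
          define \<sigma> where "\<sigma> = sgn x"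
          have \<sigma>: "\<sigma> = 1 \<or> \<sigma> = -1"
            using x R by (auto simp: \<sigma>_def sgn_real_def)
          then have \<sigma>2: "\<sigma> * (\<sigma> * r) = r" for r
            by auto
          have i: "core R x = 0"
            using x by (auto simp: core_def)
          have o: "odd_ramp R l x = \<sigma> * ramp R l x" if "l > 0" for l
            using odd_ramp_eq[OF R that] by (simp add: \<sigma>_def)
          have r: "1 - ramp R l x / l \<le> shell R l x" if "l > 0" "\<bar>x\<bar> \<noteq> R + l" for l
            using that x by (auto simp: ramp_def shell_def min_def max_def field_simps)
          have sh: "0 \<le> shell R l x" for l
            by (simp add: shell_def)
          have tT: "t / T \<le> 1"
            using t T0 by (simp add: divide_le_eq)
          \<comment> \<open>Both sides are diagonal in the inward and the outward moving part; the coefficients are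
            compared one by one.\<close>
          have "a1 x + \<sigma> * b1 x = \<kappa> * (1 - ramp R T x / T)"
            using T0 by (simp add: a1_def b1_def o \<sigma>2 algebra_simps)
          also have "\<dots> \<le> \<kappa> * shell R T x"
            using r[OF T0] elim \<kappa> by (intro mult_left_mono) auto
          also have "\<dots> \<le> \<kappa> * (shell R T x * (2 - t / T))"
            using tT mult_left_mono[OF _ sh[of T], of 1 "2 - t / T"] \<kappa> by (intro mult_left_mono) auto
          also have "\<dots> = (b0' x + t * b1' x) + \<sigma> * (a0' x + t * a1' x)"
            using i T0 by (simp add: b0'_def b1'_def a0'_def a1'_def \<sigma>2 algebra_simps flip: \<sigma>_def)
          finally have X1: "a1 x + \<sigma> * b1 x \<le> (b0' x + t * b1' x) + \<sigma> * (a0' x + t * a1' x)" .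
          have "a1 x - \<sigma> * b1 x = \<kappa> * (1 - ramp R 1 x / 1)"
            using T0 by (simp add: a1_def b1_def o \<sigma>2 algebra_simps)
          also have "\<dots> \<le> \<kappa> * shell R 1 x"
            using r[OF zero_less_one] elim \<kappa> by (intro mult_left_mono) auto
          also have "\<dots> \<le> \<kappa> * (shell R 1 x * (1 + t))"
            using t sh[of 1] \<kappa> by (intro mult_left_mono) (auto simp: algebra_simps)
          also have "\<dots> = (b0' x + t * b1' x) - \<sigma> * (a0' x + t * a1' x)"
            using i T0 by (simp add: b0'_def b1'_def a0'_def a1'_def \<sigma>2 algebra_simps flip: \<sigma>_def)
          finally have X2: "a1 x - \<sigma> * b1 x \<le> (b0' x + t * b1' x) - \<sigma> * (a0' x + t * a1' x)" .
          show ?thesis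
            using split_form_le[OF \<sigma> X1 X2, of v w] out[OF x]
            by (simp add: \<rho>_def d0_def d1_def algebra_simps add_divide_distrib)
        qed
      qed
    qed
  qed
  have uL: "time_deriv u t \<in> L2" "weak_deriv (u t) \<in> L2" if "t \<ge> 0" for t
    using C1_L2_D(2)[OF u(2) that] u(1) that H1_D[of "u t"] by (auto simp: C_H1_def)
  have young: "\<bar>\<rho> x * v * w\<bar> \<le> M * (\<rho> x * v\<^sup>2 + w\<^sup>2) / 2" for x v w
  proof -
    have "\<bar>\<rho> x * v * w\<bar> = q x * (\<bar>q x * v\<bar> * \<bar>w\<bar>)"
      using q(2)[of x] by (simp add: \<rho>_def abs_mult power2_eq_square)
    also have "\<dots> \<le> M * (((q x * v)\<^sup>2 + w\<^sup>2) / 2)"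
      using q(2,3)[of x] sum_squares_bound[of "\<bar>q x * v\<bar>" "\<bar>w\<bar>"] Mpos by (intro mult_mono) auto
    finally show ?thesis
      by (simp add: \<rho>_def power_mult_distrib)
  qed
  have e0: "0 \<le> \<rho> x * v\<^sup>2 + w\<^sup>2" for x v w
    by (simp add: \<rho>_def)
  define f1 where "f1 = time_deriv u T"
  define h1 where "h1 = weak_deriv (u T)"
  have L1: "f1 \<in> L2" "h1 \<in> L2" and L0: "f \<in> L2" "h \<in> L2"
    using uL[of T] uL[of 0] T0 by (auto simp: f1_def h1_def f)
  have decr: "energy \<rho> a0 b0 (cls f1) (cls h1) + T * energy \<rho> a1 b1 (cls f1) (cls h1) \<le> energy \<rho> a0 b0 (cls f) (cls h)"
    unfolding f f1_def h1_def
    by (rule energy_decreasing_weak[OF c(1) cM b\<rho> \<rho>AE u m0 m1 _ form]) (use T0 in auto)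
  note ramp0 = ramp_bounds[OF R T0] and ramp1 = ramp_bounds[OF R zero_less_one]
  note E0 = energy_eq_integral[OF b\<rho>, of a0 b0] and E1 = energy_eq_integral[OF b\<rho>, of a1 b1]
  \<comment> \<open>At the final time the weights dominate \<open>\<kappa> T\<close> times the local energy density.\<close>
  have lower: "\<kappa> * T * local_energy c u R T \<le> energy \<rho> a0 b0 (cls f1) (cls h1) + T * energy \<rho> a1 b1 (cls f1) (cls h1)"
  proof -
    let ?J = "indicator {-R..R} :: real \<Rightarrow> real"
    let ?I0 = "\<lambda>x. a0 x * (\<rho> x * (f1 x)\<^sup>2 + (h1 x)\<^sup>2) / 2 + b0 x * \<rho> x * f1 x * h1 x"
    let ?I1 = "\<lambda>x. a1 x * (\<rho> x * (f1 x)\<^sup>2 + (h1 x)\<^sup>2) / 2 + b1 x * \<rho> x * f1 x * h1 x"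
    let ?P = "\<lambda>x. 1 / 2 * (?J x * (\<rho> x * (f1 x)\<^sup>2 + (h1 x)\<^sup>2))"
    have bJ: "bounded_weight ?J"
      by (auto simp: bounded_weight_def indicator_def intro!: exI[of _ 1] borel_measurable_indicator)
    have Pi: "integrable lebesgue ?P"
      using bounded_weight_integrable[OF bounded_weight_mult[OF bJ b\<rho>] L1(1) L1(1)]
        bounded_weight_integrable[OF bJ L1(2) L1(2)]
      by (auto simp: power2_eq_square distrib_left mult.assoc)
    have "local_energy c u R T = 1 / 2 * (LINT x|lebesgue. ?J x * (\<rho> x * (f1 x)\<^sup>2 + (h1 x)\<^sup>2))"
      unfolding local_energy_def set_lebesgue_integral_def f1_def[symmetric] h1_def[symmetric]
    proof (intro arg_cong[where f = "\<lambda>r. 1 / 2 * r"] integral_cong_AE)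
      show "AE x in lebesgue. indicator {x. \<bar>x\<bar> \<le> R} x *\<^sub>R (1 / (c x)\<^sup>2 * \<bar>f1 x\<bar>\<^sup>2 + \<bar>h1 x\<bar>\<^sup>2)
          = ?J x * (\<rho> x * (f1 x)\<^sup>2 + (h1 x)\<^sup>2)"
        using \<rho>AE by eventually_elim (auto simp: indicator_def)
      show "(\<lambda>x. ?J x * (\<rho> x * (f1 x)\<^sup>2 + (h1 x)\<^sup>2)) \<in> borel_measurable lebesgue"
        using borel_measurable_integrable[OF integrable_mult_right[OF Pi, of 2]] by simp
      have "{x. \<bar>x\<bar> \<le> R} = {-R..R}"
        by auto
      moreover have "(\<lambda>x. indicator {-R..R} x *\<^sub>R ((1 / c x)\<^sup>2 * (f1 x)\<^sup>2 + (h1 x)\<^sup>2)) \<in> borel_measurable lebesgue"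
        using L2_D(1)[OF L1(1)] L2_D(1)[OF L1(2)] c(1)
        by (intro borel_measurable_scaleR borel_measurable_indicator borel_measurable_add borel_measurable_times borel_measurable_power) auto
      ultimately show "(\<lambda>x. indicator {x. \<bar>x\<bar> \<le> R} x *\<^sub>R (1 / (c x)\<^sup>2 * \<bar>f1 x\<bar>\<^sup>2 + \<bar>h1 x\<bar>\<^sup>2)) \<in> borel_measurable lebesgue"
        by (simp add: power_one_over)
    qed
    then have "\<kappa> * T * local_energy c u R T = (LINT x|lebesgue. \<kappa> * T * ?P x)"
      by simp
    also have "\<dots> \<le> (LINT x|lebesgue. ?I0 x + T * ?I1 x)"
    proof (rule integral_mono)
      show "integrable lebesgue (\<lambda>x. ?I0 x + T * ?I1 x)"
        using E0(2)[OF _ _ L1] E1(2)[OF _ _ L1] bm by auto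
      fix x
      have eq: "?I0 x + T * ?I1 x
          = (a0 x + T * a1 x) * (\<rho> x * (f1 x)\<^sup>2 + (h1 x)\<^sup>2) / 2 + (b0 x + T * b1 x) * \<rho> x * f1 x * h1 x"
        by (simp add: algebra_simps add_divide_distrib)
      show "\<kappa> * T * ?P x \<le> ?I0 x + T * ?I1 x"
      proof (cases "\<bar>x\<bar> \<le> R")
        case True
        have z: "ramp R l x = 0" "odd_ramp R l x = 0" if "l > 0" for l
          using True that R by (auto simp: ramp_def odd_ramp_def cut_def min_def max_def)
        have i: "cut (- R) R x = x" "?J x = 1"
          using True by (auto simp: cut_def indicator_def)
        have "\<bar>x\<bar> * \<bar>\<rho> x * f1 x * h1 x\<bar> \<le> R * (M * (\<rho> x * (f1 x)\<^sup>2 + (h1 x)\<^sup>2) / 2)"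
          using True young[of x "f1 x" "h1 x"] R by (intro mult_mono) auto
        then have "\<bar>x * (\<rho> x * f1 x * h1 x)\<bar> \<le> R * M * (\<rho> x * (f1 x)\<^sup>2 + (h1 x)\<^sup>2) / 2"
          unfolding abs_mult by (simp add: mult.assoc)
        also have "\<dots> \<le> K * (\<rho> x * (f1 x)\<^sup>2 + (h1 x)\<^sup>2) / 2"
          using R e0[of x "f1 x" "h1 x"] by (intro divide_right_mono mult_right_mono) (auto simp: K_def)
        finally have "0 \<le> K * (\<rho> x * (f1 x)\<^sup>2 + (h1 x)\<^sup>2) / 2 + x * (\<rho> x * f1 x * h1 x)"
          by linarith
        moreover have "?I0 x + T * ?I1 x = \<kappa> * T * ?P x
            + (K * (\<rho> x * (f1 x)\<^sup>2 + (h1 x)\<^sup>2) / 2 + x * (\<rho> x * f1 x * h1 x))"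
          unfolding a0_def a1_def b0_def b1_def using z T0
          by (simp add: i algebra_simps add_divide_distrib)
        ultimately show ?thesis by linarith
      next
        case False
        then have x: "\<bar>x\<bar> > R" by simp
        define \<sigma> where "\<sigma> = sgn x"
        have \<sigma>: "\<sigma> = 1 \<or> \<sigma> = -1"
          using x R by (auto simp: \<sigma>_def sgn_real_def)
        then have \<sigma>2: "\<sigma> * (\<sigma> * r) = r" "\<sigma> * \<sigma> = 1" for r
          by auto
        have o: "odd_ramp R l x = \<sigma> * ramp R l x" if "l > 0" for l
          using odd_ramp_eq[OF R that] by (simp add: \<sigma>_def)
        have cl: "cut (- R) R x = \<sigma> * R"
          using x R by (auto simp: cut_def \<sigma>_def sgn_real_def min_def max_def)
        have "(a0 x + T * a1 x) + \<sigma> * (b0 x + T * b1 x) = K + R + \<kappa> * ramp R T x + \<kappa> * T"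
          using T0 by (simp add: a0_def a1_def b0_def b1_def o cl \<sigma>2 algebra_simps)
        moreover have "0 \<le> K + R + \<kappa> * ramp R T x + \<kappa> * T"
          using R Mpos \<kappa> T0 ramp0 by (simp add: K_def)
        ultimately have n1: "0 \<le> (a0 x + T * a1 x) + \<sigma> * (b0 x + T * b1 x)"
          by simp
        have "\<kappa> * ramp R 1 x \<le> 1 * 1"
          using \<kappa> \<kappa>1 ramp1 by (intro mult_mono) auto
        moreover have "\<kappa> * T * ramp R 1 x \<le> \<kappa> * T * 1"
          using \<kappa> T0 ramp1 by (intro mult_left_mono) auto
        moreover have "0 \<le> R * M"
          using R Mpos by simp
        ultimately have "0 \<le> (K - R - \<kappa> * ramp R 1 x) + (\<kappa> * T - \<kappa> * T * ramp R 1 x)"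
          unfolding K_def by linarith
        also have "\<dots> = (a0 x + T * a1 x) - \<sigma> * (b0 x + T * b1 x)"
          using T0 by (simp add: a0_def a1_def b0_def b1_def o cl \<sigma>2 algebra_simps)
        finally have n2: "0 \<le> (a0 x + T * a1 x) - \<sigma> * (b0 x + T * b1 x)" .
        have "0 \<le> (a0 x + T * a1 x) * ((f1 x)\<^sup>2 + (h1 x)\<^sup>2) / 2 + (b0 x + T * b1 x) * f1 x * h1 x"
          unfolding split_form[OF \<sigma>] by (intro add_nonneg_nonneg mult_nonneg_nonneg[OF n1] mult_nonneg_nonneg[OF n2]) auto
        moreover have "?J x = 0"
          using x by (auto simp: indicator_def)
        ultimately show ?thesis
          unfolding eq using out[OF x] by (simp add: \<rho>_def)
      qed
    qed (rule integrable_mult_right[OF Pi])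
    also have "\<dots> = energy \<rho> a0 b0 (cls f1) (cls h1) + T * energy \<rho> a1 b1 (cls f1) (cls h1)"
      using E0[OF _ _ L1] E1[OF _ _ L1] bm by simp
    finally show ?thesis .
  qed
  \<comment> \<open>At the initial time the weights grow at most linearly.\<close>
  have upper: "energy \<rho> a0 b0 (cls f) (cls h)
      \<le> (K + R * M + 2 * M + 1) / 2 * (LINT x|lebesgue. (1 + \<bar>x\<bar>) * ((q x)\<^sup>2 * (f x)\<^sup>2 + (h x)\<^sup>2))"
  proof -
    have "energy \<rho> a0 b0 (cls f) (cls h)
        = (LINT x|lebesgue. a0 x * (\<rho> x * (f x)\<^sup>2 + (h x)\<^sup>2) / 2 + b0 x * \<rho> x * f x * h x)"
      using E0(1)[OF _ _ L0] bm by simp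
    also have "\<dots> \<le> (LINT x|lebesgue. (K + R * M + 2 * M + 1) / 2 * ((1 + \<bar>x\<bar>) * ((q x)\<^sup>2 * (f x)\<^sup>2 + (h x)\<^sup>2)))"
    proof (rule integral_mono)
      show "integrable lebesgue (\<lambda>x. a0 x * (\<rho> x * (f x)\<^sup>2 + (h x)\<^sup>2) / 2 + b0 x * \<rho> x * f x * h x)"
        using E0(2)[OF _ _ L0] bm by simp
      fix x
      let ?e = "\<rho> x * (f x)\<^sup>2 + (h x)\<^sup>2"
      have k0: "\<kappa> * ramp R T x \<le> 1 * \<bar>x\<bar>" "\<kappa> * ramp R 1 x \<le> 1 * \<bar>x\<bar>"
        by (rule mult_mono[OF \<kappa>1 ramp0(3)] mult_mono[OF \<kappa>1 ramp1(3)]; use ramp0 ramp1 in simp)+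
      have k1: "0 \<le> \<kappa> * ramp R T x" "0 \<le> \<kappa> * ramp R 1 x"
        using \<kappa> ramp0 ramp1 by auto
      have A: "a0 x \<le> K + \<bar>x\<bar>"
        using k0 k1 by (simp add: a0_def)
      have so: "\<bar>odd_ramp R l x\<bar> \<le> ramp R l x" if "l > 0" for l
        using odd_ramp_eq[OF R that] ramp_bounds[OF R that] by (auto simp: abs_mult sgn_real_def)
      have "\<bar>b0 x\<bar> \<le> \<bar>cut (- R) R x\<bar> + \<bar>\<kappa> * odd_ramp R T x\<bar> + \<bar>\<kappa> / 2 * odd_ramp R 1 x\<bar>"
        unfolding b0_def by linarith
      also have "\<dots> \<le> R + \<kappa> * ramp R T x + \<kappa> * ramp R 1 x"
      proof -
        have "\<bar>cut (- R) R x\<bar> \<le> R"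
          using R by (auto simp: cut_def)
        moreover have "\<bar>\<kappa> * odd_ramp R T x\<bar> \<le> \<kappa> * ramp R T x"
          using so[OF T0] \<kappa> by (simp add: abs_mult)
        moreover have "\<bar>\<kappa> * odd_ramp R 1 x\<bar> \<le> \<kappa> * ramp R 1 x"
          using so[OF zero_less_one] \<kappa> by (simp add: abs_mult)
        ultimately show ?thesis
          using k1 by simp
      qed
      finally have B: "\<bar>b0 x\<bar> \<le> R + 2 * \<bar>x\<bar>"
        using k0 by linarith
      have "b0 x * (\<rho> x * f x * h x) \<le> \<bar>b0 x\<bar> * \<bar>\<rho> x * f x * h x\<bar>"
        by (metis abs_ge_self abs_mult)
      also have "\<dots> \<le> (R + 2 * \<bar>x\<bar>) * (M * ?e / 2)"
        using B young[of x "f x" "h x"] R by (intro mult_mono) auto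
      finally have C: "b0 x * (\<rho> x * f x * h x) \<le> (R + 2 * \<bar>x\<bar>) * M * ?e / 2"
        by (simp add: mult.assoc)
      have "a0 x * ?e / 2 + b0 x * (\<rho> x * f x * h x) \<le> (K + \<bar>x\<bar>) * ?e / 2 + (R + 2 * \<bar>x\<bar>) * M * ?e / 2"
        using A C e0[of x "f x" "h x"] by (intro add_mono divide_right_mono mult_right_mono) auto
      also have "\<dots> = (K + \<bar>x\<bar> + (R + 2 * \<bar>x\<bar>) * M) * ?e / 2"
        by (simp add: algebra_simps add_divide_distrib)
      also have "\<dots> \<le> (K + R * M + 2 * M + 1) * (1 + \<bar>x\<bar>) * ?e / 2"
      proof (intro divide_right_mono mult_right_mono e0)
        have "0 \<le> (K + R * M) * \<bar>x\<bar>"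
          using R Mpos by (simp add: K_def)
        then show "K + \<bar>x\<bar> + (R + 2 * \<bar>x\<bar>) * M \<le> (K + R * M + 2 * M + 1) * (1 + \<bar>x\<bar>)"
          using Mpos by (simp add: algebra_simps)
      qed simp
      finally show "a0 x * ?e / 2 + b0 x * \<rho> x * f x * h x
          \<le> (K + R * M + 2 * M + 1) / 2 * ((1 + \<bar>x\<bar>) * ((q x)\<^sup>2 * (f x)\<^sup>2 + (h x)\<^sup>2))"
        by (simp add: \<rho>_def mult.assoc)
    qed (use weighted in simp)
    finally show ?thesis
      by simp
  qed
  show ?thesis
  proof -
    have eq: "K + R * M + 2 * M + 1 = 2 * R * M + R + 2 * M + 2"
      by (simp add: K_def)
    show ?thesis
      using lower decr upper unfolding eq by linarith
  qed
qed

section \<open>Decay of the local energy\<close>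

theorem theorem1p4:
  fixes c u0 u1 :: "real \<Rightarrow> real" and u :: "real \<Rightarrow> real \<Rightarrow> real" and L \<eta> :: real
  assumes c_pos: "\<And>x. c x > 0"
    and c_bdd: "c \<in> Linf"
    and c_inv_bdd: "(\<lambda>x. 1 / c x) \<in> Linf"
    and c_diff: "weakly_differentiable c"
    and c_deriv_bdd: "weak_deriv c \<in> Linf"
    and L_pos: "L > 0"
    and c_outside: "\<And>x. \<bar>x\<bar> > L \<Longrightarrow> c x = 1"
    and eta_def: "\<eta> = 2 * L * Linf_norm (\<lambda>x. 1 / c x) * Linf_norm (weak_deriv c)"
    and eta_range: "\<eta> \<in> {0..<1}"
    and u0: "u0 \<in> H1"
    and u1: "u1 \<in> L2"
    and weighted: "integrable lebesgue
      (\<lambda>x. (1 + \<bar>x\<bar>) * (1 / (c x)\<^sup>2 * \<bar>u1 x\<bar>\<^sup>2 + \<bar>weak_deriv u0 x\<bar>\<^sup>2))"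
    and sol: "weak_solution c u0 u1 u"
  shows "\<forall>R>L. (\<lambda>t. local_energy c u R t) \<in> O[at_top](\<lambda>t. t powr (- (1 - \<eta>)))"
proof (intro allI impI)
  fix R assume "L < R"
  have u: "u \<in> C_H1" "u \<in> C1_L2" "wave_equation c u"
    and init: "AE x in lebesgue. u 0 x = u0 x" "AE x in lebesgue. time_deriv u 0 x = u1 x"
    using sol by (auto simp: weak_solution_def)
  define M where "M = Linf_norm (\<lambda>x. 1 / c x)"
  define D where "D = Linf_norm (weak_deriv c)"
  obtain q g where q: "primitive q (\<lambda>x. - (g x * (q x)\<^sup>2))" "AE x in lebesgue. 1 / c x = q x"
      "\<And>x. q x > 0" "\<And>x. q x \<le> M" "\<And>x. \<bar>x\<bar> > L \<Longrightarrow> q x = 1"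
    and g: "\<And>x. \<bar>g x\<bar> \<le> D" "\<And>x. \<bar>x\<bar> > L \<Longrightarrow> g x = 0" "g \<in> borel_measurable lebesgue"
    by (rule slowness_representative[OF c_inv_bdd c_pos c_diff c_deriv_bdd c_outside L_pos,
          folded M_def D_def], assumption) (rule that)
  define f where "f = time_deriv u 0"
  define h where "h = weak_deriv (u 0)"
  have fL: "f \<in> L2"
    using C1_L2_D(2)[OF u(2), of 0] by (simp add: f_def)
  have uH: "u 0 \<in> H1"
    using u(1) by (auto simp: C_H1_def)
  note h = H1_D[OF uH, folded h_def] and h0 = H1_D[OF u0]
  have hAE: "AE x in lebesgue. weak_deriv u0 x = h x"
  proof (rule has_weak_deriv_unique[OF h0(3)])
    show "has_weak_deriv u0 h"
      by (rule has_weak_deriv_cong_AE[OF h(3) init(1)])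
        (auto intro: L2_locally_integrable h(2) h0(1))
  qed
  have cm: "(\<lambda>x. 1 / c x) \<in> borel_measurable lebesgue"
    using c_inv_bdd by (simp add: Linf_def)
  have qm: "q \<in> borel_measurable lebesgue"
    by (intro borel_imp_lebesgue_measurable borel_measurable_continuous_onI primitive_continuous[OF q(1)])
  have weighted': "integrable lebesgue (\<lambda>x. (1 + \<bar>x\<bar>) * ((q x)\<^sup>2 * (f x)\<^sup>2 + (h x)\<^sup>2))"
  proof (rule integrable_cong_AE_imp[OF weighted])
    have w: "(\<lambda>x::real. 1 + \<bar>x\<bar>) \<in> borel_measurable lebesgue"
      by (intro borel_imp_lebesgue_measurable) simp
    show "(\<lambda>x. (1 + \<bar>x\<bar>) * ((q x)\<^sup>2 * (f x)\<^sup>2 + (h x)\<^sup>2)) \<in> borel_measurable lebesgue"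
      by (intro borel_measurable_times[OF w] borel_measurable_times borel_measurable_add
          borel_measurable_power qm L2_D(1)[OF fL] L2_D(1)[OF h(2)])
    show "AE x in lebesgue. (1 + \<bar>x\<bar>) * (1 / (c x)\<^sup>2 * \<bar>u1 x\<bar>\<^sup>2 + \<bar>weak_deriv u0 x\<bar>\<^sup>2)
        = (1 + \<bar>x\<bar>) * ((q x)\<^sup>2 * (f x)\<^sup>2 + (h x)\<^sup>2)"
      using hAE init(2) q(2) by eventually_elim (simp add: f_def flip: power_one_over)
  qed
  define N where "N = (2 * R * M + R + 2 * M + 2) / 2
    * (LINT x|lebesgue. (1 + \<bar>x\<bar>) * ((q x)\<^sup>2 * (f x)\<^sup>2 + (h x)\<^sup>2))"
  define C where "C = N / (1 - \<eta>)"
  have \<eta>: "1 - \<eta> > 0" "\<eta> \<ge> 0" "1 - \<eta> = 1 - 2 * L * M * D"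
    using eta_range eta_def by (auto simp: M_def D_def)
  have bound: "local_energy c u R t \<le> C / t" if t: "t \<ge> 1" for t
  proof -
    have "(1 - \<eta>) * t * local_energy c u R t \<le> N"
      unfolding N_def
      by (rule weighted_energy_decay[OF cm q(2,1,3,4,5) g(3,1,2) L_pos \<open>L < R\<close> \<eta>(3,1) u t f_def h_def weighted'])
    also have "N = C * (1 - \<eta>)"
      using \<eta>(1) by (simp add: C_def)
    finally have "(1 - \<eta>) * (t * local_energy c u R t) \<le> (1 - \<eta>) * C"
      by (simp add: mult.commute mult.left_commute)
    then have "t * local_energy c u R t \<le> C"
      using \<eta>(1) by simp
    then show ?thesis
      using t by (simp add: pos_le_divide_eq mult.commute)
  qed
  have nonneg: "local_energy c u R t \<ge> 0" for t
    unfolding local_energy_def set_lebesgue_integral_def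
    by (intro mult_nonneg_nonneg integral_nonneg_AE) (auto simp: indicator_def)
  show "(\<lambda>t. local_energy c u R t) \<in> O[at_top](\<lambda>t. t powr (- (1 - \<eta>)))"
  proof (rule bigoI[where c = "\<bar>C\<bar>"])
    show "\<forall>\<^sub>F t in at_top. norm (local_energy c u R t) \<le> \<bar>C\<bar> * norm (t powr (- (1 - \<eta>)))"
      using eventually_ge_at_top[of 1]
    proof eventually_elim
      case (elim t)
      have "local_energy c u R t \<le> C * t powr (- 1)"
        using bound[OF elim] elim by (simp add: powr_minus_divide)
      also have "\<dots> \<le> \<bar>C\<bar> * t powr (- (1 - \<eta>))"
        using elim \<eta>(2) by (intro mult_mono powr_mono) auto
      finally show ?case
        using nonneg[of t] by simp
    qed
  qed
qed

end
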